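(* Let $1\leq l\leq l'<n$, $\lambda\in I_l$, $\lambda'\in I_{l'}$, and put $t=l+l'-n-1$. As $D(H_{\mathcal D})$-modules: (1) If $t<0$, then $V(l,\lambda)\otimes V(l',\lambda')\cong\bigoplus_{s=0}^{l-1}V(l+l'-1-2s,\phi^s\lambda\lambda')$. (2) If $t\geq 0$, then $$V(l,\lambda)\otimes V(l',\lambda')\cong\Big(\bigoplus_{s=c(t)}^{t}P(l+l'-1-2s,\phi^s\lambda\lambda')\Big)\oplus\Big(\bigoplus_{t+1\leq s\leq l-1}V(l+l'-1-2s,\phi^s\lambda\lambda')\Big).$$
   Context: Let $\Bbbk$ be an algebraically closed field of characteristic $0$; all modules are finite-dimensional left modules. $\mathcal D=(G,\chi,a,\alpha)$ is a group datum with $G$ abelian: $G$ is a finite abelian group, $\chi\in\Gamma:=\mathrm{Hom}(G,\Bbbk^\times)$, $a\in G$, $\alpha\in\Bbbk$, and, with $\rho=\chi(a)$ of order $n\geq 2$, either $\chi^n=1$ or $\alpha(a^n-1)=0$. $\mathcal D$ is of nilpotent type if $\alpha(a^n-1)=0$, and of non-nilpotent type if $\alpha(a^n-1)\neq0$ and $\chi^n=1$ (then $\alpha=1$ is assumed). Put $(i)_\rho=1+\rho+\cdots+\rho^{i-1}$, $(i)!_\rho=(i)_\rho\cdots(1)_\rho$, $(0)!_\rho=1$. The Drinfeld double $D(H_{\mathcal D})$ is the Hopf algebra generated as an algebra by the groups $G,\Gamma$ and elements $x,\xi$, with the group relations of $G$ and $\Gamma$ and: $x^n=\alpha(a^n-1)$,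 $xg=\chi(g)gx$, $\xi^n=0$, $\xi\gamma=\gamma(a)\gamma\xi$, $g\gamma=\gamma g$, $\xi g=\chi^{-1}(g)g\xi$, $x\xi-\xi x=a-\chi$, and $\gamma(a)x\gamma=\gamma x$ in the nilpotent case, $\gamma(a)x\gamma=\gamma x+\frac{\gamma^n(a)-1}{(n-1)!_\rho}\gamma(\rho a-\chi)\xi^{n-1}$ in the non-nilpotent case ($g\in G,\gamma\in\Gamma$). Comultiplication: $\Delta(g)=g\otimes g$, $\Delta(x)=x\otimes a+1\otimes x$, $\Delta(\xi)=\xi\otimes1+\chi\otimes\xi$, and $\Delta(\gamma)=\gamma\otimes\gamma$ in the nilpotent case, $\Delta(\gamma)=\gamma\otimes\gamma+(\gamma^n(a)-1)\sum_{p+r=n,\,p,r\geq1}\frac{1}{(p)!_\rho(r)!_\rho}\gamma\chi^p\xi^r\otimes\gamma\xi^p$ in the non-nilpotent case. Tensor products of modules are over $\Bbbk$ with action via $\Delta$. $\Lambda$ is the group of characters $G\times\Gamma\to\Bbbk^\times$; $\phi\in\Lambda$ is $\phi(g\gamma)=\chi^{-1}(g)\gamma(a)$. For $1\leq l\leq n-1$, $I_l=\{\lambda\in\Lambda:\lambda(a\chi^{-1})=\rho^{l-1}\}$; $I_n''=\{\lambda\in\Lambda:\lambda(a\chi^{-1})=\rho^{n-1}\}$; $I_n'=\{\lambda\in\Lambda:\lambda(a\chi^{-1})\neq\rho^k\text{ for all }0\leq k\leq n-1\}$; $I_n=I_n'\cup I_n''$. For $1\leq l\leq n$, $\lambda\in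 I_l$, let $\alpha_i(l,\lambda)=(i)_\rho(\lambda(\chi)-\lambda(a)\rho^{1-i})$. $V(l,\lambda)$ is the simple module with basis $v_0,\dots,v_{l-1}$ and $(g\gamma)v_i=(\phi^i\lambda)(g\gamma)v_i$; $xv_i=v_{i+1}$ for $i\leq l-2$; $\xi v_0=0$, $\xi v_i=\alpha_i(l,\lambda)v_{i-1}$ for $i\geq1$; $xv_{l-1}=0$ if $l<n$ or $\mathcal D$ is nilpotent, and $xv_{n-1}=(\lambda(a)^n-1)v_0$ if $l=n$ and $\mathcal D$ is non-nilpotent. These form a complete set of representatives of simple modules. For $1\leq l\leq n-1$, $P(l,\lambda)$ is the projective cover of $V(l,\lambda)$ (of dimension $2n$); $V(n,\lambda)$ is projective and $P(n,\lambda):=V(n,\lambda)$ for $\lambda\in I_n$. For an integer $t$, $c(t)=\lfloor (t+1)/2\rfloor$. Empty direct sums are $0$. *)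

theory Defs
  imports
    "HOL-Algebra.Multiplicative_Group"
    "HOL-Computational_Algebra.Polynomial"
    "Jordan_Normal_Form.Matrix"
begin

section \<open>Characters and group data\<close>

definition units_group :: "'k::field monoid" where
  "units_group = \<lparr>carrier = UNIV - {0}, monoid.mult = (*), monoid.one = 1\<rparr>"

text \<open>Characters are extensional, so that a homomorphism from \<open>H\<close> to the units of the field is the
  same thing as an element of the carrier.\<close>

definition char_group :: "('a, 'b) monoid_scheme \<Rightarrow> ('a \<Rightarrow> 'k::field) monoid" where
  "char_group H =
     \<lparr>carrier = hom H units_group \<inter> extensional (carrier H),
      monoid.mult = (\<lambda>\<gamma> \<delta>. \<lambda>h\<in>carrier H. \<gamma> h * \<delta> h),
      monoid.one = (\<lambda>h\<in>carrier H. 1)\<rparr>"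

record ('g, 'k) group_datum =
  grp :: "'g monoid"
  chi :: "'g \<Rightarrow> 'k"
  pt :: 'g
  alp :: 'k

abbreviation Gam :: "('g, 'k::field) group_datum \<Rightarrow> ('g \<Rightarrow> 'k) monoid" where
  "Gam D \<equiv> char_group (grp D)"

definition rho :: "('g, 'k) group_datum \<Rightarrow> 'k" where
  "rho D = chi D (pt D)"

definition nn :: "('g, 'k::field) group_datum \<Rightarrow> nat" where
  "nn D = group.ord units_group (rho D)"

text \<open>The equation \<open>\<alpha>(a\<^sup>n - 1) = 0\<close> is an equation in the group algebra of \<open>G\<close>, in which distinct
  group elements are linearly independent.\<close>

definition nilpotent_type :: "('g, 'k::field) group_datum \<Rightarrow> bool" where
  "nilpotent_type D \<longleftrightarrow> alp D = 0 \<or> pt D [^]\<^bsub>grp D\<^esub> nn D = \<one>\<^bsub>grp D\<^esub>"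

definition is_group_datum :: "('g, 'k::field) group_datum \<Rightarrow> bool" where
  "is_group_datum D \<longleftrightarrow>
     comm_group (grp D) \<and> finite (carrier (grp D)) \<and>
     chi D \<in> carrier (Gam D) \<and> pt D \<in> carrier (grp D) \<and> nn D \<ge> 2 \<and>
     (chi D [^]\<^bsub>Gam D\<^esub> nn D = \<one>\<^bsub>Gam D\<^esub> \<or> nilpotent_type D) \<and>
     (\<not> nilpotent_type D \<longrightarrow> alp D = 1)"

definition qnum :: "'k::field \<Rightarrow> nat \<Rightarrow> 'k" where
  "qnum q i = (\<Sum>j<i. q ^ j)"

definition qfact :: "'k::field \<Rightarrow> nat \<Rightarrow> 'k" where
  "qfact q i = (\<Prod>j=1..i. qnum q j)"

section \<open>Algebras given by generators and relations\<close>

text \<open>The algebra with generators \<open>X\<close> and relations \<open>R\<close> is the set of terms over \<open>X\<close> modulo the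
  least congruence \<open>alg_eq X R\<close> that contains \<open>R\<close> and makes the terms an associative unital algebra.
  The arithmetic operations on terms are syntactic.\<close>

datatype ('k, 'x) fterm =
    Const 'k
  | Gen 'x
  | Add "('k, 'x) fterm" "('k, 'x) fterm"
  | Mult "('k, 'x) fterm" "('k, 'x) fterm"

instantiation fterm :: (field, type) "{one, plus, minus, times}"
begin
definition "1 = Const 1"
definition "u + v = Add u v"
definition "u * v = Mult u v"
definition "u - v = Add u (Mult (Const (- 1)) v)"
instance ..
end

instance fterm :: (field, type) power ..

definition terms :: "'x set \<Rightarrow> ('k, 'x) fterm set" where
  "terms X = {u. set2_fterm u \<subseteq> X}"

inductive alg_eq ::
  "'x set \<Rightarrow> (('k::field, 'x) fterm \<times> ('k, 'x) fterm) set \<Rightarrow>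
   ('k, 'x) fterm \<Rightarrow> ('k, 'x) fterm \<Rightarrow> bool"
  for X R where
  rel: "(u, v) \<in> R \<Longrightarrow> u \<in> terms X \<Longrightarrow> v \<in> terms X \<Longrightarrow> alg_eq X R u v"
| refl: "u \<in> terms X \<Longrightarrow> alg_eq X R u u"
| sym: "alg_eq X R u v \<Longrightarrow> alg_eq X R v u"
| trans: "alg_eq X R u v \<Longrightarrow> alg_eq X R v w \<Longrightarrow> alg_eq X R u w"
| cong_add: "alg_eq X R u u' \<Longrightarrow> alg_eq X R v v' \<Longrightarrow> alg_eq X R (u + v) (u' + v')"
| cong_mult: "alg_eq X R u u' \<Longrightarrow> alg_eq X R v v' \<Longrightarrow> alg_eq X R (u * v) (u' * v')"
| add_assoc: "u \<in> terms X \<Longrightarrow> v \<in> terms X \<Longrightarrow> w \<in> terms X \<Longrightarrow>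
    alg_eq X R ((u + v) + w) (u + (v + w))"
| add_comm: "u \<in> terms X \<Longrightarrow> v \<in> terms X \<Longrightarrow> alg_eq X R (u + v) (v + u)"
| add_zero: "u \<in> terms X \<Longrightarrow> alg_eq X R (Const 0 + u) u"
| mult_zero: "u \<in> terms X \<Longrightarrow> alg_eq X R (Const 0 * u) (Const 0)"
| mult_assoc: "u \<in> terms X \<Longrightarrow> v \<in> terms X \<Longrightarrow> w \<in> terms X \<Longrightarrow>
    alg_eq X R ((u * v) * w) (u * (v * w))"
| mult_one: "u \<in> terms X \<Longrightarrow> alg_eq X R (1 * u) u"
| distrib_left: "u \<in> terms X \<Longrightarrow> v \<in> terms X \<Longrightarrow> w \<in> terms X \<Longrightarrow>
    alg_eq X R (u * (v + w)) (u * v + u * w)"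
| distrib_right: "u \<in> terms X \<Longrightarrow> v \<in> terms X \<Longrightarrow> w \<in> terms X \<Longrightarrow>
    alg_eq X R ((u + v) * w) (u * w + v * w)"
| const_add: "alg_eq X R (Const c + Const d) (Const (c + d))"
| const_mult: "alg_eq X R (Const c * Const d) (Const (c * d))"
| const_central: "u \<in> terms X \<Longrightarrow> alg_eq X R (Const c * u) (u * Const c)"

section \<open>The Drinfeld double\<close>

datatype ('g, 'k) ddgen = GGen 'g | CGen "'g \<Rightarrow> 'k" | XGen | XiGen

type_synonym ('g, 'k) ddterm = "('k, ('g, 'k) ddgen) fterm"

abbreviation g_el :: "'g \<Rightarrow> ('g, 'k) ddterm" where "g_el g \<equiv> Gen (GGen g)"
abbreviation c_el :: "('g \<Rightarrow> 'k) \<Rightarrow> ('g, 'k) ddterm" where "c_el \<gamma> \<equiv> Gen (CGen \<gamma>)"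
abbreviation x_el :: "('g, 'k) ddterm" where "x_el \<equiv> Gen XGen"
abbreviation xi_el :: "('g, 'k) ddterm" where "xi_el \<equiv> Gen XiGen"

definition dd_gens :: "('g, 'k::field) group_datum \<Rightarrow> ('g, 'k) ddgen set" where
  "dd_gens D = GGen ` carrier (grp D) \<union> CGen ` carrier (Gam D) \<union> {XGen, XiGen}"

definition dd_rels ::
  "('g, 'k::field) group_datum \<Rightarrow> (('g, 'k) ddterm \<times> ('g, 'k) ddterm) set" where
  "dd_rels D = (let G = grp D; \<Gamma> = Gam D; \<chi> = chi D; a = pt D; n = nn D; \<rho> = rho D in
     {(g_el g * g_el h, g_el (g \<otimes>\<^bsub>G\<^esub> h)) | g h. g \<in> carrier G \<and> h \<in> carrier G} \<union>
     {(g_el \<one>\<^bsub>G\<^esub>, 1)} \<union>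
     {(c_el \<gamma> * c_el \<delta>, c_el (\<gamma> \<otimes>\<^bsub>\<Gamma>\<^esub> \<delta>)) | \<gamma> \<delta>. \<gamma> \<in> carrier \<Gamma> \<and> \<delta> \<in> carrier \<Gamma>} \<union>
     {(c_el \<one>\<^bsub>\<Gamma>\<^esub>, 1)} \<union>
     {(x_el ^ n, Const (alp D) * (g_el (a [^]\<^bsub>G\<^esub> n) - 1))} \<union>
     {(x_el * g_el g, Const (\<chi> g) * (g_el g * x_el)) | g. g \<in> carrier G} \<union>
     {(xi_el ^ n, Const 0)} \<union>
     {(xi_el * c_el \<gamma>, Const (\<gamma> a) * (c_el \<gamma> * xi_el)) | \<gamma>. \<gamma> \<in> carrier \<Gamma>} \<union>
     {(g_el g * c_el \<gamma>, c_el \<gamma> * g_el g) | g \<gamma>. g \<in> carrier G \<and> \<gamma> \<in> carrier \<Gamma>} \<union>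
     {(xi_el * g_el g, Const (inverse (\<chi> g)) * (g_el g * xi_el)) | g. g \<in> carrier G} \<union>
     {(x_el * xi_el - xi_el * x_el, g_el a - c_el \<chi>)} \<union>
     (if nilpotent_type D then
        {(Const (\<gamma> a) * (x_el * c_el \<gamma>), c_el \<gamma> * x_el) | \<gamma>. \<gamma> \<in> carrier \<Gamma>}
      else
        {(Const (\<gamma> a) * (x_el * c_el \<gamma>),
          c_el \<gamma> * x_el +
          Const ((\<gamma> a ^ n - 1) / qfact \<rho> (n - 1)) *
            (c_el \<gamma> * (Const \<rho> * g_el a - c_el \<chi>) * xi_el ^ (n - 1))) | \<gamma>. \<gamma> \<in> carrier \<Gamma>}))"

abbreviation dd_terms :: "('g, 'k::field) group_datum \<Rightarrow> ('g, 'k) ddterm set" where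
  "dd_terms D \<equiv> terms (dd_gens D)"

text \<open>Equality in \<open>D(H\<^sub>D)\<close>.\<close>

abbreviation dd_eq :: "('g, 'k::field) group_datum \<Rightarrow> ('g, 'k) ddterm \<Rightarrow> ('g, 'k) ddterm \<Rightarrow> bool" where
  "dd_eq D \<equiv> alg_eq (dd_gens D) (dd_rels D)"

text \<open>A list of pairs stands for the corresponding sum of pure tensors in \<open>D(H\<^sub>D) \<otimes> D(H\<^sub>D)\<close>;
  \<open>comult\<close> is the multiplicative extension of the comultiplication from the generators to terms.\<close>

fun comult_gen ::
  "('g, 'k::field) group_datum \<Rightarrow> ('g, 'k) ddgen \<Rightarrow> (('g, 'k) ddterm \<times> ('g, 'k) ddterm) list" where
  "comult_gen D (GGen g) = [(g_el g, g_el g)]"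
| "comult_gen D XGen = [(x_el, g_el (pt D)), (1, x_el)]"
| "comult_gen D XiGen = [(xi_el, 1), (c_el (chi D), xi_el)]"
| "comult_gen D (CGen \<gamma>) =
     (c_el \<gamma>, c_el \<gamma>) #
     (if nilpotent_type D then []
      else map (\<lambda>p.
          (Const ((\<gamma> (pt D) ^ nn D - 1) / (qfact (rho D) p * qfact (rho D) (nn D - p))) *
             (c_el \<gamma> * c_el (chi D) ^ p * xi_el ^ (nn D - p)),
           c_el \<gamma> * xi_el ^ p))
        [1..<nn D])"

primrec comult ::
  "('g, 'k::field) group_datum \<Rightarrow> ('g, 'k) ddterm \<Rightarrow> (('g, 'k) ddterm \<times> ('g, 'k) ddterm) list" where
  "comult D (Const c) = [(Const c, 1)]"
| "comult D (Gen x) = comult_gen D x"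
| "comult D (Add u v) = comult D u @ comult D v"
| "comult D (Mult u v) =
     concat (map (\<lambda>(p, q). map (\<lambda>(r, s). (p * r, q * s)) (comult D v)) (comult D u))"

section \<open>Modules\<close>

text \<open>A finite-dimensional module is a representation by matrices on column vectors.\<close>

record ('g, 'k) ddmod =
  mdim :: nat
  act :: "('g, 'k) ddterm \<Rightarrow> 'k mat"

definition dd_module :: "('g, 'k::field) group_datum \<Rightarrow> ('g, 'k) ddmod \<Rightarrow> bool" where
  "dd_module D M \<longleftrightarrow>
     (\<forall>u\<in>dd_terms D. act M u \<in> carrier_mat (mdim M) (mdim M)) \<and>
     (\<forall>u v. dd_eq D u v \<longrightarrow> act M u = act M v) \<and>
     (\<forall>c. act M (Const c) = c \<cdot>\<^sub>m 1\<^sub>m (mdim M)) \<and>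
     (\<forall>u\<in>dd_terms D. \<forall>v\<in>dd_terms D. act M (u + v) = act M u + act M v) \<and>
     (\<forall>u\<in>dd_terms D. \<forall>v\<in>dd_terms D. act M (u * v) = act M u * act M v)"

definition dd_hom ::
  "('g, 'k::field) group_datum \<Rightarrow> ('g, 'k) ddmod \<Rightarrow> ('g, 'k) ddmod \<Rightarrow> 'k mat set" where
  "dd_hom D M N =
     {F \<in> carrier_mat (mdim N) (mdim M). \<forall>u\<in>dd_terms D. F * act M u = act N u * F}"

definition dd_iso :: "('g, 'k::field) group_datum \<Rightarrow> ('g, 'k) ddmod \<Rightarrow> ('g, 'k) ddmod \<Rightarrow> bool" where
  "dd_iso D M N \<longleftrightarrow>
     dd_module D M \<and> dd_module D N \<and>
     (\<exists>F\<in>dd_hom D M N. \<exists>E\<in>dd_hom D N M. E * F = 1\<^sub>m (mdim M) \<and> F * E = 1\<^sub>m (mdim N))"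

text \<open>The basis vector \<open>e\<^sub>i \<otimes> f\<^sub>j\<close> of the tensor product has index \<open>i * mdim N + j\<close>.\<close>

definition dd_tensor ::
  "('g, 'k::field) group_datum \<Rightarrow> ('g, 'k) ddmod \<Rightarrow> ('g, 'k) ddmod \<Rightarrow> ('g, 'k) ddmod" where
  "dd_tensor D M N =
     \<lparr>mdim = mdim M * mdim N,
      act = (\<lambda>u. mat (mdim M * mdim N) (mdim M * mdim N) (\<lambda>(i, j).
        \<Sum>(p, q)\<leftarrow>comult D u.
          act M p $$ (i div mdim N, j div mdim N) * act N q $$ (i mod mdim N, j mod mdim N)))\<rparr>"

definition dd_sum :: "('g, 'k::field) ddmod list \<Rightarrow> ('g, 'k) ddmod" where
  "dd_sum Ms =
     \<lparr>mdim = sum_list (map mdim Ms), act = (\<lambda>u. diag_block_mat (map (\<lambda>M. act M u) Ms))\<rparr>"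

definition surj_mat :: "'k::field mat \<Rightarrow> bool" where
  "surj_mat F \<longleftrightarrow> (\<forall>w\<in>carrier_vec (dim_row F). \<exists>v\<in>carrier_vec (dim_col F). F *\<^sub>v v = w)"

definition dd_projective :: "('g, 'k::field) group_datum \<Rightarrow> ('g, 'k) ddmod \<Rightarrow> bool" where
  "dd_projective D P \<longleftrightarrow>
     dd_module D P \<and>
     (\<forall>M N. \<forall>E\<in>dd_hom D M N. \<forall>F\<in>dd_hom D P N.
        dd_module D M \<longrightarrow> dd_module D N \<longrightarrow> surj_mat E \<longrightarrow> (\<exists>H\<in>dd_hom D P M. E * H = F))"

text \<open>A projective cover is an essential epimorphism from a projective module.\<close>

definition projective_cover ::
  "('g, 'k::field) group_datum \<Rightarrow> ('g, 'k) ddmod \<Rightarrow> ('g, 'k) ddmod \<Rightarrow> bool" where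
  "projective_cover D P V \<longleftrightarrow>
     dd_projective D P \<and> dd_module D V \<and>
     (\<exists>E\<in>dd_hom D P V. surj_mat E \<and>
        (\<forall>M. \<forall>F\<in>dd_hom D M P. dd_module D M \<longrightarrow> surj_mat (E * F) \<longrightarrow> surj_mat F))"

section \<open>The modules \<open>V(l,\<lambda>)\<close> and \<open>P(l,\<lambda>)\<close>\<close>

abbreviation Lam :: "('g, 'k::field) group_datum \<Rightarrow> ('g \<times> ('g \<Rightarrow> 'k) \<Rightarrow> 'k) monoid" where
  "Lam D \<equiv> char_group (grp D \<times>\<times> Gam D)"

definition phi :: "('g, 'k::field) group_datum \<Rightarrow> 'g \<times> ('g \<Rightarrow> 'k) \<Rightarrow> 'k" where
  "phi D = (\<lambda>(g, \<gamma>)\<in>carrier (grp D \<times>\<times> Gam D). inverse (chi D g) * \<gamma> (pt D))"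

text \<open>For \<open>1 \<le> l < n\<close> only.\<close>

definition I_set :: "('g, 'k::field) group_datum \<Rightarrow> nat \<Rightarrow> ('g \<times> ('g \<Rightarrow> 'k) \<Rightarrow> 'k) set" where
  "I_set D l =
     {\<mu> \<in> carrier (Lam D). \<mu> (pt D, inv\<^bsub>Gam D\<^esub> (chi D)) = rho D ^ (l - 1)}"

abbreviation at_G :: "('g, 'k::field) group_datum \<Rightarrow> ('g \<times> ('g \<Rightarrow> 'k) \<Rightarrow> 'k) \<Rightarrow> 'g \<Rightarrow> 'k" where
  "at_G D \<mu> g \<equiv> \<mu> (g, \<one>\<^bsub>Gam D\<^esub>)"

abbreviation at_Gam ::
  "('g, 'k::field) group_datum \<Rightarrow> ('g \<times> ('g \<Rightarrow> 'k) \<Rightarrow> 'k) \<Rightarrow> ('g \<Rightarrow> 'k) \<Rightarrow> 'k" where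
  "at_Gam D \<mu> \<gamma> \<equiv> \<mu> (\<one>\<^bsub>grp D\<^esub>, \<gamma>)"

definition alpha_coeff ::
  "('g, 'k::field) group_datum \<Rightarrow> ('g \<times> ('g \<Rightarrow> 'k) \<Rightarrow> 'k) \<Rightarrow> nat \<Rightarrow> 'k" where
  "alpha_coeff D \<mu> i =
     qnum (rho D) i * (at_Gam D \<mu> (chi D) - at_G D \<mu> (pt D) * rho D powi (1 - int i))"

primrec eval_term :: "nat \<Rightarrow> ('x \<Rightarrow> 'k::field mat) \<Rightarrow> ('k, 'x) fterm \<Rightarrow> 'k mat" where
  "eval_term d f (Const c) = c \<cdot>\<^sub>m 1\<^sub>m d"
| "eval_term d f (Gen x) = f x"
| "eval_term d f (Add u v) = eval_term d f u + eval_term d f v"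
| "eval_term d f (Mult u v) = eval_term d f u * eval_term d f v"

text \<open>Column \<open>j\<close> holds the image of the basis vector \<open>v\<^sub>j\<close>.\<close>

fun V_gen ::
  "('g, 'k::field) group_datum \<Rightarrow> nat \<Rightarrow> ('g \<times> ('g \<Rightarrow> 'k) \<Rightarrow> 'k) \<Rightarrow> ('g, 'k) ddgen \<Rightarrow> 'k mat" where
  "V_gen D l \<mu> (GGen g) = mat l l (\<lambda>(i, j).
     if i = j then at_G D (phi D [^]\<^bsub>Lam D\<^esub> j \<otimes>\<^bsub>Lam D\<^esub> \<mu>) g else 0)"
| "V_gen D l \<mu> (CGen \<gamma>) = mat l l (\<lambda>(i, j).
     if i = j then at_Gam D (phi D [^]\<^bsub>Lam D\<^esub> j \<otimes>\<^bsub>Lam D\<^esub> \<mu>) \<gamma> else 0)"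
| "V_gen D l \<mu> XGen = mat l l (\<lambda>(i, j).
     if i = j + 1 then 1
     else if l = nn D \<and> \<not> nilpotent_type D \<and> j = l - 1 \<and> i = 0
       then at_G D \<mu> (pt D) ^ nn D - 1
     else 0)"
| "V_gen D l \<mu> XiGen = mat l l (\<lambda>(i, j). if j = i + 1 then alpha_coeff D \<mu> j else 0)"

definition V_mod ::
  "('g, 'k::field) group_datum \<Rightarrow> nat \<Rightarrow> ('g \<times> ('g \<Rightarrow> 'k) \<Rightarrow> 'k) \<Rightarrow> ('g, 'k) ddmod" where
  "V_mod D l \<mu> = \<lparr>mdim = l, act = eval_term l (V_gen D l \<mu>)\<rparr>"

text \<open>Projective covers are unique up to isomorphism; one is chosen.\<close>

definition P_mod ::
  "('g, 'k::field) group_datum \<Rightarrow> nat \<Rightarrow> ('g \<times> ('g \<Rightarrow> 'k) \<Rightarrow> 'k) \<Rightarrow> ('g, 'k) ddmod" where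
  "P_mod D l \<mu> =
     (if l = nn D then V_mod D l \<mu> else (SOME P. projective_cover D P (V_mod D l \<mu>)))"

definition cc :: "int \<Rightarrow> int" where
  "cc t = (t + 1) div 2"

end

theory Submission
  imports Defs "Jordan_Normal_Form.Determinant" "HOL-Library.Function_Algebras"
begin

text \<open>The element \<open>y = x - c(\<rho>a - \<chi>)\<xi>\<^sup>n\<^sup>-\<^sup>1\<close>, with \<open>c = 1 / (n - 1)!\<close> in the non-nilpotent case, satisfies
  \<open>\<gamma>(a)y\<gamma> = \<gamma>y\<close>, and conjugation with \<open>1 + Z\<close>, where \<open>Z\<close> is the \<open>n\<close>-th divided power of \<open>\<xi>\<close>, turns the tensor
  product into a module with diagonal action of \<open>\<Gamma>\<close>. In this form, \<open>V(l,\<lambda>) \<otimes> V(l',\<lambda>')\<close> is graded by the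
  sum of the indices of the basis vectors, \<open>y\<close> raises the degree by one and \<open>\<xi>\<close> lowers it.

  On the degrees below \<open>l\<close>, \<open>\<xi>\<close> is surjective with a one-dimensional kernel, spanned by \<open>h(s)\<close>; on the degrees from
  \<open>l\<close> on it is injective. If \<open>l + l' - 1 - 2s \<le> n\<close>, then \<open>h(s)\<close> generates a simple module of this dimension.
  If \<open>t < 2s \<le> 2t\<close>, let \<open>m = 2s - t\<close>; a vector \<open>w\<close> of degree \<open>s\<close> such that \<open>\<xi>w = y\<^sup>m\<^sup>-\<^sup>1h(t - s)\<close> generates a
  module of dimension \<open>2n\<close>, in which the kernel of \<open>\<xi>\<close> is spanned by \<open>h(t - s)\<close> and \<open>y\<^sup>mh(t - s)\<close>, the latter being a
  multiple of \<open>h(s)\<close>. This module is the projective cover \<open>P(n - m,\<phi>\<^sup>s\<lambda>\<lambda>')\<close>: its presentation by two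
  highest weight conditions can be solved in every preimage, because on a weight space
  \<open>0 = y\<^sup>n\<^sup>-\<^sup>1\<xi>\<^sup>n\<close> factors into linear polynomials in \<open>y\<xi>\<close>, all but one of them with nonzero constant term.
  As the kernels of \<open>\<xi>\<close> on these submodules lie in different degrees, their sum is direct, and the
  dimensions add up to \<open>ll'\<close>.\<close>

section \<open>Matrices acting on finitely supported sequences\<close>

text \<open>The relations of the double are never checked on the basis of \<open>P_ex\<close>. A map
  out of it is determined by the images of u and w, and its construction uses only that the target
  is a module; an injective map into the tensor product then reflects the relations. Projectivity is
  therefore proved under the assumption that \<open>P_ex\<close> is a module, and the decomposition
  supplies this assumption. The tensor product also inherits its module structure, through the
  isomorphism with \<open>M1\<close>.

  Since \<xi> is nilpotent, injectivity of a map out of a sum of submodules has to be tested on the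
  kernel of \<xi> only, which is at most two-dimensional in each summand.

  Lifting w along a surjection onto N cannot start from an arbitrary preimage of its image, because
  the condition \<xi>y\<xi>w = 0 may fail there. The remedy is to divide in N by the invertible
  linear factors, to lift the quotient, and to multiply by the same factors upstairs: the product
  lies over the given vector and satisfies the condition automatically.\<close>

definition sc :: "'k::field \<Rightarrow> (nat \<Rightarrow> 'k) \<Rightarrow> nat \<Rightarrow> 'k" (infixr "*s" 75) where
  "c *s f = (\<lambda>i. c * f i)"

text \<open>Vectors of every dimension live in the single type \<open>nat \<Rightarrow> 'k\<close>,
  an additive group under pointwise operations, so that linear identities need no dimension side
  conditions. Coordinates beyond the number of rows are set to 0.\<close>

definition mop :: "'k::field mat \<Rightarrow> (nat \<Rightarrow> 'k) \<Rightarrow> nat \<Rightarrow> 'k" where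
  "mop A f = (\<lambda>i. if i < dim_row A then \<Sum>j<dim_col A. A $$ (i, j) * f j else 0)"

definition fsp :: "nat \<Rightarrow> (nat \<Rightarrow> 'k::field) set" where
  "fsp d = {f. \<forall>i\<ge>d. f i = 0}"

definition bas :: "nat \<Rightarrow> nat \<Rightarrow> 'k::field" where
  "bas j = (\<lambda>i. if i = j then 1 else 0)"

lemma sc_apply: "(c *s f) i = c * f i"
  by (simp add: sc_def)

text \<open>Vector sums stay unexpanded, so that linearity rewrites whole vectors;
  \<open>ptw\<close> descends to coordinates where these are meant.\<close>

declare plus_fun_apply [simp del] zero_fun_apply [simp del] minus_apply [simp del] uminus_apply [simp del]

lemmas ptw = sc_apply plus_fun_apply zero_fun_apply minus_apply uminus_apply

lemma sum_fun_apply: "(sum f S :: nat \<Rightarrow> 'k::field) i = (\<Sum>s\<in>S. f s i)"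
  by (induction S rule: infinite_finite_induct) (auto simp: ptw)

lemma sc_simps [simp]:
  "1 *s f = f" "0 *s f = 0" "c *s 0 = 0" "c *s d *s f = (c * d) *s f" "(- 1) *s f = - f"
  by (auto simp: fun_eq_iff ptw)

lemma sc_distrib: "c *s (f + g) = c *s f + c *s g" "(c + d) *s f = c *s f + d *s f"
  "c *s (f - g) = c *s f - c *s g" "(c - d) *s f = c *s f - d *s f"
  "c *s (- f) = - (c *s f)" "c *s sum F S = (\<Sum>s\<in>S. c *s F s)"
  by (auto simp: fun_eq_iff ptw algebra_simps sum_distrib_left sum_fun_apply ptw)

lemma sc_eq_0_iff: "c *s f = 0 \<longleftrightarrow> c = 0 \<or> f = 0"
  by (auto simp: fun_eq_iff ptw)

lemma mop_add [simp]: "mop A (f + g) = mop A f + mop A g"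
proof
  fix i show "mop A (f + g) i = (mop A f + mop A g) i"
    by (simp add: mop_def ptw algebra_simps flip: sum.distrib)
qed

lemma mop_sc [simp]: "mop A (c *s f) = c *s mop A f"
  by (auto simp: mop_def fun_eq_iff ptw sum_distrib_left mult.left_commute)

lemma mop_minus [simp]: "mop A (- f) = - mop A f"
  using mop_sc[of A "- 1" f] by simp

lemma mop_diff [simp]: "mop A (f - g) = mop A f - mop A g"
  using mop_add[of A f "- g"] by simp

lemma mop_zero [simp]: "mop A 0 = 0"
  using mop_sc[of A 0 0] by simp

lemma mop_sum [simp]: "mop A (sum F S) = (\<Sum>s\<in>S. mop A (F s))"
  using sum_comp_morphism[of "mop A" F S] by (simp add: o_def)

lemma mop_fsp: "A \<in> carrier_mat d e \<Longrightarrow> mop A f \<in> fsp d"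
  by (auto simp: mop_def fsp_def)

lemma mop_mult: "A \<in> carrier_mat a b \<Longrightarrow> B \<in> carrier_mat b c \<Longrightarrow> mop (A * B) f = mop A (mop B f)"
  unfolding mop_def fun_eq_iff ptw
  by (auto simp: scalar_prod_def sum_distrib_left sum_distrib_right mult.assoc atLeast0LessThan)
    (subst sum.swap, simp)

lemma mop_mat_add: "A \<in> carrier_mat a b \<Longrightarrow> B \<in> carrier_mat a b \<Longrightarrow> mop (A + B) f = mop A f + mop B f"
proof
  fix i assume "A \<in> carrier_mat a b" "B \<in> carrier_mat a b"
  then show "mop (A + B) f i = (mop A f + mop B f) i"
    by (simp add: mop_def ptw algebra_simps flip: sum.distrib)
qed

lemma mop_mat_smult: "mop (c \<cdot>\<^sub>m A) f = c *s mop A f"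
  by (auto simp: mop_def fun_eq_iff ptw sum_distrib_left mult.assoc)

lemma mop_one: "f \<in> fsp d \<Longrightarrow> mop (1\<^sub>m d) f = f"
proof
  fix i assume "f \<in> fsp d"
  moreover have "(\<Sum>j<d. 1\<^sub>m d $$ (i, j) * f j) = (\<Sum>j<d. if j = i then f i else 0)" if "i < d"
    by (rule sum.cong) (use that in auto)
  ultimately show "mop (1\<^sub>m d) f i = f i" by (auto simp: mop_def fsp_def)
qed

lemma fsp_closed [simp, intro]:
  "0 \<in> fsp d" "f \<in> fsp d \<Longrightarrow> g \<in> fsp d \<Longrightarrow> f + g \<in> fsp d" "f \<in> fsp d \<Longrightarrow> g \<in> fsp d \<Longrightarrow> f - g \<in> fsp d"
  "f \<in> fsp d \<Longrightarrow> - f \<in> fsp d" "f \<in> fsp d \<Longrightarrow> c *s f \<in> fsp d" "j < d \<Longrightarrow> bas j \<in> fsp d"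
  by (auto simp: fsp_def bas_def ptw)

lemma fsp_sum: "(\<And>s. s \<in> S \<Longrightarrow> F s \<in> fsp d) \<Longrightarrow> sum F S \<in> fsp d"
  by (induction S rule: infinite_finite_induct) auto

lemma mop_bas: "A \<in> carrier_mat a b \<Longrightarrow> j < b \<Longrightarrow> mop A (bas j) = (\<lambda>i. if i < a then A $$ (i, j) else 0)"
proof
  fix i assume A: "A \<in> carrier_mat a b" "j < b"
  have "(\<Sum>k<b. A $$ (i, k) * bas j k) = (\<Sum>k<b. if k = j then A $$ (i, j) else 0)"
    by (rule sum.cong) (auto simp: bas_def)
  then show "mop A (bas j) i = (if i < a then A $$ (i, j) else 0)"
    using A by (auto simp: mop_def)
qed

lemma mop_expand: "A \<in> carrier_mat a b \<Longrightarrow> mop A f = (\<Sum>j<b. f j *s mop A (bas j))"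
proof
  fix i assume A: "A \<in> carrier_mat a b"
  have "(\<Sum>j<b. f j * mop A (bas j) i) = (if i < a then \<Sum>j<b. A $$ (i, j) * f j else 0)"
    using A by (simp add: mop_bas mult.commute)
  then show "mop A f i = (\<Sum>j<b. f j *s mop A (bas j)) i"
    using A by (simp add: mop_def[of A f] sum_fun_apply ptw)
qed

lemma fsp_expand: "f \<in> fsp d \<Longrightarrow> f = (\<Sum>j<d. f j *s bas j)"
proof
  fix i assume f: "f \<in> fsp d"
  have "(\<Sum>j<d. f j * bas j i) = (\<Sum>j<d. if j = i then f i else 0)"
    by (rule sum.cong) (auto simp: bas_def)
  then show "f i = (\<Sum>j<d. f j *s bas j) i"
    using f by (simp add: sum_fun_apply fsp_def ptw)
qed

lemma mop_eqI:
  assumes "A \<in> carrier_mat a b" "B \<in> carrier_mat a b" "\<And>j. j < b \<Longrightarrow> mop A (bas j) = mop B (bas j)"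
  shows "A = B"
proof (rule eq_matI)
  fix i j assume "i < dim_row B" "j < dim_col B"
  then have "i < a" "j < b" using assms by auto
  then show "A $$ (i, j) = B $$ (i, j)"
    using fun_cong[OF assms(3)[of j], of i] mop_bas[OF assms(1), of j] mop_bas[OF assms(2), of j] by simp
qed (use assms in auto)

lemma mop_eqI_fsp:
  assumes "A \<in> carrier_mat a b" "B \<in> carrier_mat a b" "\<And>f. f \<in> fsp b \<Longrightarrow> mop A f = mop B f"
  shows "A = B"
  by (rule mop_eqI[OF assms(1,2)]) (use assms(3) in auto)

definition cols_mat :: "nat \<Rightarrow> nat \<Rightarrow> (nat \<Rightarrow> nat \<Rightarrow> 'k::field) \<Rightarrow> 'k mat" where
  "cols_mat a b c = mat a b (\<lambda>(i, j). c j i)"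

lemma cols_mat_carrier [simp]: "cols_mat a b c \<in> carrier_mat a b"
  by (simp add: cols_mat_def)

lemma mop_cols_mat: "j < b \<Longrightarrow> c j \<in> fsp a \<Longrightarrow> mop (cols_mat a b c) (bas j) = c j"
  using mop_bas[OF cols_mat_carrier[of a b c], of j] by (auto simp: fun_eq_iff ptw cols_mat_def fsp_def)

lemma funpow_fsp: "A \<in> carrier_mat d d \<Longrightarrow> f \<in> fsp d \<Longrightarrow> (mop A ^^ k) f \<in> fsp d"
  by (induction k) (auto intro: mop_fsp)

lemma funpow_mop_lin [simp]:
  "(mop A ^^ k) (f + g) = (mop A ^^ k) f + (mop A ^^ k) g"
  "(mop A ^^ k) (f - g) = (mop A ^^ k) f - (mop A ^^ k) g"
  "(mop A ^^ k) (c *s f) = c *s (mop A ^^ k) f"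
  "(mop A ^^ k) 0 = 0"
  by (induction k) simp_all

lemma mult_mat_vec_mop:
  "A \<in> carrier_mat a b \<Longrightarrow> A *\<^sub>v vec b f = vec a (mop A f)"
  by (auto simp: mop_def scalar_prod_def atLeast0LessThan)

lemma surj_mat_mop:
  assumes A: "(A :: 'k::field mat) \<in> carrier_mat a b"
  shows "surj_mat A \<longleftrightarrow> (\<forall>g\<in>fsp a. \<exists>f\<in>fsp b. mop A f = g)"
proof
  assume s: "surj_mat A"
  show "\<forall>g\<in>fsp a. \<exists>f\<in>fsp b. mop A f = g"
  proof
    fix g :: "nat \<Rightarrow> 'k" assume g: "g \<in> fsp a"
    obtain v where v: "v \<in> carrier_vec b" "A *\<^sub>v v = vec a g"
      using s A unfolding surj_mat_def by (metis carrier_matD vec_carrier)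
    define f where "f = (\<lambda>i. if i < b then v $ i else 0)"
    have "v = vec b f" using v by (auto simp: f_def)
    then have "vec a (mop A f) = vec a g" using v mult_mat_vec_mop[OF A, of f] by simp
    then have "mop A f i = g i" if "i < a" for i using that by (metis index_vec)
    then have "mop A f = g"
      using g mop_fsp[OF A, of f] by (auto simp: fun_eq_iff ptw fsp_def) (metis not_le)
    moreover have "f \<in> fsp b" by (auto simp: f_def fsp_def)
    ultimately show "\<exists>f\<in>fsp b. mop A f = g" by blast
  qed
next
  assume s: "\<forall>g\<in>fsp a. \<exists>f\<in>fsp b. mop A f = g"
  show "surj_mat A" unfolding surj_mat_def
  proof
    fix w :: "'k vec" assume w: "w \<in> carrier_vec (dim_row A)"
    define g where "g = (\<lambda>i. if i < a then w $ i else 0)"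
    have "g \<in> fsp a" by (auto simp: g_def fsp_def)
    then obtain f where "mop A f = g" using s by blast
    moreover have "w = vec a g" using w A by (auto simp: g_def)
    ultimately show "\<exists>v\<in>carrier_vec (dim_col A). A *\<^sub>v v = w"
      using A mult_mat_vec_mop[OF A, of f] by (intro bexI[of _ "vec b f"]) auto
  qed
qed

lemma inverse_of_inj:
  assumes A: "(A :: 'k::field mat) \<in> carrier_mat d d"
    and inj: "\<And>f. f \<in> fsp d \<Longrightarrow> mop A f = 0 \<Longrightarrow> f = 0"
  shows "\<exists>B\<in>carrier_mat d d. A * B = 1\<^sub>m d \<and> B * A = 1\<^sub>m d"
proof -
  have "det A \<noteq> 0"
  proof
    assume "det A = 0"
    then obtain v where v: "v \<in> carrier_vec d" "v \<noteq> 0\<^sub>v d" "A *\<^sub>v v = 0\<^sub>v d"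
      using det_0_iff_vec_prod_zero_field[OF A] by auto
    define f where "f = (\<lambda>i. if i < d then v $ i else 0)"
    have vf: "v = vec d f" using v by (auto simp: f_def)
    have "vec d (mop A f) = 0\<^sub>v d" using v vf mult_mat_vec_mop[OF A, of f] by simp
    then have "mop A f i = 0" if "i < d" for i using that by (metis index_vec index_zero_vec(1))
    then have "mop A f = 0"
      using mop_fsp[OF A, of f] by (auto simp: fun_eq_iff ptw fsp_def) (metis not_le)
    then have "f = 0" using inj[of f] by (auto simp: f_def fsp_def)
    then have "v = 0\<^sub>v d" using vf by (auto simp: ptw)
    then show False using v by simp
  qed
  then have "A \<in> Units (ring_mat TYPE('k) d ())"
    by (rule det_non_zero_imp_unit[OF A])
  then show ?thesis by (auto simp: Units_def ring_mat_def)
qed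

text \<open>\<open>E * F\<close> and \<open>F * E\<close> have the same trace; in characteristic 0
  both dimensions can be read off from it.\<close>

lemma dim_eq_of_inverses:
  assumes F: "(F :: 'k::field_char_0 mat) \<in> carrier_mat b a" and E: "E \<in> carrier_mat a b"
    and EF: "E * F = 1\<^sub>m a" and FE: "F * E = 1\<^sub>m b"
  shows "a = b"
proof -
  have "of_nat a = (\<Sum>i<a. (E * F) $$ (i, i))" using EF by simp
  also have "\<dots> = (\<Sum>i<a. \<Sum>j<b. E $$ (i, j) * F $$ (j, i))"
    using E F by (auto simp: scalar_prod_def atLeast0LessThan)
  also have "\<dots> = (\<Sum>j<b. \<Sum>i<a. F $$ (j, i) * E $$ (i, j))"
    by (subst sum.swap) (simp add: mult.commute)
  also have "\<dots> = (\<Sum>j<b. (F * E) $$ (j, j))"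
    using E F by (auto simp: scalar_prod_def atLeast0LessThan)
  also have "\<dots> = of_nat b" using FE by simp
  finally show ?thesis by simp
qed

section \<open>Modules over the double\<close>

lemma terms_simps [simp]:
  "Const c \<in> terms X" "Gen x \<in> terms X \<longleftrightarrow> x \<in> X"
  "u + v \<in> terms X \<longleftrightarrow> u \<in> terms X \<and> v \<in> terms X"
  "u * v \<in> terms X \<longleftrightarrow> u \<in> terms X \<and> v \<in> terms X"
  "u - v \<in> terms X \<longleftrightarrow> u \<in> terms X \<and> v \<in> terms X"
  "1 \<in> terms X"
  by (auto simp: terms_def plus_fterm_def times_fterm_def minus_fterm_def one_fterm_def)

lemma terms_power [simp]: "u \<in> terms X \<Longrightarrow> u ^ k \<in> terms X"
  by (induction k) auto

lemma terms_induct [consumes 1, case_names Const Gen add mult]: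
  assumes "u \<in> terms X" "\<And>c. P (Const c)" "\<And>x. x \<in> X \<Longrightarrow> P (Gen x)"
    "\<And>u v. u \<in> terms X \<Longrightarrow> v \<in> terms X \<Longrightarrow> P u \<Longrightarrow> P v \<Longrightarrow> P (u + v)"
    "\<And>u v. u \<in> terms X \<Longrightarrow> v \<in> terms X \<Longrightarrow> P u \<Longrightarrow> P v \<Longrightarrow> P (u * v)"
  shows "P u"
  using assms(1)
proof (induction u)
  case (Add u v)
  then show ?case using assms(4)[of u v] terms_simps(3)[of u v X] by (simp add: plus_fterm_def)
next
  case (Mult u v)
  then show ?case using assms(5)[of u v] terms_simps(4)[of u v X] by (simp add: times_fterm_def)
next
  case (Const c)
  show ?case by (rule assms(2))
next
  case (Gen x)
  then show ?case using assms(3)[of x] by simp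
qed

text \<open>The module axioms without the relations of the double. They hold by construction for
  \<open>rep_mod\<close> and for tensor products of such; the relations can be inherited later by
  \<open>dd_module_embedded\<close>.\<close>

definition pre_module :: "('g, 'k::field) group_datum \<Rightarrow> ('g, 'k) ddmod \<Rightarrow> bool" where
  "pre_module D M \<longleftrightarrow>
     (\<forall>u\<in>dd_terms D. act M u \<in> carrier_mat (mdim M) (mdim M)) \<and>
     (\<forall>c. act M (Const c) = c \<cdot>\<^sub>m 1\<^sub>m (mdim M)) \<and>
     (\<forall>u\<in>dd_terms D. \<forall>v\<in>dd_terms D. act M (u + v) = act M u + act M v) \<and>
     (\<forall>u\<in>dd_terms D. \<forall>v\<in>dd_terms D. act M (u * v) = act M u * act M v)"

lemma dd_module_iff:
  "dd_module D M \<longleftrightarrow> pre_module D M \<and> (\<forall>u v. dd_eq D u v \<longrightarrow> act M u = act M v)"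
  by (auto simp: dd_module_def pre_module_def)

lemma dd_module_pre: "dd_module D M \<Longrightarrow> pre_module D M"
  by (simp add: dd_module_iff)

abbreviation app :: "('g, 'k::field) ddmod \<Rightarrow> ('g, 'k) ddterm \<Rightarrow> (nat \<Rightarrow> 'k) \<Rightarrow> nat \<Rightarrow> 'k" where
  "app M u \<equiv> mop (act M u)"

context
  fixes D :: "('g, 'k::field) group_datum" and M :: "('g, 'k) ddmod"
  assumes M: "pre_module D M"
begin

lemma pre_carrier: "u \<in> dd_terms D \<Longrightarrow> act M u \<in> carrier_mat (mdim M) (mdim M)"
  using M by (simp add: pre_module_def)

lemma app_fsp [simp, intro]: "u \<in> dd_terms D \<Longrightarrow> app M u v \<in> fsp (mdim M)"
  using mop_fsp[OF pre_carrier] by blast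

lemma app_add: "u \<in> dd_terms D \<Longrightarrow> v \<in> dd_terms D \<Longrightarrow> app M (u + v) w = app M u w + app M v w"
  using M mop_mat_add[OF pre_carrier pre_carrier] by (simp add: pre_module_def)

lemma app_mult: "u \<in> dd_terms D \<Longrightarrow> v \<in> dd_terms D \<Longrightarrow> app M (u * v) w = app M u (app M v w)"
  using M mop_mult[OF pre_carrier pre_carrier] by (simp add: pre_module_def)

lemma app_const: "w \<in> fsp (mdim M) \<Longrightarrow> app M (Const c) w = c *s w"
  using M by (simp add: pre_module_def mop_mat_smult mop_one)

lemma app_one: "w \<in> fsp (mdim M) \<Longrightarrow> app M 1 w = w"
  by (simp add: one_fterm_def app_const)

lemma app_const_mult: "u \<in> dd_terms D \<Longrightarrow> app M (Const c * u) w = c *s app M u w"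
  by (simp add: app_mult app_const)

lemma app_diff: "u \<in> dd_terms D \<Longrightarrow> v \<in> dd_terms D \<Longrightarrow> app M (u - v) w = app M u w - app M v w"
proof -
  assume uv: "u \<in> dd_terms D" "v \<in> dd_terms D"
  have "u - v = u + Const (- 1) * v" by (simp add: minus_fterm_def plus_fterm_def times_fterm_def)
  then show ?thesis using uv by (simp add: app_add app_const_mult)
qed

lemma app_power: "u \<in> dd_terms D \<Longrightarrow> w \<in> fsp (mdim M) \<Longrightarrow> app M (u ^ k) w = (app M u ^^ k) w"
  by (induction k) (simp_all add: app_one app_mult)

text \<open>All clauses of \<open>alg_eq\<close> except \<open>rel\<close> are identities of
  matrices, so only the defining relations remain to be checked.\<close>

lemma pre_module_eq:
  assumes rels: "\<And>u v. (u, v) \<in> dd_rels D \<Longrightarrow> u \<in> dd_terms D \<Longrightarrow> v \<in> dd_terms D \<Longrightarrow> act M u = act M v"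
  shows "dd_module D M"
  unfolding dd_module_iff
proof (intro conjI allI impI M)
  fix u v assume "dd_eq D u v"
  then have "u \<in> dd_terms D \<and> v \<in> dd_terms D \<and> act M u = act M v"
  proof (induction rule: alg_eq.induct)
    case (cong_add u u' v v')
    then show ?case using M by (simp add: pre_module_def)
  next
    case (cong_mult u u' v v')
    then show ?case using M by (simp add: pre_module_def)
  next
    case (add_zero u)
    have "act M (Const 0 + u) = act M u"
      by (rule mop_eqI_fsp[of _ "mdim M" "mdim M"])
        (use add_zero in \<open>auto intro!: pre_carrier simp: app_add app_const\<close>)
    then show ?case using add_zero by simp
  next
    case (mult_zero u)
    have "act M (Const 0 * u) = act M (Const 0)"
      by (rule mop_eqI_fsp[of _ "mdim M" "mdim M"])
        (use mult_zero in \<open>auto intro!: pre_carrier simp: app_mult app_const\<close>)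
    then show ?case using mult_zero by simp
  next
    case (const_add c d)
    have "act M (Const c + Const d) = act M (Const (c + d))"
      by (rule mop_eqI_fsp[of _ "mdim M" "mdim M"])
        (auto intro!: pre_carrier simp: app_add app_const sc_distrib)
    then show ?case by simp
  next
    case (const_mult c d)
    have "act M (Const c * Const d) = act M (Const (c * d))"
      by (rule mop_eqI_fsp[of _ "mdim M" "mdim M"])
        (auto intro!: pre_carrier simp: app_mult app_const mult.commute)
    then show ?case by simp
  next
    case (const_central u c)
    have "act M (Const c * u) = act M (u * Const c)"
      by (rule mop_eqI_fsp[of _ "mdim M" "mdim M"])
        (use const_central in \<open>auto intro!: pre_carrier simp: app_mult app_const\<close>)
    then show ?case using const_central by simp
  next
    case (add_comm u v)
    have "act M (u + v) = act M (v + u)"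
      by (rule mop_eqI_fsp[of _ "mdim M" "mdim M"])
        (use add_comm in \<open>auto intro!: pre_carrier simp: app_add add.commute\<close>)
    then show ?case using add_comm by simp
  next
    case (add_assoc u v w)
    have "act M (u + v + w) = act M (u + (v + w))"
      by (rule mop_eqI_fsp[of _ "mdim M" "mdim M"])
        (use add_assoc in \<open>auto intro!: pre_carrier simp: app_add add.assoc\<close>)
    then show ?case using add_assoc by simp
  next
    case (mult_assoc u v w)
    have "act M (u * v * w) = act M (u * (v * w))"
      by (rule mop_eqI_fsp[of _ "mdim M" "mdim M"])
        (use mult_assoc in \<open>auto intro!: pre_carrier simp: app_mult\<close>)
    then show ?case using mult_assoc by simp
  next
    case (mult_one u)
    have "act M (1 * u) = act M u"
      by (rule mop_eqI_fsp[of _ "mdim M" "mdim M"])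
        (use mult_one in \<open>auto intro!: pre_carrier simp: app_mult app_one\<close>)
    then show ?case using mult_one by simp
  next
    case (distrib_left u v w)
    have "act M (u * (v + w)) = act M (u * v + u * w)"
      by (rule mop_eqI_fsp[of _ "mdim M" "mdim M"])
        (use distrib_left in \<open>auto intro!: pre_carrier simp: app_mult app_add\<close>)
    then show ?case using distrib_left by simp
  next
    case (distrib_right u v w)
    have "act M ((u + v) * w) = act M (u * w + v * w)"
      by (rule mop_eqI_fsp[of _ "mdim M" "mdim M"])
        (use distrib_right in \<open>auto intro!: pre_carrier simp: app_mult app_add\<close>)
    then show ?case using distrib_right by simp
  next
    case (rel u v)
    then show ?case using rels[of u v] by simp
  next
    case (refl u)
    then show ?case by simp
  next
    case (sym u v)
    then show ?case by metis
  next
    case (trans u v w)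
    then show ?case by metis
  qed
  then show "act M u = act M v" by simp
qed

end

definition rep_mod :: "nat \<Rightarrow> (('g, 'k) ddgen \<Rightarrow> 'k::field mat) \<Rightarrow> ('g, 'k) ddmod" where
  "rep_mod d f = \<lparr>mdim = d, act = eval_term d f\<rparr>"

lemma rep_mod_simps [simp]:
  "mdim (rep_mod d f) = d" "act (rep_mod d f) (Gen x) = f x"
  by (simp_all add: rep_mod_def)

lemma eval_term_carrier:
  "(\<And>x. x \<in> X \<Longrightarrow> f x \<in> carrier_mat d d) \<Longrightarrow> u \<in> terms X \<Longrightarrow> eval_term d f u \<in> carrier_mat d d"
  by (erule terms_induct[of u X]) (auto simp: plus_fterm_def times_fterm_def)

lemma rep_pre_module:
  assumes "\<And>x. x \<in> dd_gens D \<Longrightarrow> f x \<in> carrier_mat d d"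
  shows "pre_module D (rep_mod d f)"
  using eval_term_carrier[of "dd_gens D" f d] assms
  by (auto simp: pre_module_def rep_mod_def plus_fterm_def times_fterm_def)

lemma dd_hom_carrier: "F \<in> dd_hom D M N \<Longrightarrow> F \<in> carrier_mat (mdim N) (mdim M)"
  by (simp add: dd_hom_def)

lemma dd_hom_app:
  assumes "pre_module D M" "pre_module D N" "F \<in> dd_hom D M N" "u \<in> dd_terms D"
  shows "mop F (app M u w) = app N u (mop F w)"
proof -
  have F: "F \<in> carrier_mat (mdim N) (mdim M)" "F * act M u = act N u * F"
    using assms by (auto simp: dd_hom_def)
  show ?thesis
    using mop_mult[OF F(1) pre_carrier[OF assms(1,4)], of w]
      mop_mult[OF pre_carrier[OF assms(2,4)] F(1), of w] F(2) by simp
qed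

lemma dd_homI:
  assumes M: "pre_module D M" and N: "pre_module D N" and F: "F \<in> carrier_mat (mdim N) (mdim M)"
    and gen: "\<And>x w. x \<in> dd_gens D \<Longrightarrow> w \<in> fsp (mdim M) \<Longrightarrow>
      mop F (app M (Gen x) w) = app N (Gen x) (mop F w)"
  shows "F \<in> dd_hom D M N"
  unfolding dd_hom_def
proof (intro CollectI conjI ballI F)
  fix u assume u: "u \<in> dd_terms D"
  have "mop F (app M u w) = app N u (mop F w)" if "w \<in> fsp (mdim M)" for w
    using u that
  proof (induction u arbitrary: w rule: terms_induct)
    case (Const c)
    then show ?case using mop_fsp[OF F, of w] by (simp add: app_const[OF M] app_const[OF N])
  next
    case (add u v)
    then show ?case by (simp add: app_add[OF M] app_add[OF N])
  next
    case (mult u v)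
    then show ?case using app_fsp[OF M, of v w] by (simp add: app_mult[OF M] app_mult[OF N])
  qed (use gen in auto)
  then show "F * act M u = act N u * F"
    using mop_mult[OF F pre_carrier[OF M u]] mop_mult[OF pre_carrier[OF N u] F]
      pre_carrier[OF M u] pre_carrier[OF N u] F
    by (intro mop_eqI_fsp[of _ "mdim N" "mdim M"]) auto
qed

lemma dd_hom_comp:
  assumes "pre_module D L" "pre_module D M" "pre_module D N" "F \<in> dd_hom D L M" "E \<in> dd_hom D M N"
  shows "E * F \<in> dd_hom D L N"
proof (rule dd_homI[OF assms(1,3)])
  have c: "E \<in> carrier_mat (mdim N) (mdim M)" "F \<in> carrier_mat (mdim M) (mdim L)"
    using assms by (auto intro: dd_hom_carrier)
  then show "E * F \<in> carrier_mat (mdim N) (mdim L)" by simp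
  fix x w assume "x \<in> dd_gens D"
  then show "mop (E * F) (app L (Gen x) w) = app N (Gen x) (mop (E * F) w)"
    using c assms by (simp add: mop_mult[OF c] dd_hom_app[of D])
qed

lemma dd_module_embedded:
  assumes M: "dd_module D M" and N: "pre_module D N" and F: "F \<in> dd_hom D N M"
    and inj: "\<And>v. v \<in> fsp (mdim N) \<Longrightarrow> mop F v = 0 \<Longrightarrow> v = 0"
  shows "dd_module D N"
proof (rule pre_module_eq[OF N])
  fix u v assume uv: "(u, v) \<in> dd_rels D" "u \<in> dd_terms D" "v \<in> dd_terms D"
  note M' = dd_module_pre[OF M]
  have "act M u = act M v" using M alg_eq.rel[OF uv] unfolding dd_module_iff by blast
  then have "mop F (app N u w - app N v w) = 0" for w
    using dd_hom_app[OF N M' F, of u w] dd_hom_app[OF N M' F, of v w] uv(2,3) by simp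
  then have "app N u w - app N v w = 0" for w
    by (rule inj[rotated]) (intro fsp_closed app_fsp[OF N] uv)
  then have "app N u w = app N v w" for w by (metis right_minus_eq)
  then show "act N u = act N v"
    by (intro mop_eqI_fsp[OF pre_carrier[OF N] pre_carrier[OF N]] uv)
qed

lemma dd_hom_one: "pre_module D M \<Longrightarrow> 1\<^sub>m (mdim M) \<in> dd_hom D M M"
  unfolding dd_hom_def
  by (intro CollectI conjI ballI)
    (simp, metis pre_carrier left_mult_one_mat right_mult_one_mat)

text \<open>A two-sided inverse of a homomorphism is a homomorphism, so \<open>E\<close> is only
  required to be a matrix.\<close>

lemma dd_isoI:
  fixes D :: "('g, 'k::field) group_datum"
  assumes M: "dd_module D M" and N: "dd_module D N" and F: "F \<in> dd_hom D M N"
    and E: "E \<in> carrier_mat (mdim M) (mdim N)" and EF: "E * F = 1\<^sub>m (mdim M)" and FE: "F * E = 1\<^sub>m (mdim N)"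
  shows "dd_iso D M N"
proof -
  note M' = dd_module_pre[OF M] and N' = dd_module_pre[OF N]
  note Fc = dd_hom_carrier[OF F]
  have fe: "mop F (mop E w) = w" if "w \<in> fsp (mdim N)" for w
    using mop_mult[OF Fc E, of w] FE that by (simp add: mop_one)
  have ef: "mop E (mop F w) = w" if "w \<in> fsp (mdim M)" for w
    using mop_mult[OF E Fc, of w] EF that by (simp add: mop_one)
  have "E \<in> dd_hom D N M"
  proof (rule dd_homI[OF N' M' E])
    fix x and w :: "nat \<Rightarrow> 'k" assume x: "x \<in> dd_gens D" and w: "w \<in> fsp (mdim N)"
    have "mop E (app N (Gen x) w) = mop E (app N (Gen x) (mop F (mop E w)))" using fe w by simp
    also have "\<dots> = mop E (mop F (app M (Gen x) (mop E w)))"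
      using dd_hom_app[OF M' N' F, of "Gen x"] x by simp
    also have "\<dots> = app M (Gen x) (mop E w)" using ef app_fsp[OF M', of "Gen x"] x by simp
    finally show "mop E (app N (Gen x) w) = app M (Gen x) (mop E w)" .
  qed
  then show ?thesis using M N F EF FE by (auto simp: dd_iso_def)
qed

lemma dd_iso_sym: "dd_iso D M N \<Longrightarrow> dd_iso D N M"
  by (auto simp: dd_iso_def)

lemma dd_iso_trans:
  assumes "dd_iso D L M" "dd_iso D M N"
  shows "dd_iso D L N"
proof -
  obtain F E where F: "F \<in> dd_hom D L M" "E \<in> dd_hom D M L" "E * F = 1\<^sub>m (mdim L)" "F * E = 1\<^sub>m (mdim M)"
    using assms(1) by (auto simp: dd_iso_def)
  obtain F' E' where F': "F' \<in> dd_hom D M N" "E' \<in> dd_hom D N M" "E' * F' = 1\<^sub>m (mdim M)" "F' * E' = 1\<^sub>m (mdim N)"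
    using assms(2) by (auto simp: dd_iso_def)
  have m: "dd_module D L" "dd_module D M" "dd_module D N" using assms by (auto simp: dd_iso_def)
  note c = F(1,2)[THEN dd_hom_carrier] F'(1,2)[THEN dd_hom_carrier]
  show ?thesis
  proof (rule dd_isoI[OF m(1,3)])
    show "F' * F \<in> dd_hom D L N" using m F F' by (blast intro: dd_hom_comp dd_module_pre)
    show "E * E' \<in> carrier_mat (mdim L) (mdim N)" using c by simp
    have "E * E' * (F' * F) = E * (E' * (F' * F))" using c by (intro assoc_mult_mat) auto
    also have "E' * (F' * F) = E' * F' * F" using c by (intro assoc_mult_mat[symmetric]) auto
    finally show "E * E' * (F' * F) = 1\<^sub>m (mdim L)" using F F' c by simp
    have "F' * F * (E * E') = F' * (F * (E * E'))" using c by (intro assoc_mult_mat) auto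
    also have "F * (E * E') = F * E * E'" using c by (intro assoc_mult_mat[symmetric]) auto
    finally show "F' * F * (E * E') = 1\<^sub>m (mdim N)" using F F' c by simp
  qed
qed

lemma dd_iso_mdim: "dd_iso D M (N :: ('g, 'k::field_char_0) ddmod) \<Longrightarrow> mdim M = mdim N"
proof -
  assume "dd_iso D M N"
  then obtain F E where "F \<in> dd_hom D M N" "E \<in> dd_hom D N M" "E * F = 1\<^sub>m (mdim M)" "F * E = 1\<^sub>m (mdim N)"
    unfolding dd_iso_def by blast
  then show ?thesis by (intro dim_eq_of_inverses[of F _ _ E] dd_hom_carrier)
qed

subsection \<open>Uniqueness of projective covers\<close>

text \<open>Projectivity of \<open>P\<close> gives \<open>H\<close> over \<open>V\<close>,
  surjective because \<open>E'\<close> is essential; projectivity of \<open>Q\<close> splits it by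
  some \<open>K\<close>, and \<open>K\<close> is surjective because \<open>E\<close> is essential. A
  surjective section is an inverse.\<close>

lemma projective_cover_unique:
  assumes P: "projective_cover D P V" and Q: "projective_cover D Q V"
  shows "dd_iso D P Q"
proof -
  obtain E where E: "E \<in> dd_hom D P V" "surj_mat E"
      "\<And>M F. F \<in> dd_hom D M P \<Longrightarrow> dd_module D M \<Longrightarrow> surj_mat (E * F) \<Longrightarrow> surj_mat F"
    using P unfolding projective_cover_def by metis
  obtain E' where E': "E' \<in> dd_hom D Q V" "surj_mat E'"
      "\<And>M F. F \<in> dd_hom D M Q \<Longrightarrow> dd_module D M \<Longrightarrow> surj_mat (E' * F) \<Longrightarrow> surj_mat F"
    using Q unfolding projective_cover_def by metis
  have pP: "dd_projective D P" and pQ: "dd_projective D Q" and V: "dd_module D V"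
    using P Q by (auto simp: projective_cover_def)
  have mP: "dd_module D P" and mQ: "dd_module D Q"
    using pP pQ by (auto simp: dd_projective_def)
  obtain H where H: "H \<in> dd_hom D P Q" "E' * H = E"
    using pP mQ V E(1) E'(1,2) unfolding dd_projective_def by blast
  have sH: "surj_mat H" using E'(3)[OF H(1) mP] H(2) E(2) by simp
  obtain K where K: "K \<in> dd_hom D Q P" "H * K = 1\<^sub>m (mdim Q)"
    using pQ mP mQ H(1) sH dd_hom_one[OF dd_module_pre[OF mQ]] unfolding dd_projective_def by blast
  note c = H(1)[THEN dd_hom_carrier] K(1)[THEN dd_hom_carrier] E(1)[THEN dd_hom_carrier] E'(1)[THEN dd_hom_carrier]
  have "E * K = E' * (H * K)" using c by (simp add: H(2)[symmetric])
  then have "E * K = E'" using c K(2) by simp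
  then have sK: "surj_mat K" using E(3)[OF K(1) mQ] E'(2) by metis
  have "K * H = 1\<^sub>m (mdim P)"
  proof (rule mop_eqI_fsp)
    fix w :: "nat \<Rightarrow> 'b" assume "w \<in> fsp (mdim P)"
    then obtain v where v: "v \<in> fsp (mdim Q)" "w = mop K v"
      using sK surj_mat_mop[OF c(2)] by metis
    have "mop H w = v" using v mop_mult[OF c(1,2), of v] K(2) mop_one[OF v(1)] by simp
    then show "mop (K * H) w = mop (1\<^sub>m (mdim P)) w"
      using v mop_mult[OF c(2,1), of w] mop_one[OF \<open>w \<in> fsp (mdim P)\<close>] by simp
  qed (use c in auto)
  then show ?thesis using dd_isoI[OF mP mQ H(1) c(2)] K(2) by simp
qed

subsection \<open>Direct sums\<close>

text \<open>The component in the second summand of a direct sum whose first summand has dimension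
  \<open>a\<close>.\<close>

definition hi :: "nat \<Rightarrow> (nat \<Rightarrow> 'k) \<Rightarrow> nat \<Rightarrow> 'k" where
  "hi a w = (\<lambda>i. w (i + a))"

lemma hi_simps [simp]: "hi a (v + w :: nat \<Rightarrow> 'k::field) = hi a v + hi a w" "hi a (0 :: nat \<Rightarrow> 'k::field) = 0"
  by (auto simp: hi_def fun_eq_iff ptw)

lemma hi_fsp: "w \<in> fsp (a + b) \<Longrightarrow> hi a w \<in> fsp b"
  by (auto simp: hi_def fsp_def)

lemma sum_split_at: "(\<Sum>j<a + b::nat. f j) = (\<Sum>j<a. f j) + (\<Sum>j<b. f (j + a) :: 'k::comm_monoid_add)"
  by (induct b) (auto simp: ac_simps)

lemma mop_diag_block:
  assumes A: "A \<in> carrier_mat a a" and B: "B \<in> carrier_mat b b"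
  shows "mop (four_block_mat A (0\<^sub>m a b) (0\<^sub>m b a) B) w =
    (\<lambda>i. if i < a then mop A w i else mop B (hi a w) (i - a))" (is "mop ?M w = ?f")
proof
  fix i
  have d: "dim_row ?M = a + b" "dim_col ?M = a + b" using A B by auto
  consider "i < a" | "a \<le> i" "i < a + b" | "a + b \<le> i" by linarith
  then show "mop ?M w i = ?f i"
    by cases (use A B in \<open>auto simp: mop_def d sum_split_at hi_def ptw\<close>)
qed

lemma act_dd_sum_Cons:
  assumes "u \<in> dd_terms D" "pre_module D M" "act (dd_sum Ms) u \<in> carrier_mat (mdim (dd_sum Ms)) (mdim (dd_sum Ms))"
  shows "act (dd_sum (M # Ms)) u = four_block_mat (act M u) (0\<^sub>m (mdim M) (mdim (dd_sum Ms)))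
    (0\<^sub>m (mdim (dd_sum Ms)) (mdim M)) (act (dd_sum Ms) u)"
  using assms pre_carrier[OF assms(2,1)] by (auto simp: dd_sum_def Let_def)

lemma mdim_dd_sum [simp]: "mdim (dd_sum []) = 0" "mdim (dd_sum (M # Ms)) = mdim M + mdim (dd_sum Ms)"
  by (auto simp: dd_sum_def)

lemma pre_module_dd_sum_Nil: "dd_module D (dd_sum [])"
proof (rule pre_module_eq)
  show "pre_module D (dd_sum [])" by (auto simp: pre_module_def dd_sum_def)
qed (auto simp: dd_sum_def)

lemma
  assumes M: "pre_module D M" and N: "pre_module D (dd_sum Ms)"
  shows pre_module_dd_sum_Cons: "pre_module D (dd_sum (M # Ms))"
    and app_dd_sum_Cons: "u \<in> dd_terms D \<Longrightarrow> app (dd_sum (M # Ms)) u w =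
      (\<lambda>i. if i < mdim M then app M u w i else app (dd_sum Ms) u (hi (mdim M) w) (i - mdim M))"
proof -
  let ?S = "dd_sum (M # Ms)" and ?N = "dd_sum Ms"
  note a = act_dd_sum_Cons[OF _ M pre_carrier[OF N]]
  show app: "app (dd_sum (M # Ms)) u w =
      (\<lambda>i. if i < mdim M then app M u w i else app (dd_sum Ms) u (hi (mdim M) w) (i - mdim M))"
    if "u \<in> dd_terms D" for u w
    using that by (simp add: a mop_diag_block[OF pre_carrier[OF M] pre_carrier[OF N]])
  have c: "act ?S u \<in> carrier_mat (mdim ?S) (mdim ?S)" if "u \<in> dd_terms D" for u
    using that pre_carrier[OF M that] pre_carrier[OF N that] by (simp add: a)
  have trunc: "mop A (\<lambda>i. if i < mdim M then f i else g i) = mop A f" if "A \<in> carrier_mat (mdim M) (mdim M)"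
    for A :: "'b mat" and f g
    using that by (auto simp: mop_def fun_eq_iff ptw)
  have hi_eq: "hi (mdim M) (\<lambda>i. if i < mdim M then f i else g (i - mdim M)) = g" for f g :: "nat \<Rightarrow> 'b"
    by (auto simp: hi_def)
  show "pre_module D (dd_sum (M # Ms))"
    unfolding pre_module_def
  proof (intro conjI ballI allI c)
    show "act ?S (Const k) = k \<cdot>\<^sub>m 1\<^sub>m (mdim ?S)" for k
    proof (rule mop_eqI_fsp[of _ "mdim ?S" "mdim ?S"])
      fix w :: "nat \<Rightarrow> 'b" assume w: "w \<in> fsp (mdim ?S)"
      have l: "app M (Const k) w i = k * w i" if "i < mdim M" for i
      proof -
        have "app M (Const k) w = app M (Const k) (\<lambda>i. if i < mdim M then w i else 0)"
          using trunc[OF pre_carrier[OF M], of "Const k" w "\<lambda>_. 0"] by simp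
        then show ?thesis using that by (subst (asm) app_const[OF M]) (auto simp: fsp_def ptw)
      qed
      have h: "app ?N (Const k) (hi (mdim M) w) = k *s hi (mdim M) w"
        using w by (intro app_const[OF N]) (auto intro: hi_fsp)
      show "app ?S (Const k) w = mop (k \<cdot>\<^sub>m 1\<^sub>m (mdim ?S)) w"
        using w h by (simp only: app terms_simps mop_mat_smult mop_one) (auto simp: l fun_eq_iff ptw hi_def)
    qed (use c in auto)
  next
    fix u v assume uv: "u \<in> dd_terms D" "v \<in> dd_terms D"
    show "act ?S (u + v) = act ?S u + act ?S v"
    proof (rule mop_eqI_fsp[of _ "mdim ?S" "mdim ?S"])
      fix w :: "nat \<Rightarrow> 'b"
      show "app ?S (u + v) w = mop (act ?S u + act ?S v) w"
        using uv by (simp add: mop_mat_add[OF c c])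
          (simp add: app app_add[OF M] app_add[OF N] fun_eq_iff ptw)
    qed (use uv c[of u] c[of v] c[of "u + v"] in auto)
    show "act ?S (u * v) = act ?S u * act ?S v"
    proof (rule mop_eqI_fsp[of _ "mdim ?S" "mdim ?S"])
      fix w :: "nat \<Rightarrow> 'b"
      show "app ?S (u * v) w = mop (act ?S u * act ?S v) w"
        using uv by (simp add: mop_mult[OF c c])
          (simp add: app app_mult[OF M] app_mult[OF N] fun_eq_iff ptw trunc[OF pre_carrier[OF M]] hi_eq)
    qed (use uv c[of u] c[of v] c[of "u * v"] in auto)
  qed
qed

lemma dd_module_dd_sum_Cons:
  assumes M: "dd_module D M" and N: "dd_module D (dd_sum Ms)"
  shows "dd_module D (dd_sum (M # Ms))"
proof -
  note M' = dd_module_pre[OF M] and N' = dd_module_pre[OF N]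
  show ?thesis
  proof (rule pre_module_eq[OF pre_module_dd_sum_Cons[OF M' N']])
    fix u v assume uv: "(u, v) \<in> dd_rels D" "u \<in> dd_terms D" "v \<in> dd_terms D"
    have "act M u = act M v" "act (dd_sum Ms) u = act (dd_sum Ms) v"
      using M N alg_eq.rel[OF uv] unfolding dd_module_iff by blast+
    then show "act (dd_sum (M # Ms)) u = act (dd_sum (M # Ms)) v"
      using act_dd_sum_Cons[OF _ M' pre_carrier[OF N']] uv by simp
  qed
qed

section \<open>Characters\<close>

lemma units_group_simps [simp]:
  "carrier units_group = UNIV - {0}" "x \<otimes>\<^bsub>units_group\<^esub> y = x * y" "\<one>\<^bsub>units_group\<^esub> = 1"
  by (simp_all add: units_group_def)

lemma group_units_group: "comm_group (units_group :: 'k::field monoid)"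
proof (rule comm_groupI)
  fix x :: 'k assume "x \<in> carrier units_group"
  then show "\<exists>y\<in>carrier units_group. y \<otimes>\<^bsub>units_group\<^esub> x = \<one>\<^bsub>units_group\<^esub>"
    by (intro bexI[of _ "inverse x"]) auto
qed (auto simp: mult_ac)

lemma units_group_pow: "x [^]\<^bsub>units_group\<^esub> (k::nat) = x ^ k"
proof -
  interpret comm_group "units_group :: 'a monoid" by (rule group_units_group)
  show ?thesis by (induction k) (auto simp: nat_pow_Suc)
qed

lemma char_group_carrierD:
  assumes "\<gamma> \<in> carrier (char_group H)"
  shows "x \<in> carrier H \<Longrightarrow> \<gamma> x \<noteq> 0"
    "x \<in> carrier H \<Longrightarrow> y \<in> carrier H \<Longrightarrow> \<gamma> (x \<otimes>\<^bsub>H\<^esub> y) = \<gamma> x * \<gamma> y"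
    "x \<notin> carrier H \<Longrightarrow> \<gamma> x = undefined"
  using assms by (auto simp: char_group_def hom_def extensional_def)

lemma char_group_one: "group H \<Longrightarrow> \<gamma> \<in> carrier (char_group H) \<Longrightarrow> \<gamma> \<one>\<^bsub>H\<^esub> = 1"
  using char_group_carrierD(2)[of \<gamma> H "\<one>\<^bsub>H\<^esub>" "\<one>\<^bsub>H\<^esub>"] char_group_carrierD(1)[of \<gamma> H "\<one>\<^bsub>H\<^esub>"]
  by (simp add: group.is_monoid monoid.one_closed)

lemma char_group_simps:
  "\<gamma> \<otimes>\<^bsub>char_group H\<^esub> \<delta> = (\<lambda>h\<in>carrier H. \<gamma> h * \<delta> h)"
  "\<one>\<^bsub>char_group H\<^esub> = (\<lambda>h\<in>carrier H. 1)"
  by (simp_all add: char_group_def)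

lemma char_group_carrierI:
  assumes "\<And>x. x \<in> carrier H \<Longrightarrow> \<gamma> x \<noteq> 0"
    "\<And>x y. x \<in> carrier H \<Longrightarrow> y \<in> carrier H \<Longrightarrow> \<gamma> (x \<otimes>\<^bsub>H\<^esub> y) = \<gamma> x * \<gamma> y"
    "\<gamma> \<in> extensional (carrier H)"
  shows "\<gamma> \<in> carrier (char_group H)"
  using assms by (auto simp: char_group_def hom_def)

lemma comm_group_char_group:
  assumes H: "group H"
  shows "comm_group (char_group H :: ('a \<Rightarrow> 'k::field) monoid)"
proof -
  interpret H: group H by (rule H)
  note D = char_group_carrierD(1,2)
  show ?thesis
  proof (rule comm_groupI)
    fix \<gamma> \<delta> :: "'a \<Rightarrow> 'k" assume g: "\<gamma> \<in> carrier (char_group H)" "\<delta> \<in> carrier (char_group H)"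
    show "\<gamma> \<otimes>\<^bsub>char_group H\<^esub> \<delta> \<in> carrier (char_group H)"
      by (rule char_group_carrierI) (auto simp: char_group_simps D[OF g(1)] D[OF g(2)] mult_ac)
    show "\<gamma> \<otimes>\<^bsub>char_group H\<^esub> \<delta> = \<delta> \<otimes>\<^bsub>char_group H\<^esub> \<gamma>"
      by (simp add: char_group_simps mult.commute)
    show "\<one>\<^bsub>char_group H\<^esub> \<otimes>\<^bsub>char_group H\<^esub> \<gamma> = \<gamma>"
      using char_group_carrierD(3)[OF g(1)] by (auto simp: char_group_simps fun_eq_iff restrict_def)
    have "(\<lambda>h\<in>carrier H. inverse (\<gamma> h)) \<in> carrier (char_group H)"
      by (rule char_group_carrierI) (auto simp: D[OF g(1)])
    moreover have "(\<lambda>h\<in>carrier H. inverse (\<gamma> h)) \<otimes>\<^bsub>char_group H\<^esub> \<gamma> = \<one>\<^bsub>char_group H\<^esub>"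
      by (auto simp: char_group_simps fun_eq_iff restrict_def D[OF g(1)])
    ultimately show "\<exists>\<delta>\<in>carrier (char_group H). \<delta> \<otimes>\<^bsub>char_group H\<^esub> \<gamma> = \<one>\<^bsub>char_group H\<^esub>" by blast
  next
    show "\<one>\<^bsub>char_group H\<^esub> \<in> carrier (char_group H :: ('a \<Rightarrow> 'k) monoid)"
      by (rule char_group_carrierI) (auto simp: char_group_simps)
  qed (auto simp: char_group_simps mult_ac fun_eq_iff restrict_def)
qed

lemma char_group_pow:
  fixes \<gamma> :: "'a \<Rightarrow> 'k::field"
  assumes "group H" "\<gamma> \<in> carrier (char_group H)" "x \<in> carrier H"
  shows "(\<gamma> [^]\<^bsub>char_group H\<^esub> (k::nat)) x = \<gamma> x ^ k"
proof -
  interpret comm_group "char_group H :: ('a \<Rightarrow> 'k) monoid" by (rule comm_group_char_group[OF assms(1)])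
  show ?thesis using assms(3) by (induction k) (simp_all add: char_group_simps)
qed

lemma char_group_arg_pow:
  assumes "group H" "\<gamma> \<in> carrier (char_group H)" "x \<in> carrier H"
  shows "\<gamma> (x [^]\<^bsub>H\<^esub> (k::nat)) = \<gamma> x ^ k"
proof -
  interpret group H by (rule assms)
  show ?thesis
    by (induction k) (use assms in \<open>auto simp: char_group_one char_group_carrierD(2)[OF assms(2)]\<close>)
qed

text \<open>All values are roots of z^h = 1, with h the order of the group. Finiteness of \<Gamma>
  is what permits averaging over it in \<open>wproj\<close>.\<close>

lemma finite_char_group:
  assumes H: "group H" and fin: "finite (carrier H)"
  shows "finite (carrier (char_group H :: ('a \<Rightarrow> 'k::field) monoid))"
proof -
  interpret group H by (rule H)
  let ?R = "{z::'k. z ^ Coset.order H = 1}"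
  have "Coset.order H > 0" using fin order_gt_0_iff_finite by blast
  then have "monom (1::'k) (Coset.order H) - 1 \<noteq> 0"
    by (metis degree_1 degree_monom_eq eq_iff_diff_eq_0 less_numeral_extra(3) zero_neq_one)
  then have "finite {z. poly (monom (1::'k) (Coset.order H) - 1) z = 0}" by (rule poly_roots_finite)
  then have "finite ?R" by (simp add: poly_monom)
  moreover have "carrier (char_group H :: ('a \<Rightarrow> 'k) monoid) \<subseteq> carrier H \<rightarrow>\<^sub>E ?R"
  proof
    fix \<gamma> :: "'a \<Rightarrow> 'k" assume g: "\<gamma> \<in> carrier (char_group H)"
    have "\<gamma> x ^ Coset.order H = 1" if "x \<in> carrier H" for x
      using char_group_arg_pow[OF H g that, of "Coset.order H"] pow_order_eq_1[OF that] char_group_one[OF H g] by simp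
    moreover have "\<gamma> \<in> extensional (carrier H)" using g by (simp add: char_group_def)
    ultimately show "\<gamma> \<in> carrier H \<rightarrow>\<^sub>E ?R" by (auto simp: PiE_def)
  qed
  ultimately show ?thesis using fin by (meson finite_PiE finite_subset)
qed

section \<open>Quantum integers\<close>

lemma qnum_simps [simp]: "qnum q 0 = 0" "qnum q (Suc k) = qnum q k + q ^ k"
  by (simp_all add: qnum_def)

lemma qnum_Suc': "qnum q (Suc k) = 1 + q * qnum q k"
proof (induction k)
  case (Suc k)
  have "qnum q (Suc (Suc k)) = 1 + q * qnum q k + q ^ Suc k" unfolding qnum_simps(2)[of q "Suc k"] Suc ..
  then show ?case by (simp only: qnum_simps ring_distribs power_Suc mult_1_right add.assoc)
qed simp

lemma qnum_add: "qnum q (j + k) = qnum q j + q ^ j * qnum q k"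
  by (induct k) (simp_all add: ring_distribs ac_simps power_add)

lemma qnum_geom: "(q - 1) * qnum q k = q ^ k - 1"
  by (induction k) (simp_all add: algebra_simps)

lemma qfact_simps [simp]: "qfact q 0 = 1" "qfact q (Suc k) = qfact q k * (qnum q k + q ^ k)"
  by (simp_all add: qfact_def)

locale datum =
  fixes D :: "('g, 'k::field_char_0) group_datum"
  assumes D: "is_group_datum D"
begin

abbreviation "GG \<equiv> carrier (grp D)"
abbreviation "CC \<equiv> carrier (Gam D)"
abbreviation "q \<equiv> rho D"
abbreviation "n \<equiv> nn D"
abbreviation "a \<equiv> pt D"
abbreviation "X \<equiv> chi D"

lemma grp: "comm_group (grp D)" "group (grp D)" "finite GG"
  using D by (auto simp: is_group_datum_def comm_group_def)

lemma Gam: "comm_group (Gam D)" "group (Gam D)" "finite CC"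
  using comm_group_char_group[OF grp(2), where 'k='k] finite_char_group[OF grp(2,3), where 'k='k]
  by (auto simp: comm_group_def)

lemma closed [simp, intro]:
  "a \<in> GG" "X \<in> CC" "\<one>\<^bsub>grp D\<^esub> \<in> GG" "\<one>\<^bsub>Gam D\<^esub> \<in> CC"
  "g \<in> GG \<Longrightarrow> h \<in> GG \<Longrightarrow> g \<otimes>\<^bsub>grp D\<^esub> h \<in> GG" "\<gamma> \<in> CC \<Longrightarrow> \<delta> \<in> CC \<Longrightarrow> \<gamma> \<otimes>\<^bsub>Gam D\<^esub> \<delta> \<in> CC"
  "g \<in> GG \<Longrightarrow> g [^]\<^bsub>grp D\<^esub> (k::nat) \<in> GG"
  using D grp(2) Gam(2)
  by (auto simp: is_group_datum_def group.is_monoid monoid.one_closed monoid.m_closed monoid.nat_pow_closed)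

lemma n2: "2 \<le> n"
  using D by (auto simp: is_group_datum_def)

lemma char_nz [simp]: "\<gamma> \<in> CC \<Longrightarrow> g \<in> GG \<Longrightarrow> \<gamma> g \<noteq> 0"
  by (rule char_group_carrierD)

lemma char_mult: "\<gamma> \<in> CC \<Longrightarrow> g \<in> GG \<Longrightarrow> h \<in> GG \<Longrightarrow> \<gamma> (g \<otimes>\<^bsub>grp D\<^esub> h) = \<gamma> g * \<gamma> h"
  by (rule char_group_carrierD)

lemma char_one: "\<gamma> \<in> CC \<Longrightarrow> \<gamma> \<one>\<^bsub>grp D\<^esub> = 1"
  by (rule char_group_one[OF grp(2)])

lemma q_X: "X a = q" and q_nz [simp]: "q \<noteq> 0"
  using char_nz[of X a] by (auto simp: rho_def)

lemma q_pow_1_iff: "q ^ k = 1 \<longleftrightarrow> n dvd k"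
proof -
  interpret U: comm_group "units_group :: 'k monoid" by (rule group_units_group)
  have "q \<in> carrier units_group" by simp
  from U.pow_eq_id[OF this, of k] show ?thesis by (simp add: units_group_pow nn_def)
qed

lemma q_n [simp]: "q ^ n = 1"
  by (simp add: q_pow_1_iff)

lemma q_pow_neq_1: "0 < k \<Longrightarrow> k < n \<Longrightarrow> q ^ k \<noteq> 1"
  by (auto simp: q_pow_1_iff dest: dvd_imp_le)

lemma q_neq_1: "q \<noteq> 1"
  using q_pow_neq_1[of 1] n2 by simp

lemma qnum_0_iff: "qnum q k = 0 \<longleftrightarrow> n dvd k"
  using qnum_geom[of q k] q_neq_1 q_pow_1_iff[of k] by auto

lemma qnum_nz: "0 < k \<Longrightarrow> k < n \<Longrightarrow> qnum q k \<noteq> 0"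
  by (auto simp: qnum_0_iff dest: dvd_imp_le)

lemma qnum_n [simp]: "qnum q n = 0"
  by (simp add: qnum_0_iff)

lemma qfact_nz: "k < n \<Longrightarrow> qfact q k \<noteq> 0"
  using qnum_nz by (auto simp: qfact_def)

lemma qfact_n [simp]: "qfact q n = 0"
  using n2 by (auto simp: qfact_def intro!: bexI[of _ n])

lemma X_pow_n: "\<not> nilpotent_type D \<Longrightarrow> g \<in> GG \<Longrightarrow> X g ^ n = 1"
proof -
  assume "\<not> nilpotent_type D" and g: "g \<in> GG"
  then have "(X [^]\<^bsub>Gam D\<^esub> n) g = \<one>\<^bsub>Gam D\<^esub> g" using D by (auto simp: is_group_datum_def)
  then show ?thesis using char_group_pow[OF grp(2) closed(2) g] g by (simp add: char_group_simps)
qed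

text \<open>If no character detects \<open>a\<^sup>n\<close>, the correction terms of the non-nilpotent relations vanish, and
  the module category does not see the difference to the nilpotent case.\<close>

definition twisted :: bool where
  "twisted \<longleftrightarrow> \<not> nilpotent_type D \<and> (\<exists>\<gamma>\<in>CC. \<gamma> a ^ n \<noteq> 1)"

definition cw :: 'k where
  "cw = (if twisted then inverse (qfact q (n - 1)) else 0)"

text \<open>\<open>upg\<close> and \<open>upc\<close> multiply by the k-th power of
  \<open>phi D\<close>, on the restrictions of a character to G and to \<Gamma>; \<open>dng\<close>
  and \<open>dnc\<close> multiply by the inverse power.\<close>

definition upg :: "nat \<Rightarrow> ('g \<Rightarrow> 'k) \<Rightarrow> 'g \<Rightarrow> 'k" where
  "upg k lg = (\<lambda>g. inverse (X g) ^ k * lg g)"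

definition upc :: "nat \<Rightarrow> (('g \<Rightarrow> 'k) \<Rightarrow> 'k) \<Rightarrow> ('g \<Rightarrow> 'k) \<Rightarrow> 'k" where
  "upc k lc = (\<lambda>\<gamma>. \<gamma> a ^ k * lc \<gamma>)"

definition dng :: "nat \<Rightarrow> ('g \<Rightarrow> 'k) \<Rightarrow> 'g \<Rightarrow> 'k" where
  "dng k lg = (\<lambda>g. X g ^ k * lg g)"

definition dnc :: "nat \<Rightarrow> (('g \<Rightarrow> 'k) \<Rightarrow> 'k) \<Rightarrow> ('g \<Rightarrow> 'k) \<Rightarrow> 'k" where
  "dnc k lc = (\<lambda>\<gamma>. inverse (\<gamma> a) ^ k * lc \<gamma>)"

lemma shift_a: "upg k lg a = lg a * inverse q ^ k" "upc k lc X = lc X * q ^ k"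
  "dng k lg a = lg a * q ^ k" "dnc k lc X = lc X * inverse q ^ k"
  by (simp_all add: upg_def upc_def dng_def dnc_def q_X)

lemma shift_0 [simp]: "upg 0 lg = lg" "upc 0 lc = lc" "dng 0 lg = lg" "dnc 0 lc = lc"
  by (simp_all add: upg_def upc_def dng_def dnc_def)

lemma shift_up: "upg j (upg k lg) = upg (j + k) lg" "upc j (upc k lc) = upc (j + k) lc"
  by (simp_all add: upg_def upc_def power_add mult.assoc)

end

section \<open>Representations of the generators\<close>

declare One_nat_def [simp del]

lemma mop_pow_mat: "A \<in> carrier_mat e e \<Longrightarrow> v \<in> fsp e \<Longrightarrow> mop (A ^\<^sub>m k) v = (mop A ^^ k) v"
proof (induction k arbitrary: v)
  case (Suc k)
  then show ?case
    using mop_mult[OF pow_carrier_mat[OF Suc(2)] Suc(2), of k v] mop_fsp[OF Suc(2), of v]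
    by (simp add: funpow_swap1)
qed (simp add: mop_one)

text \<open>The action of \<open>x\<close> in terms of that of \<open>y = x - c(\<rho>a - \<chi>)\<xi>\<^sup>n\<^sup>-\<^sup>1\<close>, where \<open>y\<close> satisfies the relations
  between \<open>x\<close> and \<open>\<Gamma>\<close> of the nilpotent type.\<close>

definition (in datum) tw_mat :: "'k mat \<Rightarrow> 'k mat \<Rightarrow> 'k mat \<Rightarrow> 'k mat \<Rightarrow> 'k mat" where
  "tw_mat ka kx xi y = y + cw \<cdot>\<^sub>m ((q \<cdot>\<^sub>m ka + (- 1) \<cdot>\<^sub>m kx) * xi ^\<^sub>m (n - 1))"

lemma (in datum)
  assumes c: "ka \<in> carrier_mat d d" "kx \<in> carrier_mat d d" "xi \<in> carrier_mat d d" "y \<in> carrier_mat d d"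
  shows tw_mat_c: "tw_mat ka kx xi y \<in> carrier_mat d d"
    and mop_tw_mat: "v \<in> fsp d \<Longrightarrow> mop (tw_mat ka kx xi y) v = mop y v +
      cw *s (q *s mop ka ((mop xi ^^ (n - 1)) v) - mop kx ((mop xi ^^ (n - 1)) v))"
proof -
  have c': "q \<cdot>\<^sub>m ka \<in> carrier_mat d d" "(- 1) \<cdot>\<^sub>m kx \<in> carrier_mat d d" "xi ^\<^sub>m (n - 1) \<in> carrier_mat d d"
    using c by auto
  note c'' = add_carrier_mat[OF c'(2), of "q \<cdot>\<^sub>m ka"]
  show "tw_mat ka kx xi y \<in> carrier_mat d d"
    unfolding tw_mat_def using mult_carrier_mat[OF c'' c'(3)] by simp
  show "mop (tw_mat ka kx xi y) v = mop y v +
      cw *s (q *s mop ka ((mop xi ^^ (n - 1)) v) - mop kx ((mop xi ^^ (n - 1)) v))" if "v \<in> fsp d"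
    unfolding tw_mat_def using that c mult_carrier_mat[OF c'' c'(3)]
    by (simp add: mop_mat_add[of _ d d] mop_mult[OF c'' c'(3)] mop_mat_add[OF c'(1,2)]
        mop_mat_smult mop_pow_mat)
qed

text \<open>The relations without x, shared by the presentation with x (\<open>ddrep\<close>) and
  the one with y (\<open>nilrep\<close>). Equations are asserted on \<open>fsp d\<close> only, since
  the matrices ignore the coordinates from \<open>d\<close> on.\<close>

locale torus = datum D for D :: "('g, 'k::field_char_0) group_datum" +
  fixes d :: nat and kg :: "'g \<Rightarrow> 'k mat" and kc :: "('g \<Rightarrow> 'k) \<Rightarrow> 'k mat" and xi :: "'k mat"
  assumes kg_c: "g \<in> GG \<Longrightarrow> kg g \<in> carrier_mat d d"
    and kc_c: "\<gamma> \<in> CC \<Longrightarrow> kc \<gamma> \<in> carrier_mat d d"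
    and xi_c: "xi \<in> carrier_mat d d"
    and kg_mult: "g \<in> GG \<Longrightarrow> h \<in> GG \<Longrightarrow> v \<in> fsp d \<Longrightarrow>
      mop (kg g) (mop (kg h) v) = mop (kg (g \<otimes>\<^bsub>grp D\<^esub> h)) v"
    and kg_one: "v \<in> fsp d \<Longrightarrow> mop (kg \<one>\<^bsub>grp D\<^esub>) v = v"
    and kc_mult: "\<gamma> \<in> CC \<Longrightarrow> \<delta> \<in> CC \<Longrightarrow> v \<in> fsp d \<Longrightarrow>
      mop (kc \<gamma>) (mop (kc \<delta>) v) = mop (kc (\<gamma> \<otimes>\<^bsub>Gam D\<^esub> \<delta>)) v"
    and kc_one: "v \<in> fsp d \<Longrightarrow> mop (kc \<one>\<^bsub>Gam D\<^esub>) v = v"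
    and kg_kc: "g \<in> GG \<Longrightarrow> \<gamma> \<in> CC \<Longrightarrow> v \<in> fsp d \<Longrightarrow>
      mop (kg g) (mop (kc \<gamma>) v) = mop (kc \<gamma>) (mop (kg g) v)"
    and xi_kg: "g \<in> GG \<Longrightarrow> v \<in> fsp d \<Longrightarrow>
      mop xi (mop (kg g) v) = inverse (X g) *s mop (kg g) (mop xi v)"
    and xi_kc: "\<gamma> \<in> CC \<Longrightarrow> v \<in> fsp d \<Longrightarrow>
      mop xi (mop (kc \<gamma>) v) = \<gamma> a *s mop (kc \<gamma>) (mop xi v)"
    and xi_n: "v \<in> fsp d \<Longrightarrow> (mop xi ^^ n) v = 0"
begin

lemma op_fsp [simp, intro]:
  "g \<in> GG \<Longrightarrow> mop (kg g) v \<in> fsp d" "\<gamma> \<in> CC \<Longrightarrow> mop (kc \<gamma>) v \<in> fsp d" "mop xi v \<in> fsp d"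
  "v \<in> fsp d \<Longrightarrow> (mop xi ^^ k) v \<in> fsp d"
  by (simp_all add: mop_fsp[OF kg_c] mop_fsp[OF kc_c] mop_fsp[OF xi_c] funpow_fsp[OF xi_c])

lemma kg_comm: "g \<in> GG \<Longrightarrow> h \<in> GG \<Longrightarrow> v \<in> fsp d \<Longrightarrow>
    mop (kg g) (mop (kg h) v) = mop (kg h) (mop (kg g) v)"
  using comm_groupE(4)[OF grp(1), of g h] by (simp add: kg_mult)

lemma kc_comm: "\<gamma> \<in> CC \<Longrightarrow> \<delta> \<in> CC \<Longrightarrow> v \<in> fsp d \<Longrightarrow>
    mop (kc \<gamma>) (mop (kc \<delta>) v) = mop (kc \<delta>) (mop (kc \<gamma>) v)"
  using comm_groupE(4)[OF Gam(1), of \<gamma> \<delta>] by (simp add: kc_mult)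

lemma xi_pow_kg: "g \<in> GG \<Longrightarrow> v \<in> fsp d \<Longrightarrow>
    (mop xi ^^ k) (mop (kg g) v) = inverse (X g) ^ k *s mop (kg g) ((mop xi ^^ k) v)"
  by (induction k) (simp_all add: xi_kg mult.commute)

lemma xi_pow_kc: "\<gamma> \<in> CC \<Longrightarrow> v \<in> fsp d \<Longrightarrow>
    (mop xi ^^ k) (mop (kc \<gamma>) v) = \<gamma> a ^ k *s mop (kc \<gamma>) ((mop xi ^^ k) v)"
  by (induction k) (simp_all add: xi_kc mult.commute)

text \<open>The operator (\<rho>a - \<chi>)\<xi>^(n-1) of the correction term in the non-nilpotent
  relation.\<close>

definition zop :: "(nat \<Rightarrow> 'k) \<Rightarrow> nat \<Rightarrow> 'k" where
  "zop v = q *s mop (kg a) ((mop xi ^^ (n - 1)) v) - mop (kc X) ((mop xi ^^ (n - 1)) v)"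

lemma zop_lin [simp]: "zop (v + w) = zop v + zop w" "zop (c *s v) = c *s zop v"
  by (auto simp: zop_def sc_distrib algebra_simps)

lemma zop_kg: "g \<in> GG \<Longrightarrow> v \<in> fsp d \<Longrightarrow> zop (mop (kg g) v) = inverse (X g) ^ (n - 1) *s mop (kg g) (zop v)"
  by (simp add: zop_def xi_pow_kg kg_comm[of a] kg_kc[of g X] sc_distrib mult.commute)

lemma zop_kc: "\<gamma> \<in> CC \<Longrightarrow> v \<in> fsp d \<Longrightarrow> zop (mop (kc \<gamma>) v) = \<gamma> a ^ (n - 1) *s mop (kc \<gamma>) (zop v)"
  by (simp add: zop_def xi_pow_kc kc_comm[of X] kg_kc[of a \<gamma>] sc_distrib mult.commute)

lemma xi_Suc_n: "v \<in> fsp d \<Longrightarrow> mop xi ((mop xi ^^ (n - 1)) v) = 0"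
proof -
  assume "v \<in> fsp d"
  then have "(mop xi ^^ Suc (n - 1)) v = 0" using xi_n n2 by simp
  then show ?thesis by simp
qed

text \<open>Together with \<open>zop_xi\<close>: both products vanish because \<xi>^n = 0, so
  passing between x and y does not change the commutator with \<xi>.\<close>

lemma xi_zop: "v \<in> fsp d \<Longrightarrow> mop xi (zop v) = 0"
  by (simp add: zop_def xi_kg xi_kc xi_Suc_n)

lemma zop_xi: "v \<in> fsp d \<Longrightarrow> zop (mop xi v) = 0"
  by (simp add: zop_def funpow_swap1[symmetric] xi_Suc_n)

text \<open>The zero vector has every weight, and \<open>lg\<close>, \<open>lc\<close> are arbitrary
  functions. This keeps weight spaces closed under linear combinations and lets weights be shifted
  freely.\<close>

definition wt :: "('g \<Rightarrow> 'k) \<Rightarrow> (('g \<Rightarrow> 'k) \<Rightarrow> 'k) \<Rightarrow> (nat \<Rightarrow> 'k) \<Rightarrow> bool" where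
  "wt lg lc v \<longleftrightarrow> v \<in> fsp d \<and> (\<forall>g\<in>GG. mop (kg g) v = lg g *s v) \<and> (\<forall>\<gamma>\<in>CC. mop (kc \<gamma>) v = lc \<gamma> *s v)"

lemma wtD: "wt lg lc v \<Longrightarrow> v \<in> fsp d" "wt lg lc v \<Longrightarrow> g \<in> GG \<Longrightarrow> mop (kg g) v = lg g *s v"
  "wt lg lc v \<Longrightarrow> \<gamma> \<in> CC \<Longrightarrow> mop (kc \<gamma>) v = lc \<gamma> *s v"
  by (auto simp: wt_def)

lemma wt_lin: "wt lg lc v \<Longrightarrow> wt lg lc w \<Longrightarrow> wt lg lc (v + w)" "wt lg lc v \<Longrightarrow> wt lg lc (c *s v)"
  "wt lg lc 0" "wt lg lc v \<Longrightarrow> wt lg lc w \<Longrightarrow> wt lg lc (v - w)"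
  by (auto simp: wt_def sc_distrib mult.commute)

lemma wt_cong: "wt lg lc v \<Longrightarrow> (\<And>g. g \<in> GG \<Longrightarrow> lg g = lg' g) \<Longrightarrow> (\<And>\<gamma>. \<gamma> \<in> CC \<Longrightarrow> lc \<gamma> = lc' \<gamma>) \<Longrightarrow> wt lg' lc' v"
  by (auto simp: wt_def)

lemma wt_xi_pow: "wt lg lc v \<Longrightarrow> wt (dng k lg) (dnc k lc) ((mop xi ^^ k) v)"
proof -
  assume v: "wt lg lc v"
  have "mop (kg g) ((mop xi ^^ k) v) = X g ^ k *s lg g *s (mop xi ^^ k) v" if "g \<in> GG" for g
    using xi_pow_kg[OF that wtD(1)[OF v], of k, symmetric] wtD(2)[OF v that] that
    by (metis (no_types, lifting) char_nz closed(2) funpow_mop_lin(3) nonzero_mult_div_cancel_left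
        inverse_eq_divide sc_simps(1,4) power_not_zero mult.commute power_inverse right_inverse)
  moreover have "mop (kc \<gamma>) ((mop xi ^^ k) v) = inverse (\<gamma> a) ^ k *s lc \<gamma> *s (mop xi ^^ k) v" if "\<gamma> \<in> CC" for \<gamma>
    using xi_pow_kc[OF that wtD(1)[OF v], of k, symmetric] wtD(3)[OF v that] that
    by (metis (no_types, lifting) char_nz closed(1) funpow_mop_lin(3) sc_simps(1,4) power_not_zero
        power_inverse left_inverse)
  ultimately show ?thesis using wtD(1)[OF v] by (auto simp: wt_def dng_def dnc_def)
qed

lemma wt_xi: "wt lg lc v \<Longrightarrow> wt (dng 1 lg) (dnc 1 lc) (mop xi v)"
  using wt_xi_pow[of lg lc v 1] by (simp add: One_nat_def)

end

text \<open>The relations of nilpotent type for y, without any relation for y^n. That power is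
  handled separately, on weight vectors, by \<open>y_n_zero\<close>.\<close>

locale nilrep = torus D d kg kc xi
  for D :: "('g, 'k::field_char_0) group_datum" and d kg kc xi +
  fixes y :: "'k mat"
  assumes y_c: "y \<in> carrier_mat d d"
    and y_kg: "g \<in> GG \<Longrightarrow> v \<in> fsp d \<Longrightarrow> mop y (mop (kg g) v) = X g *s mop (kg g) (mop y v)"
    and y_kc: "\<gamma> \<in> CC \<Longrightarrow> v \<in> fsp d \<Longrightarrow> \<gamma> a *s mop y (mop (kc \<gamma>) v) = mop (kc \<gamma>) (mop y v)"
    and comm: "v \<in> fsp d \<Longrightarrow> mop y (mop xi v) - mop xi (mop y v) = mop (kg a) v - mop (kc X) v"

locale ddrep = torus D d kg kc xi
  for D :: "('g, 'k::field_char_0) group_datum" and d kg kc xi +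
  fixes x :: "'k mat"
  assumes x_c: "x \<in> carrier_mat d d"
    and x_n: "v \<in> fsp d \<Longrightarrow> (mop x ^^ n) v = alp D *s (mop (kg (a [^]\<^bsub>grp D\<^esub> n)) v - v)"
    and x_kg: "g \<in> GG \<Longrightarrow> v \<in> fsp d \<Longrightarrow> mop x (mop (kg g) v) = X g *s mop (kg g) (mop x v)"
    and x_kc: "\<gamma> \<in> CC \<Longrightarrow> v \<in> fsp d \<Longrightarrow> \<gamma> a *s mop x (mop (kc \<gamma>) v) = mop (kc \<gamma>) (mop x v) +
      (if nilpotent_type D then 0 else (\<gamma> a ^ n - 1) / qfact q (n - 1)) *s mop (kc \<gamma>) (zop v)"
    and x_comm: "v \<in> fsp d \<Longrightarrow> mop x (mop xi v) - mop xi (mop x v) = mop (kg a) v - mop (kc X) v"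

context torus
begin

text \<open>In the twisted case \<chi>^n = 1, so moving g past \<xi>^(n-1) costs \<chi>(g)^(1-n) =
  \<chi>(g), the same factor as for x.\<close>

lemma cw_zop_kg: "g \<in> GG \<Longrightarrow> v \<in> fsp d \<Longrightarrow> cw *s zop (mop (kg g) v) = cw *s X g *s mop (kg g) (zop v)"
proof (cases twisted)
  case True
  assume g: "g \<in> GG" and v: "v \<in> fsp d"
  have "X g * X g ^ (n - 1) = 1"
    using X_pow_n[of g] True g n2 by (simp add: twisted_def power_eq_if[of _ n])
  then have "inverse (X g) ^ (n - 1) = X g"
    by (metis inverse_unique mult.commute power_inverse)
  then show ?thesis using g v by (simp add: zop_kg)
qed (simp add: cw_def)

text \<open>Moving \<gamma> past \<xi>^(n-1) gives \<gamma>(a)^(n-1), hence \<gamma>(a)^n in total.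
  The surplus \<gamma>(a)^n - 1 matches the coefficient of the relation for x precisely because c is
  the inverse of the q-factorial of n - 1. Without twist either the type is nilpotent or
  \<gamma>(a)^n = 1, and all terms vanish.\<close>

lemma cw_zop_kc:
  assumes "\<gamma> \<in> CC" "v \<in> fsp d"
  shows "\<gamma> a *s cw *s zop (mop (kc \<gamma>) v) = cw *s mop (kc \<gamma>) (zop v) +
    (if nilpotent_type D then 0 else (\<gamma> a ^ n - 1) / qfact q (n - 1)) *s mop (kc \<gamma>) (zop v)"
proof (cases twisted)
  case True
  have "\<gamma> a * \<gamma> a ^ (n - 1) = \<gamma> a ^ n" using n2 by (simp add: power_eq_if[of _ n])
  moreover have "cw *s mop (kc \<gamma>) (zop v) + ((\<gamma> a ^ n - 1) / qfact q (n - 1)) *s mop (kc \<gamma>) (zop v) =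
      (cw * \<gamma> a ^ n) *s mop (kc \<gamma>) (zop v)"
    using True qfact_nz[of "n - 1"] n2 by (simp add: cw_def sc_distrib(2)[symmetric] field_simps)
  ultimately show ?thesis
    using assms True by (simp add: zop_kc twisted_def mult_ac)
next
  case False
  then show ?thesis using assms by (auto simp: cw_def twisted_def)
qed

lemma ddrep_twist:
  assumes "nilrep D d kg kc xi y" and x: "x \<in> carrier_mat d d"
    and xv: "\<And>v. v \<in> fsp d \<Longrightarrow> mop x v = mop y v + cw *s zop v"
    and x_n: "\<And>v. v \<in> fsp d \<Longrightarrow> (mop x ^^ n) v = alp D *s (mop (kg (a [^]\<^bsub>grp D\<^esub> n)) v - v)"
  shows "ddrep D d kg kc xi x"
proof -
  interpret N: nilrep D d kg kc xi y by (rule assms(1))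
  have [simp]: "mop y v \<in> fsp d" for v using mop_fsp[OF N.y_c] .
  show ?thesis
  proof
    show "x \<in> carrier_mat d d" by (rule x)
    fix v :: "nat \<Rightarrow> 'k" assume v: "v \<in> fsp d"
    show "(mop x ^^ n) v = alp D *s (mop (kg (a [^]\<^bsub>grp D\<^esub> n)) v - v)" by (rule x_n[OF v])
    show "mop x (mop (kg g) v) = X g *s mop (kg g) (mop x v)" if "g \<in> GG" for g
      using that v by (simp add: xv cw_zop_kg N.y_kg sc_distrib mult.commute)
    show "mop x (mop xi v) - mop xi (mop x v) = mop (kg a) v - mop (kc X) v"
      using v N.comm[OF v] by (simp add: xv zop_xi xi_zop)
    show "\<gamma> a *s mop x (mop (kc \<gamma>) v) = mop (kc \<gamma>) (mop x v) +
      (if nilpotent_type D then 0 else (\<gamma> a ^ n - 1) / qfact q (n - 1)) *s mop (kc \<gamma>) (zop v)"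
      if g: "\<gamma> \<in> CC" for \<gamma>
    proof -
      have "\<gamma> a *s mop x (mop (kc \<gamma>) v) = \<gamma> a *s mop y (mop (kc \<gamma>) v) + \<gamma> a *s cw *s zop (mop (kc \<gamma>) v)"
        using v g by (simp add: xv sc_distrib(1))
      then show ?thesis unfolding cw_zop_kc[OF g v] N.y_kc[OF g v] using v by (simp add: xv add.assoc)
    qed
  qed
qed

lemma nilrep_untwist:
  assumes "ddrep D d kg kc xi x" and y: "y \<in> carrier_mat d d"
    and yv: "\<And>v. v \<in> fsp d \<Longrightarrow> mop y v = mop x v - cw *s zop v"
  shows "nilrep D d kg kc xi y"
proof -
  interpret N: ddrep D d kg kc xi x by (rule assms(1))
  have [simp]: "mop x v \<in> fsp d" for v using mop_fsp[OF N.x_c] .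
  show ?thesis
  proof
    show "y \<in> carrier_mat d d" by (rule y)
    fix v :: "nat \<Rightarrow> 'k" assume v: "v \<in> fsp d"
    show "mop y (mop (kg g) v) = X g *s mop (kg g) (mop y v)" if "g \<in> GG" for g
      using that v by (simp add: yv cw_zop_kg N.x_kg sc_distrib mult.commute)
    show "mop y (mop xi v) - mop xi (mop y v) = mop (kg a) v - mop (kc X) v"
      using v N.x_comm[OF v] by (simp add: yv zop_xi xi_zop)
    show "\<gamma> a *s mop y (mop (kc \<gamma>) v) = mop (kc \<gamma>) (mop y v)" if g: "\<gamma> \<in> CC" for \<gamma>
    proof -
      have "\<gamma> a *s mop y (mop (kc \<gamma>) v) = \<gamma> a *s mop x (mop (kc \<gamma>) v) - \<gamma> a *s cw *s zop (mop (kc \<gamma>) v)"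
        using v g by (simp add: yv sc_distrib(3))
      then show ?thesis unfolding cw_zop_kc[OF g v] N.x_kc[OF g v] using v by (simp add: yv)
    qed
  qed
qed

end

context nilrep
begin

lemma y_fsp [simp, intro]: "mop y v \<in> fsp d" "v \<in> fsp d \<Longrightarrow> (mop y ^^ k) v \<in> fsp d"
  using mop_fsp[OF y_c] funpow_fsp[OF y_c] by auto

lemma wt_y: "wt lg lc v \<Longrightarrow> wt (upg 1 lg) (upc 1 lc) (mop y v)"
proof -
  assume v: "wt lg lc v"
  have "mop (kg g) (mop y v) = inverse (X g) *s lg g *s mop y v" if "g \<in> GG" for g
  proof -
    have "inverse (X g) *s mop y (mop (kg g) v) = mop (kg g) (mop y v)"
      using that v wtD(1)[OF v] by (simp add: y_kg)
    then show ?thesis using wtD(2)[OF v that] by simp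
  qed
  moreover have "mop (kc \<gamma>) (mop y v) = \<gamma> a *s lc \<gamma> *s mop y v" if "\<gamma> \<in> CC" for \<gamma>
    using y_kc[OF that wtD(1)[OF v], symmetric] wtD(3)[OF v that] by simp
  ultimately show ?thesis by (auto simp: wt_def upg_def upc_def)
qed

lemma wt_y_pow: "wt lg lc v \<Longrightarrow> wt (upg k lg) (upc k lc) ((mop y ^^ k) v)"
proof (induction k)
  case (Suc k)
  then show ?case using wt_y[of "upg k lg" "upc k lc"] by (simp add: shift_up plus_1_eq_Suc)
qed simp

end

section \<open>Modules as representations of the generators\<close>

context datum
begin

definition y_term :: "('g, 'k) ddterm" where
  "y_term = x_el - Const cw * ((Const q * g_el a - c_el X) * xi_el ^ (n - 1))"

lemma app_y_term:
  assumes M: "pre_module D M" and "g_el a \<in> dd_terms D" "c_el X \<in> dd_terms D" "x_el \<in> dd_terms D"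
    "xi_el \<in> dd_terms D" "v \<in> fsp (mdim M)"
  shows "app M y_term v = app M x_el v - cw *s (q *s app M (g_el a) ((app M xi_el ^^ (n - 1)) v) -
    app M (c_el X) ((app M xi_el ^^ (n - 1)) v))"
  using assms by (simp add: y_term_def app_mult[OF M] app_const_mult[OF M] app_diff[OF M]
      app_power[OF M] app_const[OF M] app_fsp[OF M] sc_distrib mult.commute)

lemma gens [simp, intro]:
  "g \<in> GG \<Longrightarrow> GGen g \<in> dd_gens D" "\<gamma> \<in> CC \<Longrightarrow> CGen \<gamma> \<in> dd_gens D" "XGen \<in> dd_gens D" "XiGen \<in> dd_gens D"
  by (auto simp: dd_gens_def)

lemma y_term_terms [simp, intro]: "y_term \<in> dd_terms D"
  by (simp add: y_term_def)

abbreviation "mg M \<equiv> (\<lambda>g. act M (g_el g))"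
abbreviation "mc M \<equiv> (\<lambda>\<gamma>. act M (c_el \<gamma>))"

lemma ddrep_dd_module:
  fixes M :: "('g, 'k) ddmod"
  assumes M: "pre_module D M" and r: "ddrep D (mdim M) (mg M) (mc M) (act M xi_el) (act M x_el)"
  shows "dd_module D M"
proof (rule pre_module_eq[OF M])
  interpret ddrep D "mdim M" "mg M" "mc M" "act M xi_el" "act M x_el" by (rule r)
  fix u v assume uv: "(u, v) \<in> dd_rels D" and t: "u \<in> dd_terms D" "v \<in> dd_terms D"
  note ap = app_mult[OF M] app_const_mult[OF M] app_add[OF M] app_diff[OF M] app_power[OF M] app_one[OF M] app_const[OF M]
  have "app M u w = app M v w" if w: "w \<in> fsp (mdim M)" for w
    using uv w unfolding dd_rels_def Let_def
    apply (elim UnE)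
             apply (auto simp: ap kg_mult kg_one)[1]
            apply (auto simp: ap kg_mult kg_one)[1]
           apply (auto simp: ap kc_mult)[1]
          apply (auto simp: ap kc_one)[1]
         apply (auto simp: ap x_n sc_distrib)[1]
        apply (auto simp: ap x_kg)[1]
       apply (auto simp: ap xi_n)[1]
      apply (auto simp: ap xi_kc)[1]
     apply (auto simp: ap kg_kc)[1]
    apply (auto simp: ap xi_kg)[1]
    apply (auto simp: ap x_comm)[1]
    apply (auto simp: ap app_fsp[OF M] x_kc zop_def sc_distrib mult.commute split: if_splits)[1]
    done
  then show "act M u = act M v"
    by (intro mop_eqI_fsp[OF pre_carrier[OF M t(1)] pre_carrier[OF M t(2)]])
qed

lemma dd_rels_mem:
  "g \<in> GG \<Longrightarrow> h \<in> GG \<Longrightarrow> (g_el g * g_el h, g_el (g \<otimes>\<^bsub>grp D\<^esub> h)) \<in> dd_rels D"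
  "(g_el \<one>\<^bsub>grp D\<^esub>, 1) \<in> dd_rels D"
  "\<gamma> \<in> CC \<Longrightarrow> \<delta> \<in> CC \<Longrightarrow> (c_el \<gamma> * c_el \<delta>, c_el (\<gamma> \<otimes>\<^bsub>Gam D\<^esub> \<delta>)) \<in> dd_rels D"
  "(c_el \<one>\<^bsub>Gam D\<^esub>, 1) \<in> dd_rels D"
  "(x_el ^ n, Const (alp D) * (g_el (a [^]\<^bsub>grp D\<^esub> n) - 1)) \<in> dd_rels D"
  "g \<in> GG \<Longrightarrow> (x_el * g_el g, Const (X g) * (g_el g * x_el)) \<in> dd_rels D"
  "(xi_el ^ n, Const 0) \<in> dd_rels D"
  "\<gamma> \<in> CC \<Longrightarrow> (xi_el * c_el \<gamma>, Const (\<gamma> a) * (c_el \<gamma> * xi_el)) \<in> dd_rels D"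
  "g \<in> GG \<Longrightarrow> \<gamma> \<in> CC \<Longrightarrow> (g_el g * c_el \<gamma>, c_el \<gamma> * g_el g) \<in> dd_rels D"
  "g \<in> GG \<Longrightarrow> (xi_el * g_el g, Const (inverse (X g)) * (g_el g * xi_el)) \<in> dd_rels D"
  "(x_el * xi_el - xi_el * x_el, g_el a - c_el X) \<in> dd_rels D"
  "\<gamma> \<in> CC \<Longrightarrow> nilpotent_type D \<Longrightarrow> (Const (\<gamma> a) * (x_el * c_el \<gamma>), c_el \<gamma> * x_el) \<in> dd_rels D"
  "\<gamma> \<in> CC \<Longrightarrow> \<not> nilpotent_type D \<Longrightarrow> (Const (\<gamma> a) * (x_el * c_el \<gamma>), c_el \<gamma> * x_el +
    Const ((\<gamma> a ^ n - 1) / qfact q (n - 1)) * (c_el \<gamma> * (Const q * g_el a - c_el X) * xi_el ^ (n - 1))) \<in> dd_rels D"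
  by (simp_all add: dd_rels_def Let_def) (blast | force)+

lemma dd_module_ddrep:
  fixes M :: "('g, 'k) ddmod"
  assumes M: "dd_module D M"
  shows "ddrep D (mdim M) (mg M) (mc M) (act M xi_el) (act M x_el)"
proof -
  note M' = dd_module_pre[OF M]
  note ap = app_mult[OF M'] app_const_mult[OF M'] app_add[OF M'] app_diff[OF M'] app_power[OF M'] app_one[OF M'] app_const[OF M'] app_fsp[OF M']
  have e: "app M u w = app M v w" if "(u, v) \<in> dd_rels D" "u \<in> dd_terms D" "v \<in> dd_terms D" for u v w
    using M alg_eq.rel[OF that] unfolding dd_module_iff by simp
  have t: "torus D (mdim M) (mg M) (mc M) (act M xi_el)"
  proof
    fix g assume g: "g \<in> GG"
    show "act M (g_el g) \<in> carrier_mat (mdim M) (mdim M)" using g by (intro pre_carrier[OF M']) simp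
    fix v :: "nat \<Rightarrow> 'k" assume v: "v \<in> fsp (mdim M)"
    show "app M (g_el g) (app M (g_el h) v) = app M (g_el (g \<otimes>\<^bsub>grp D\<^esub> h)) v" if "h \<in> GG" for h
      using e[OF dd_rels_mem(1)[OF g that], where w = v] g that by (simp add: ap)
    show "app M xi_el (app M (g_el g) v) = inverse (X g) *s app M (g_el g) (app M xi_el v)"
      using e[OF dd_rels_mem(10)[OF g], where w = v] g by (simp add: ap)
    show "app M (g_el g) (app M (c_el \<gamma>) v) = app M (c_el \<gamma>) (app M (g_el g) v)" if "\<gamma> \<in> CC" for \<gamma>
      using e[OF dd_rels_mem(9)[OF g that], where w = v] g that by (simp add: ap)
  next
    fix \<gamma> assume g: "\<gamma> \<in> CC"
    show "act M (c_el \<gamma>) \<in> carrier_mat (mdim M) (mdim M)" using g by (intro pre_carrier[OF M']) simp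
    fix v :: "nat \<Rightarrow> 'k" assume v: "v \<in> fsp (mdim M)"
    show "app M (c_el \<gamma>) (app M (c_el \<delta>) v) = app M (c_el (\<gamma> \<otimes>\<^bsub>Gam D\<^esub> \<delta>)) v" if "\<delta> \<in> CC" for \<delta>
      using e[OF dd_rels_mem(3)[OF g that], where w = v] g that by (simp add: ap)
    show "app M xi_el (app M (c_el \<gamma>) v) = \<gamma> a *s app M (c_el \<gamma>) (app M xi_el v)"
      using e[OF dd_rels_mem(8)[OF g], where w = v] g by (simp add: ap)
  next
    show "act M xi_el \<in> carrier_mat (mdim M) (mdim M)" by (intro pre_carrier[OF M']) simp
    fix v :: "nat \<Rightarrow> 'k" assume v: "v \<in> fsp (mdim M)"
    show "app M (g_el \<one>\<^bsub>grp D\<^esub>) v = v"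
      using e[OF dd_rels_mem(2), where w = v] v by (simp add: ap)
    show "app M (c_el \<one>\<^bsub>Gam D\<^esub>) v = v"
      using e[OF dd_rels_mem(4), where w = v] v by (simp add: ap)
    show "(app M xi_el ^^ n) v = 0"
      using e[OF dd_rels_mem(7), where w = v] v by (simp add: ap)
  qed
  interpret torus D "mdim M" "mg M" "mc M" "act M xi_el" by (rule t)
  show ?thesis
  proof
    show "act M x_el \<in> carrier_mat (mdim M) (mdim M)" by (intro pre_carrier[OF M']) simp
    fix v :: "nat \<Rightarrow> 'k" assume v: "v \<in> fsp (mdim M)"
    show "(app M x_el ^^ n) v = alp D *s (app M (g_el (a [^]\<^bsub>grp D\<^esub> n)) v - v)"
      using e[OF dd_rels_mem(5), where w = v] v by (simp add: ap sc_distrib)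
    show "app M x_el (app M (g_el g) v) = X g *s app M (g_el g) (app M x_el v)" if "g \<in> GG" for g
      using e[OF dd_rels_mem(6)[OF that], where w = v] that by (simp add: ap)
    show "app M x_el (app M xi_el v) - app M xi_el (app M x_el v) = app M (g_el a) v - app M (c_el X) v"
      using e[OF dd_rels_mem(11), where w = v] by (simp add: ap)
    show "\<gamma> a *s app M x_el (app M (c_el \<gamma>) v) = app M (c_el \<gamma>) (app M x_el v) +
        (if nilpotent_type D then 0 else (\<gamma> a ^ n - 1) / qfact q (n - 1)) *s app M (c_el \<gamma>) (zop v)"
      if g: "\<gamma> \<in> CC" for \<gamma>
    proof (cases "nilpotent_type D")
      case True
      then show ?thesis
        using e[OF dd_rels_mem(12)[OF g True], where w = v] g by (simp add: ap)
    next
      case False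
      from e[OF dd_rels_mem(13)[OF g False], where w = v] show ?thesis
        using False g v by (simp add: ap zop_def sc_distrib mult.commute)
    qed
  qed
qed

text \<open>x is a combination of y and of a, \<chi> times a power of \<xi>, so compatibility with
  \<open>y_term\<close> replaces the one with x.\<close>

lemma dd_hom_yI:
  fixes M N :: "('g, 'k) ddmod"
  assumes M: "pre_module D M" and N: "pre_module D N" and F: "F \<in> carrier_mat (mdim N) (mdim M)"
    and g: "\<And>g v. g \<in> GG \<Longrightarrow> v \<in> fsp (mdim M) \<Longrightarrow> mop F (app M (g_el g) v) = app N (g_el g) (mop F v)"
    and c: "\<And>\<gamma> v. \<gamma> \<in> CC \<Longrightarrow> v \<in> fsp (mdim M) \<Longrightarrow> mop F (app M (c_el \<gamma>) v) = app N (c_el \<gamma>) (mop F v)"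
    and xi: "\<And>v. v \<in> fsp (mdim M) \<Longrightarrow> mop F (app M xi_el v) = app N xi_el (mop F v)"
    and y: "\<And>v. v \<in> fsp (mdim M) \<Longrightarrow> mop F (app M y_term v) = app N y_term (mop F v)"
  shows "F \<in> dd_hom D M N"
proof (rule dd_homI[OF M N F])
  fix z and v :: "nat \<Rightarrow> 'k" assume z: "z \<in> dd_gens D" and v: "v \<in> fsp (mdim M)"
  have p: "(app M xi_el ^^ k) v \<in> fsp (mdim M) \<and> mop F ((app M xi_el ^^ k) v) = (app N xi_el ^^ k) (mop F v)" for k
    by (induction k) (use v in \<open>auto simp: xi app_fsp[OF M]\<close>)
  have x: "mop F (app M x_el v) = app N x_el (mop F v)"
    using y[OF v] v mop_fsp[OF F, of v] p[of "n - 1"] by (simp add: app_y_term[OF M] app_y_term[OF N] g c)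
  show "mop F (app M (Gen z) v) = app N (Gen z) (mop F v)"
    using z v x g c xi by (auto simp: dd_gens_def)
qed

lemma dd_module_nilrep:
  fixes M :: "('g, 'k) ddmod"
  assumes M: "dd_module D M"
  shows "nilrep D (mdim M) (mg M) (mc M) (act M xi_el) (act M y_term)"
proof -
  interpret ddrep D "mdim M" "mg M" "mc M" "act M xi_el" "act M x_el" by (rule dd_module_ddrep[OF M])
  note M' = dd_module_pre[OF M]
  show ?thesis
  proof (rule nilrep_untwist)
    show "ddrep D (mdim M) (mg M) (mc M) (act M xi_el) (act M x_el)" by unfold_locales
    show "act M y_term \<in> carrier_mat (mdim M) (mdim M)" by (intro pre_carrier[OF M']) simp
    show "app M y_term v = app M x_el v - cw *s zop v" if "v \<in> fsp (mdim M)" for v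
      using that by (simp add: app_y_term[OF M'] zop_def)
  qed
qed

end

section \<open>Commutation formulas\<close>

context datum
begin

text \<open>For p = \<lambda>(a) and r = \<lambda>(\<chi>) these are the structure constants of
  V(l,\<lambda>), see \<open>alpha_coeff_alq\<close>. At k = 0 the truncated exponent is harmless
  because \<open>qnum q 0\<close> is 0.\<close>

definition alq :: "'k \<Rightarrow> 'k \<Rightarrow> nat \<Rightarrow> 'k" where
  "alq p r k = qnum q k * (r - p * inverse q ^ (k - 1))"

text \<open>The constants from moving y past powers of \<xi>: on a vector with a-value p and
  \<chi>-value r, y\<xi>^(k+1) = \<xi>^k (y\<xi> + \<open>beq p r k\<close>), see
  \<open>y_xi_pow\<close>.\<close>

definition beq :: "'k \<Rightarrow> 'k \<Rightarrow> nat \<Rightarrow> 'k" where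
  "beq p r k = qnum q k * (q * p - r * inverse q ^ k)"

lemma alq_0 [simp]: "alq p r 0 = 0" and alq_n [simp]: "alq p r n = 0" and beq_0 [simp]: "beq p r 0 = 0"
  by (simp_all add: alq_def beq_def)

lemma alq_Suc: "alq p r (Suc k) = alq p r k + (r * q ^ k - p * inverse q ^ k)"
proof (cases k)
  case (Suc j)
  have e: "qnum q (Suc k) * inverse q ^ k = inverse q ^ k + qnum q k * inverse q ^ j"
    unfolding qnum_Suc' using Suc by (simp add: field_simps)
  have "qnum q (Suc k) * (p * inverse q ^ k) = p * (qnum q (Suc k) * inverse q ^ k)"
    by (rule mult.left_commute)
  also have "\<dots> = p * inverse q ^ k + qnum q k * (p * inverse q ^ j)"
    unfolding e by (simp add: algebra_simps)
  finally have "qnum q (Suc k) * (p * inverse q ^ k) = p * inverse q ^ k + qnum q k * (p * inverse q ^ j)" .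
  moreover have "qnum q (Suc k) * r = qnum q k * r + r * q ^ k" by (simp add: algebra_simps)
  ultimately show ?thesis using Suc by (simp only: alq_def right_diff_distrib diff_Suc_1) simp
qed (simp add: alq_def One_nat_def)

lemma beq_Suc: "beq p r (Suc k) = beq p r k + (p * q ^ Suc k - r * inverse q ^ Suc k)"
proof -
  have e: "qnum q (Suc k) * inverse q ^ Suc k = inverse q ^ Suc k + qnum q k * inverse q ^ k"
    unfolding qnum_Suc' by (simp add: field_simps)
  have "qnum q (Suc k) * (r * inverse q ^ Suc k) = r * (qnum q (Suc k) * inverse q ^ Suc k)"
    by (rule mult.left_commute)
  also have "\<dots> = r * inverse q ^ Suc k + qnum q k * (r * inverse q ^ k)"
    unfolding e by (simp add: algebra_simps)
  finally have "qnum q (Suc k) * (r * inverse q ^ Suc k) = r * inverse q ^ Suc k + qnum q k * (r * inverse q ^ k)" .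
  moreover have "qnum q (Suc k) * (q * p) = qnum q k * (q * p) + p * q ^ Suc k" by (simp add: algebra_simps)
  ultimately show ?thesis by (simp only: beq_def right_diff_distrib) simp
qed

lemma q_pow_inj: "i < n \<Longrightarrow> j < n \<Longrightarrow> q ^ i = q ^ j \<Longrightarrow> i = j"
proof (induction i j rule: linorder_wlog)
  case (le i j)
  then have "q ^ (j - i) = 1" by (simp add: power_diff)
  then show ?case using q_pow_neq_1[of "j - i"] le by force
qed simp

lemma alq_nz:
  assumes "p = r * q ^ (L - 1)" "r \<noteq> 0" "1 \<le> L" "L \<le> n" "0 < k" "k < n" "k \<noteq> L"
  shows "alq p r k \<noteq> 0"
proof
  assume "alq p r k = 0"
  then have "r - p * inverse q ^ (k - 1) = 0" using qnum_nz[of k] assms by (simp add: alq_def)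
  then have "r * q ^ (k - 1) = r * q ^ (L - 1)" using assms by (simp add: field_simps)
  then have "q ^ (k - 1) = q ^ (L - 1)" using assms by simp
  then have "k - 1 = L - 1" using assms by (intro q_pow_inj) auto
  then show False using assms by linarith
qed

lemma alq_z: "p = r * q ^ (L - 1) \<Longrightarrow> alq p r L = 0"
  by (simp add: alq_def field_simps)

lemma beq_z:
  assumes "p = r * q ^ (L - 1)" "1 \<le> L" "L < n"
  shows "beq p r (n - L) = 0"
proof -
  have "q ^ L * q ^ (n - L) = 1" using assms by (simp add: power_add[symmetric])
  moreover have "q * p = r * q ^ L" using assms by (simp add: power_eq_if)
  ultimately show ?thesis by (simp add: beq_def field_simps)
qed

text \<open>With \<open>beq_z\<close>: for a weight with the condition of I_L exactly one constant
  with 0 < k < n vanishes, the one for k = n - L. So a single linear factor of y^(n-1)\<xi>^n has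
  constant term 0.\<close>

lemma beq_nz:
  assumes "p = r * q ^ (L - 1)" "r \<noteq> 0" "1 \<le> L" "L < n" "0 < k" "k < n" "k \<noteq> n - L"
  shows "beq p r k \<noteq> 0"
proof
  assume "beq p r k = 0"
  then have "q * p = r * inverse q ^ k" using qnum_nz[of k] assms by (simp add: beq_def)
  then have 1: "q * p * q ^ k = r" by (simp add: field_simps)
  have 2: "q * p = r * q ^ L" using assms by (simp add: power_eq_if)
  have "r * (q ^ L * q ^ k) = r * 1" using 1 unfolding 2 by (simp add: mult.assoc)
  then have "q ^ L * q ^ k = 1" using assms(2) by (metis mult_cancel_left)
  then have "n dvd L + k" by (simp add: q_pow_1_iff[symmetric] power_add)
  moreover have "0 < L + k" "L + k < 2 * n" using assms by auto
  ultimately have "L + k = n"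
  proof (elim dvdE)
    fix i assume "L + k = n * i" "0 < L + k" "L + k < 2 * n"
    moreover from this have "i \<noteq> 0" "i < 2" by (auto simp: mult.commute)
    ultimately show ?thesis by (simp add: less_2_cases_iff One_nat_def)
  qed
  then show False using assms by linarith
qed

end

context nilrep
begin

lemma eig_y_pow:
  assumes "wt lg lc v"
  shows "mop (kg a) ((mop y ^^ k) v) = (lg a * inverse q ^ k) *s (mop y ^^ k) v"
    "mop (kc X) ((mop y ^^ k) v) = (lc X * q ^ k) *s (mop y ^^ k) v"
  using wtD(2)[OF wt_y_pow[OF assms]] wtD(3)[OF wt_y_pow[OF assms]] by (simp_all add: shift_a)

lemma eig_xi_pow:
  assumes "wt lg lc v"
  shows "mop (kg a) ((mop xi ^^ k) v) = (lg a * q ^ k) *s (mop xi ^^ k) v"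
    "mop (kc X) ((mop xi ^^ k) v) = (lc X * inverse q ^ k) *s (mop xi ^^ k) v"
  using wtD(2)[OF wt_xi_pow[OF assms]] wtD(3)[OF wt_xi_pow[OF assms]] by (simp_all add: shift_a)

lemma xi_y_pow:
  assumes v: "wt lg lc v"
  shows "mop xi ((mop y ^^ k) v) = (mop y ^^ k) (mop xi v) + alq (lg a) (lc X) k *s (mop y ^^ (k - 1)) v"
proof (induction k)
  case (Suc k)
  let ?w = "(mop y ^^ k) v" and ?al = "alq (lg a) (lc X)"
  have w: "?w \<in> fsp d" using wtD(1)[OF v] by simp
  have 1: "mop xi (mop y ?w) = mop y (mop xi ?w) - ((lg a * inverse q ^ k) *s ?w - (lc X * q ^ k) *s ?w)"
    using comm[OF w] eig_y_pow[OF v] by (simp add: algebra_simps)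
  have 2: "mop y (?al k *s (mop y ^^ (k - 1)) v) = ?al k *s ?w"
    by (cases k) auto
  have "mop xi (mop y ?w) = mop y ((mop y ^^ k) (mop xi v)) + ?al k *s ?w
      + (lc X * q ^ k - lg a * inverse q ^ k) *s ?w"
    unfolding 1 Suc mop_add 2 by (simp add: sc_distrib algebra_simps)
  then show ?case by (simp add: alq_Suc sc_distrib add.assoc)
qed simp

lemma y_xi_pow:
  assumes v: "wt lg lc v"
  shows "mop y ((mop xi ^^ Suc k) v) =
    (mop xi ^^ k) (mop y (mop xi v)) + beq (lg a) (lc X) k *s (mop xi ^^ k) v"
proof (induction k)
  case (Suc k)
  let ?w = "(mop xi ^^ Suc k) v"
  have w: "?w \<in> fsp d" using wtD(1)[OF v] by simp
  have "mop y (mop xi ?w) = mop xi (mop y ?w) + ((lg a * q ^ Suc k) *s ?w - (lc X * inverse q ^ Suc k) *s ?w)"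
    using comm[OF w] eig_xi_pow[OF v, of "Suc k"] by (simp only:) (simp add: algebra_simps)
  also have "mop xi (mop y ?w) = mop xi ((mop xi ^^ k) (mop y (mop xi v))) + beq (lg a) (lc X) k *s ?w"
    unfolding Suc by simp
  finally show ?case by (simp add: beq_Suc sc_distrib algebra_simps)
qed simp

text \<open>Serves \<open>y_n_zero\<close>: if \<xi>^k kills v, then \<xi>^(k+1) kills yv, whatever
  the constant.\<close>

lemma xi_pow_y:
  assumes v: "wt lg lc v"
  shows "\<exists>c. (mop xi ^^ Suc k) (mop y v) = mop y ((mop xi ^^ Suc k) v) + c *s (mop xi ^^ k) v"
proof (induction k)
  case 0
  have "mop xi (mop y v) = mop y (mop xi v) + (lc X - lg a) *s v"
    using comm[OF wtD(1)[OF v]] eig_xi_pow[OF v, of 0] by (simp add: algebra_simps sc_distrib)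
  then show ?case by auto
next
  case (Suc k)
  then obtain c where c: "(mop xi ^^ Suc k) (mop y v) = mop y ((mop xi ^^ Suc k) v) + c *s (mop xi ^^ k) v" ..
  let ?w = "(mop xi ^^ Suc k) v"
  have w: "?w \<in> fsp d" using wtD(1)[OF v] by simp
  have 1: "mop xi (mop y ?w) = mop y (mop xi ?w) + (lc X * inverse q ^ Suc k - lg a * q ^ Suc k) *s ?w"
    using comm[OF w] eig_xi_pow[OF v, of "Suc k"] by (simp only:) (simp add: algebra_simps sc_distrib)
  have "(mop xi ^^ Suc (Suc k)) (mop y v) = mop xi ((mop xi ^^ Suc k) (mop y v))" by simp
  also have "\<dots> = mop xi (mop y ?w) + c *s ?w" unfolding c by simp
  also have "\<dots> = mop y ((mop xi ^^ Suc (Suc k)) v) + (c + (lc X * inverse q ^ Suc k - lg a * q ^ Suc k)) *s ?w"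
    unfolding 1 by (simp add: sc_distrib algebra_simps)
  finally show ?case by blast
qed

lemma kg_pow: "wt lg lc v \<Longrightarrow> g \<in> GG \<Longrightarrow> mop (kg (g [^]\<^bsub>grp D\<^esub> (k::nat))) v = lg g ^ k *s v"
proof (induction k)
  case 0
  then show ?case using kg_one[OF wtD(1)] by simp
next
  case (Suc k)
  have "mop (kg (g [^]\<^bsub>grp D\<^esub> Suc k)) v = mop (kg (g [^]\<^bsub>grp D\<^esub> k)) (mop (kg g) v)"
    using Suc.prems wtD(1) by (simp add: kg_mult)
  then show ?case using Suc wtD(2)[OF Suc.prems] by (simp add: mult.commute)
qed

lemma zop_wt:
  assumes v: "wt lg lc v"
  shows "zop v = (q * (lg a * q ^ (n - 1)) - lc X * inverse q ^ (n - 1)) *s (mop xi ^^ (n - 1)) v"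
  using eig_xi_pow[OF v, of "n - 1"] by (simp add: zop_def sc_distrib)

text \<open>In the twisted case \<open>x\<^sup>k v\<close> and \<open>y\<^sup>k v\<close> differ by a vector of another weight, and a character
  \<open>\<gamma>\<close> with \<open>\<gamma>(a)\<^sup>n \<noteq> 1\<close> separates the two components of \<open>x\<^sup>n v = 0\<close>.\<close>

lemma y_n_zero:
  assumes x: "ddrep D d kg kc xi x" and xv: "\<And>v. v \<in> fsp d \<Longrightarrow> mop x v = mop y v + cw *s zop v"
    and v: "wt lg lc v" and nil: "nilpotent_type D \<or> lg a ^ n = 1"
  shows "(mop y ^^ n) v = 0"
proof -
  interpret x: ddrep D d kg kc xi x by (rule x)
  have vd: "v \<in> fsp d" using wtD(1)[OF v] .
  have xn: "(mop x ^^ n) v = 0"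
  proof (cases "nilpotent_type D")
    case True
    then show ?thesis using x.x_n[OF vd] kg_one[OF vd] by (auto simp: nilpotent_type_def)
  next
    case False
    then show ?thesis using x.x_n[OF vd] kg_pow[OF v, of a n] nil by simp
  qed
  show ?thesis
  proof (cases twisted)
    case False
    have "(mop x ^^ k) v = (mop y ^^ k) v" for k
      by (induction k) (use False vd in \<open>simp_all add: xv cw_def\<close>)
    then show ?thesis using xn by metis
  next
    case True
    \<comment> \<open>\<open>R k\<close> collects the corrections produced by x^k; its weight is
      that of y^k v divided by the n-th power of \<phi>.\<close>
    define R where "R k = (mop x ^^ k) v - (mop y ^^ k) v" for k
    have sh: "upg 1 (dng n (upg k lg)) g = upg (Suc k) (dng n lg) g"
        "dng (n - 1) (upg k lg) g = upg (Suc k) (dng n lg) g" if "g \<in> GG" for k g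
      using that n2 by (simp_all add: upg_def dng_def power_eq_if[of _ n] field_simps)
    have sh': "dnc (n - 1) (upc k lc) \<gamma> = upc (Suc k) (dnc n lc) \<gamma>" if "\<gamma> \<in> CC" for k \<gamma>
      using that n2 by (simp add: upc_def dnc_def power_eq_if[of _ n] field_simps)
    \<comment> \<open>The condition \<xi>^k (R k) = 0 is carried along because it forces \<xi>^(n-1)
      (R k) = 0 for k < n, so that x adds no correction to \<open>R k\<close> itself.\<close>
    have main: "wt (upg k (dng n lg)) (upc k (dnc n lc)) (R k) \<and> (mop xi ^^ k) (R k) = 0" if "k \<le> n" for k
      using that
    proof (induction k)
      case 0
      then show ?case by (simp add: R_def wt_lin)
    next
      case (Suc k)
      then have w: "wt (upg k (dng n lg)) (upc k (dnc n lc)) (R k)" and z: "(mop xi ^^ k) (R k) = 0" by auto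
      have yk: "wt (upg k lg) (upc k lc) ((mop y ^^ k) v)" by (rule wt_y_pow[OF v])
      have "(mop xi ^^ (n - 1)) (R k) = (mop xi ^^ (n - 1 - k)) ((mop xi ^^ k) (R k))"
        using Suc.prems by (simp add: funpow_add[symmetric, THEN fun_cong, simplified])
      then have zR: "zop (R k) = 0" using z by (simp add: zop_wt[OF w])
      have xk: "(mop x ^^ k) v = R k + (mop y ^^ k) v" by (simp add: R_def)
      have "R k + (mop y ^^ k) v \<in> fsp d" using wtD(1)[OF w] wtD(1)[OF yk] by simp
      then have "mop x ((mop x ^^ k) v) = mop y ((mop y ^^ k) v) + (mop y (R k) + cw *s zop ((mop y ^^ k) v))"
        unfolding xk by (subst xv) (simp_all add: zR)
      then have R: "R (Suc k) = mop y (R k) + cw *s zop ((mop y ^^ k) v)"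
        by (simp add: R_def[of "Suc k"])
      have "wt (upg (Suc k) (dng n lg)) (upc (Suc k) (dnc n lc)) (zop ((mop y ^^ k) v))"
        unfolding zop_wt[OF yk]
        by (rule wt_lin(2), rule wt_cong[OF wt_xi_pow[OF yk]]) (simp_all add: sh sh')
      moreover have "wt (upg (Suc k) (dng n lg)) (upc (Suc k) (dnc n lc)) (mop y (R k))"
        using wt_y[OF w] by (simp add: shift_up plus_1_eq_Suc)
      ultimately have "wt (upg (Suc k) (dng n lg)) (upc (Suc k) (dnc n lc)) (R (Suc k))"
        unfolding R by (intro wt_lin)
      moreover have "(mop xi ^^ Suc k) (R (Suc k)) = 0"
      proof -
        obtain c where c: "(mop xi ^^ Suc k) (mop y (R k)) = mop y ((mop xi ^^ Suc k) (R k)) + c *s (mop xi ^^ k) (R k)"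
          using xi_pow_y[OF w] by blast
        have "(mop xi ^^ Suc k) (zop ((mop y ^^ k) v)) = (mop xi ^^ k) (mop xi (zop ((mop y ^^ k) v)))"
          by (simp add: funpow_swap1)
        then have "(mop xi ^^ Suc k) (zop ((mop y ^^ k) v)) = 0" using wtD(1)[OF yk] by (simp add: xi_zop)
        then show ?thesis unfolding R funpow_mop_lin c using z by simp
      qed
      ultimately show ?case by blast
    qed
    let ?s = "(mop y ^^ n) v"
    obtain \<gamma> where \<gamma>: "\<gamma> \<in> CC" "\<gamma> a ^ n \<noteq> 1" using True by (auto simp: twisted_def)
    have s: "?s = - R n" by (simp add: R_def xn)
    have sd: "?s \<in> fsp d" using vd by simp
    have "mop (kc \<gamma>) (R n) = lc \<gamma> *s R n"
      using wtD(3)[of "upg n (dng n lg)" "upc n (dnc n lc)" "R n" \<gamma>] main[of n] \<gamma>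
      by (simp add: upc_def dnc_def field_simps)
    then have 1: "mop (kc \<gamma>) ?s = lc \<gamma> *s ?s" by (simp add: s sc_distrib)
    moreover have "mop (kc \<gamma>) ?s = (\<gamma> a ^ n * lc \<gamma>) *s ?s"
      using wtD(3)[OF wt_y_pow[OF v, of n] \<gamma>(1)] by (simp add: upc_def)
    ultimately have "((\<gamma> a ^ n - 1) * lc \<gamma>) *s ?s = 0" by (simp add: sc_distrib algebra_simps)
    then have "lc \<gamma> = 0 \<or> ?s = 0" using \<gamma> by (auto simp: sc_eq_0_iff)
    \<comment> \<open>\<open>lc\<close> is an arbitrary function and might vanish at \<gamma>; but
      \<gamma> acts invertibly, so the vector would still be 0.\<close>
    moreover have "?s = 0" if "lc \<gamma> = 0"
    proof -
      have i: "inv\<^bsub>Gam D\<^esub> \<gamma> \<in> CC" using \<gamma> Gam(2) by (simp add: group.inv_closed)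
      have "mop (kc (inv\<^bsub>Gam D\<^esub> \<gamma>)) (mop (kc \<gamma>) ?s) = ?s"
        using kc_mult[OF i \<gamma>(1) sd] kc_one[OF sd] group.l_inv[OF Gam(2) \<gamma>(1)] by simp
      then show ?thesis using 1 that by simp
    qed
    ultimately show ?thesis by blast
  qed
qed

end

section \<open>Projection to weight spaces\<close>

lemma (in group) sum_shift:
  assumes "h \<in> carrier G"
  shows "(\<Sum>g\<in>carrier G. f (h \<otimes> g)) = (\<Sum>g\<in>carrier G. f g)"
proof (rule sum.reindex_bij_witness[of _ "\<lambda>g. inv h \<otimes> g" "\<lambda>g. h \<otimes> g"])
qed (use assms in \<open>auto simp: m_assoc[symmetric]\<close>)

context torus
begin

text \<open>The averaging idempotent of the finite group G \<times> \<Gamma> for the character given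
  by \<open>lg\<close> and \<open>lc\<close>; characteristic 0 permits the division. It turns any
  preimage of a weight vector into a preimage of the same weight.\<close>

definition wproj :: "('g \<Rightarrow> 'k) \<Rightarrow> (('g \<Rightarrow> 'k) \<Rightarrow> 'k) \<Rightarrow> (nat \<Rightarrow> 'k) \<Rightarrow> nat \<Rightarrow> 'k" where
  "wproj lg lc v = (inverse (of_nat (card GG)) * inverse (of_nat (card CC))) *s
     (\<Sum>g\<in>GG. inverse (lg g) *s mop (kg g) (\<Sum>\<gamma>\<in>CC. inverse (lc \<gamma>) *s mop (kc \<gamma>) v))"

lemma wt_wproj:
  assumes lg: "\<And>g h. g \<in> GG \<Longrightarrow> h \<in> GG \<Longrightarrow> lg (g \<otimes>\<^bsub>grp D\<^esub> h) = lg g * lg h" "\<And>g. g \<in> GG \<Longrightarrow> lg g \<noteq> 0"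
    and lc: "\<And>\<gamma> \<delta>. \<gamma> \<in> CC \<Longrightarrow> \<delta> \<in> CC \<Longrightarrow> lc (\<gamma> \<otimes>\<^bsub>Gam D\<^esub> \<delta>) = lc \<gamma> * lc \<delta>" "\<And>\<gamma>. \<gamma> \<in> CC \<Longrightarrow> lc \<gamma> \<noteq> 0"
    and v: "v \<in> fsp d"
  shows "wt lg lc (wproj lg lc v)"
proof -
  define w where "w = (\<Sum>\<gamma>\<in>CC. inverse (lc \<gamma>) *s mop (kc \<gamma>) v)"
  define u where "u = (\<Sum>g\<in>GG. inverse (lg g) *s mop (kg g) w)"
  have wd: "w \<in> fsp d" unfolding w_def by (rule fsp_sum) auto
  have ud: "u \<in> fsp d" unfolding u_def by (rule fsp_sum) auto
  have kg: "mop (kg h) u = lg h *s u" if h: "h \<in> GG" for h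
  proof -
    have "mop (kg h) u = (\<Sum>g\<in>GG. lg h *s (inverse (lg (h \<otimes>\<^bsub>grp D\<^esub> g)) *s mop (kg (h \<otimes>\<^bsub>grp D\<^esub> g)) w))"
      unfolding u_def mop_sum by (rule sum.cong) (use h wd lg in \<open>auto simp: kg_mult mult.assoc[symmetric]\<close>)
    also have "\<dots> = (\<Sum>g\<in>GG. lg h *s (inverse (lg g) *s mop (kg g) w))"
      by (rule group.sum_shift[OF grp(2) h])
    finally show ?thesis by (simp add: u_def sc_distrib)
  qed
  have kcw: "mop (kc \<delta>) w = lc \<delta> *s w" if h: "\<delta> \<in> CC" for \<delta>
  proof -
    have "mop (kc \<delta>) w = (\<Sum>g\<in>CC. lc \<delta> *s (inverse (lc (\<delta> \<otimes>\<^bsub>Gam D\<^esub> g)) *s mop (kc (\<delta> \<otimes>\<^bsub>Gam D\<^esub> g)) v))"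
      unfolding w_def mop_sum by (rule sum.cong) (use h v lc in \<open>auto simp: kc_mult mult.assoc[symmetric]\<close>)
    also have "\<dots> = (\<Sum>g\<in>CC. lc \<delta> *s (inverse (lc g) *s mop (kc g) v))"
      by (rule group.sum_shift[OF Gam(2) h])
    finally show ?thesis by (simp add: w_def sc_distrib)
  qed
  have kc: "mop (kc \<delta>) u = lc \<delta> *s u" if h: "\<delta> \<in> CC" for \<delta>
    unfolding u_def by (simp add: kg_kc[OF _ h wd, symmetric] kcw[OF h] sc_distrib mult.commute)
  have "wt lg lc u" using kg kc ud by (auto simp: wt_def)
  then show ?thesis unfolding wproj_def w_def[symmetric] u_def[symmetric] by (rule wt_lin)
qed

lemma wproj_wt:
  assumes "\<And>g. g \<in> GG \<Longrightarrow> lg g \<noteq> 0" "\<And>\<gamma>. \<gamma> \<in> CC \<Longrightarrow> lc \<gamma> \<noteq> 0" and v: "wt lg lc v"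
  shows "wproj lg lc v = v"
proof -
  have "(\<Sum>\<gamma>\<in>CC. inverse (lc \<gamma>) *s mop (kc \<gamma>) v) = (\<Sum>\<gamma>\<in>CC. v)"
    by (rule sum.cong) (use assms wtD(3)[OF v] in auto)
  also have "\<dots> = of_nat (card CC) *s v" by (auto simp: fun_eq_iff sum_fun_apply ptw)
  finally have 1: "(\<Sum>\<gamma>\<in>CC. inverse (lc \<gamma>) *s mop (kc \<gamma>) v) = of_nat (card CC) *s v" .
  have "(\<Sum>g\<in>GG. inverse (lg g) *s mop (kg g) (of_nat (card CC) *s v)) = (\<Sum>g\<in>GG. of_nat (card CC) *s v)"
    by (rule sum.cong) (use assms wtD(2)[OF v] in \<open>auto simp: mult.commute[of _ "lg _"] mult.assoc[symmetric]\<close>)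
  also have "\<dots> = of_nat (card GG) *s of_nat (card CC) *s v" by (auto simp: fun_eq_iff sum_fun_apply ptw)
  finally have 2: "(\<Sum>g\<in>GG. inverse (lg g) *s mop (kg g) (of_nat (card CC) *s v)) =
    of_nat (card GG) *s of_nat (card CC) *s v" .
  have "card GG \<noteq> 0" "card CC \<noteq> 0" using grp(3) Gam(3) closed(1,2) by (auto simp del: closed)
  then have "inverse (of_nat (card GG)) * inverse (of_nat (card CC)) * (of_nat (card GG) * of_nat (card CC)) = (1 :: 'k)"
    by (simp add: field_simps)
  then show ?thesis unfolding wproj_def 1 2 by simp
qed

end

section \<open>The modules \<open>V(l,\<lambda>)\<close>\<close>

definition lin :: "((nat \<Rightarrow> 'k::field) \<Rightarrow> nat \<Rightarrow> 'k) \<Rightarrow> bool" where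
  "lin T \<longleftrightarrow> (\<forall>f g. T (f + g) = T f + T g) \<and> (\<forall>c f. T (c *s f) = c *s T f)"

lemma lin_intros [intro, simp]:
  "lin (\<lambda>v. v)" "lin T \<Longrightarrow> lin (\<lambda>v. mop A (T v))" "lin T \<Longrightarrow> lin (\<lambda>v. c *s T v)"
  "lin T \<Longrightarrow> lin S \<Longrightarrow> lin (\<lambda>v. T v + S v)" "lin T \<Longrightarrow> lin S \<Longrightarrow> lin (\<lambda>v. T v - S v)"
  "lin T \<Longrightarrow> lin (\<lambda>v. (mop A ^^ k) (T v))" "lin (\<lambda>v. 0)"
  by (auto simp: lin_def sc_distrib mult.commute)

lemma lin_sum: "lin T \<Longrightarrow> T (\<Sum>j\<in>S. f j *s h j) = (\<Sum>j\<in>S. f j *s T (h j))"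
proof (induction S rule: infinite_finite_induct)
  have "lin T \<Longrightarrow> T 0 = 0" unfolding lin_def by (metis sc_simps(2))
  then show "infinite A \<Longrightarrow> lin T \<Longrightarrow> T (\<Sum>j\<in>A. f j *s h j) = (\<Sum>j\<in>A. f j *s T (h j))" for A by simp
  show "lin T \<Longrightarrow> T (\<Sum>j\<in>{}. f j *s h j) = (\<Sum>j\<in>{}. f j *s T (h j))"
    using \<open>lin T \<Longrightarrow> T 0 = 0\<close> by simp
qed (simp add: lin_def)

lemma lin_ext:
  assumes "lin T" "lin S" "\<And>j. j < d \<Longrightarrow> T (bas j) = S (bas j)" "v \<in> fsp d"
  shows "T v = S v"
proof -
  have "T v = (\<Sum>j<d. v j *s T (bas j))"
    using fsp_expand[OF assms(4)] lin_sum[OF assms(1)] by metis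
  also have "\<dots> = (\<Sum>j<d. v j *s S (bas j))" using assms(3) by simp
  also have "\<dots> = S v" using fsp_expand[OF assms(4)] lin_sum[OF assms(2)] by metis
  finally show ?thesis .
qed

context datum
begin

text \<open>A character of \<open>G \<times> \<Gamma>\<close> is represented by its restrictions to the two factors. The last condition
  holds since \<open>\<chi>\<^sup>n = 1\<close> in the non-nilpotent case.\<close>

definition charw :: "('g \<Rightarrow> 'k) \<Rightarrow> (('g \<Rightarrow> 'k) \<Rightarrow> 'k) \<Rightarrow> bool" where
  "charw lg lc \<longleftrightarrow> (\<forall>g\<in>GG. lg g \<noteq> 0) \<and> (\<forall>\<gamma>\<in>CC. lc \<gamma> \<noteq> 0) \<and>
     (\<forall>g\<in>GG. \<forall>h\<in>GG. lg (g \<otimes>\<^bsub>grp D\<^esub> h) = lg g * lg h) \<and>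
     (\<forall>\<gamma>\<in>CC. \<forall>\<delta>\<in>CC. lc (\<gamma> \<otimes>\<^bsub>Gam D\<^esub> \<delta>) = lc \<gamma> * lc \<delta>) \<and>
     (nilpotent_type D \<or> lc X ^ n = 1)"

lemma charwD:
  assumes "charw lg lc"
  shows "g \<in> GG \<Longrightarrow> lg g \<noteq> 0" "\<gamma> \<in> CC \<Longrightarrow> lc \<gamma> \<noteq> 0"
    "g \<in> GG \<Longrightarrow> h \<in> GG \<Longrightarrow> lg (g \<otimes>\<^bsub>grp D\<^esub> h) = lg g * lg h"
    "\<gamma> \<in> CC \<Longrightarrow> \<delta> \<in> CC \<Longrightarrow> lc (\<gamma> \<otimes>\<^bsub>Gam D\<^esub> \<delta>) = lc \<gamma> * lc \<delta>"
    "nilpotent_type D \<or> lc X ^ n = 1" "lg \<one>\<^bsub>grp D\<^esub> = 1" "lc \<one>\<^bsub>Gam D\<^esub> = 1"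
proof -
  show *: "g \<in> GG \<Longrightarrow> lg g \<noteq> 0" "\<gamma> \<in> CC \<Longrightarrow> lc \<gamma> \<noteq> 0"
    "g \<in> GG \<Longrightarrow> h \<in> GG \<Longrightarrow> lg (g \<otimes>\<^bsub>grp D\<^esub> h) = lg g * lg h"
    "\<gamma> \<in> CC \<Longrightarrow> \<delta> \<in> CC \<Longrightarrow> lc (\<gamma> \<otimes>\<^bsub>Gam D\<^esub> \<delta>) = lc \<gamma> * lc \<delta>"
    "nilpotent_type D \<or> lc X ^ n = 1" for g h \<gamma> \<delta>
    using assms by (auto simp: charw_def)
  have "lg \<one>\<^bsub>grp D\<^esub> = lg \<one>\<^bsub>grp D\<^esub> * lg \<one>\<^bsub>grp D\<^esub>"
    using *(3)[of "\<one>\<^bsub>grp D\<^esub>" "\<one>\<^bsub>grp D\<^esub>"] monoid.r_one[OF group.is_monoid[OF grp(2)], of "\<one>\<^bsub>grp D\<^esub>"] by simp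
  then show "lg \<one>\<^bsub>grp D\<^esub> = 1" using *(1)[of "\<one>\<^bsub>grp D\<^esub>"] by simp
  have "lc \<one>\<^bsub>Gam D\<^esub> = lc \<one>\<^bsub>Gam D\<^esub> * lc \<one>\<^bsub>Gam D\<^esub>"
    using *(4)[of "\<one>\<^bsub>Gam D\<^esub>" "\<one>\<^bsub>Gam D\<^esub>"] monoid.r_one[OF group.is_monoid[OF Gam(2)], of "\<one>\<^bsub>Gam D\<^esub>"] by simp
  then show "lc \<one>\<^bsub>Gam D\<^esub> = 1" using *(2)[of "\<one>\<^bsub>Gam D\<^esub>"] by simp
qed

lemma charw_up: "charw lg lc \<Longrightarrow> charw (upg k lg) (upc k lc)"
proof -
  assume c: "charw lg lc"
  have "(lc X * q ^ k) ^ n = lc X ^ n"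
    by (simp add: power_mult_distrib power_mult[symmetric] mult.commute[of k] power_mult[of q n])
  then show ?thesis
    using c shift_a(2)[of k lc]
    by (auto simp: charw_def upg_def upc_def char_mult char_group_simps power_mult_distrib mult_ac)
qed

lemma charw_pow_n:
  "charw lg lc \<Longrightarrow> lg a = lc X * q ^ (L - 1) \<Longrightarrow> nilpotent_type D \<or> lg a ^ n = 1"
  using charwD(5)[of lg lc]
  by (auto simp: power_mult_distrib power_mult[symmetric] mult.commute[of _ n] power_mult[of q n])

lemma group_prod: "group (grp D \<times>\<times> Gam D)"
  using grp(2) Gam(2) by (rule DirProd_group)

lemma Lam_split:
  assumes "\<mu> \<in> carrier (Lam D)" "g \<in> GG" "\<gamma> \<in> CC"
  shows "\<mu> (g, \<gamma>) = at_G D \<mu> g * at_Gam D \<mu> \<gamma>"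
proof -
  have "\<mu> ((g, \<one>\<^bsub>Gam D\<^esub>) \<otimes>\<^bsub>grp D \<times>\<times> Gam D\<^esub> (\<one>\<^bsub>grp D\<^esub>, \<gamma>)) = at_G D \<mu> g * at_Gam D \<mu> \<gamma>"
    using assms by (intro char_group_carrierD(2)) auto
  moreover have "(g, \<one>\<^bsub>Gam D\<^esub>) \<otimes>\<^bsub>grp D \<times>\<times> Gam D\<^esub> (\<one>\<^bsub>grp D\<^esub>, \<gamma>) = (g, \<gamma>)"
    using assms grp(2) Gam(2) by (simp add: group.is_monoid monoid.l_one monoid.r_one)
  ultimately show ?thesis by simp
qed

lemma charw_Lam: "\<mu> \<in> carrier (Lam D) \<Longrightarrow> charw (at_G D \<mu>) (at_Gam D \<mu>)"
proof -
  assume m: "\<mu> \<in> carrier (Lam D)"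
  note d = char_group_carrierD(1,2)[OF m]
  have g1: "\<one>\<^bsub>grp D\<^esub> \<otimes>\<^bsub>grp D\<^esub> \<one>\<^bsub>grp D\<^esub> = \<one>\<^bsub>grp D\<^esub>" "\<one>\<^bsub>Gam D\<^esub> \<otimes>\<^bsub>Gam D\<^esub> \<one>\<^bsub>Gam D\<^esub> = \<one>\<^bsub>Gam D\<^esub>"
    using grp(2) Gam(2) by (simp_all add: group.is_monoid monoid.l_one)
  have 1: "at_G D \<mu> (g \<otimes>\<^bsub>grp D\<^esub> h) = at_G D \<mu> g * at_G D \<mu> h" if "g \<in> GG" "h \<in> GG" for g h
    using d(2)[of "(g, \<one>\<^bsub>Gam D\<^esub>)" "(h, \<one>\<^bsub>Gam D\<^esub>)"] that g1 by simp
  have 2: "at_Gam D \<mu> (g \<otimes>\<^bsub>Gam D\<^esub> h) = at_Gam D \<mu> g * at_Gam D \<mu> h" if "g \<in> CC" "h \<in> CC" for g h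
    using d(2)[of "(\<one>\<^bsub>grp D\<^esub>, g)" "(\<one>\<^bsub>grp D\<^esub>, h)"] that g1 by simp
  have "at_Gam D \<mu> X ^ n = 1" if "\<not> nilpotent_type D"
  proof -
    interpret Gm: comm_group "Gam D" by (rule Gam(1))
    have o: "at_Gam D \<mu> \<one>\<^bsub>Gam D\<^esub> = 1" using char_group_one[OF group_prod m] by simp
    have "at_Gam D \<mu> (X [^]\<^bsub>Gam D\<^esub> k) = at_Gam D \<mu> X ^ k" for k :: nat
    proof (induction k)
      case (Suc k)
      have "X [^]\<^bsub>Gam D\<^esub> Suc k = X [^]\<^bsub>Gam D\<^esub> k \<otimes>\<^bsub>Gam D\<^esub> X" by (rule Gm.nat_pow_Suc)
      then show ?case using 2[of "X [^]\<^bsub>Gam D\<^esub> k" X] Suc Gm.nat_pow_closed[of X k] by (simp add: mult.commute)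
    qed (simp add: o)
    moreover have "X [^]\<^bsub>Gam D\<^esub> n = \<one>\<^bsub>Gam D\<^esub>" using D that by (auto simp: is_group_datum_def)
    ultimately show ?thesis using o by metis
  qed
  then show ?thesis using d(1) 1 2 by (auto simp: charw_def)
qed

lemma Gam_at: "g \<in> GG \<Longrightarrow> (\<gamma> \<otimes>\<^bsub>Gam D\<^esub> \<delta>) g = \<gamma> g * \<delta> g" "g \<in> GG \<Longrightarrow> \<one>\<^bsub>Gam D\<^esub> g = 1"
  by (simp_all add: char_group_simps)

lemma phi_Lam: "phi D \<in> carrier (Lam D)"
  by (rule char_group_carrierI) (auto simp: phi_def char_mult Gam_at mult_ac)

lemma phi_at:
  assumes "\<mu> \<in> carrier (Lam D)"
  shows "g \<in> GG \<Longrightarrow> at_G D (phi D [^]\<^bsub>Lam D\<^esub> (k::nat) \<otimes>\<^bsub>Lam D\<^esub> \<mu>) g = upg k (at_G D \<mu>) g"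
    "\<gamma> \<in> CC \<Longrightarrow> at_Gam D (phi D [^]\<^bsub>Lam D\<^esub> (k::nat) \<otimes>\<^bsub>Lam D\<^esub> \<mu>) \<gamma> = upc k (at_Gam D \<mu>) \<gamma>"
  using char_group_pow[OF group_prod phi_Lam]
  by (auto simp: char_group_simps(1)[where H = "grp D \<times>\<times> Gam D"] upg_def upc_def phi_def
      Gam_at char_one)

lemma Lam_closed:
  "\<mu> \<in> carrier (Lam D) \<Longrightarrow> \<nu> \<in> carrier (Lam D) \<Longrightarrow> \<mu> \<otimes>\<^bsub>Lam D\<^esub> \<nu> \<in> carrier (Lam D)"
  "phi D [^]\<^bsub>Lam D\<^esub> (k::nat) \<in> carrier (Lam D)"
  using comm_group_char_group[OF group_prod, where 'k='k] phi_Lam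
  by (auto simp: comm_group_def group.is_monoid monoid.m_closed monoid.nat_pow_closed)

lemma I_setD:
  assumes "\<mu> \<in> I_set D l"
  shows "\<mu> \<in> carrier (Lam D)" "at_G D \<mu> a = at_Gam D \<mu> X * q ^ (l - 1)"
proof -
  show m: "\<mu> \<in> carrier (Lam D)" using assms by (simp add: I_set_def)
  have i: "inv\<^bsub>Gam D\<^esub> X \<in> CC" using Gam(2) by (simp add: group.inv_closed)
  let ?i = "at_Gam D \<mu> (inv\<^bsub>Gam D\<^esub> X)"
  have 1: "at_G D \<mu> a * ?i = q ^ (l - 1)"
    using assms Lam_split[OF m closed(1) i] by (simp add: I_set_def)
  have 2: "at_Gam D \<mu> X * ?i = 1"
    using charwD(4)[OF charw_Lam[OF m] closed(2) i] charwD(7)[OF charw_Lam[OF m]]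
    by (simp add: group.r_inv[OF Gam(2)])
  have "at_G D \<mu> a = at_G D \<mu> a * (at_Gam D \<mu> X * ?i)" by (simp add: 2)
  also have "\<dots> = at_Gam D \<mu> X * (at_G D \<mu> a * ?i)" by (rule mult.left_commute)
  finally show "at_G D \<mu> a = at_Gam D \<mu> X * q ^ (l - 1)" by (simp add: 1)
qed

lemma alpha_coeff_alq: "alpha_coeff D \<mu> i = alq (at_G D \<mu> a) (at_Gam D \<mu> X) i"
proof (cases i)
  case (Suc k)
  have "q powi (1 - int i) = inverse q ^ (i - 1)"
    using Suc by (simp add: power_int_minus power_inverse)
  then show ?thesis by (simp add: alpha_coeff_def alq_def)
qed (simp add: alpha_coeff_def)

end

lemma V_mod_rep: "V_mod D l \<mu> = rep_mod l (V_gen D l \<mu>)"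
  by (simp add: V_mod_def rep_mod_def)

lemma V_gen_carrier: "V_gen D l \<mu> z \<in> carrier_mat l l"
  by (cases z) auto

text \<open>The case L = n is included and then describes I_n''; it occurs in the decomposition for
  2s = t.\<close>

locale vmod = datum D for D :: "('g, 'k::field_char_0) group_datum" +
  fixes L :: nat and \<mu> :: "'g \<times> ('g \<Rightarrow> 'k) \<Rightarrow> 'k"
  assumes \<mu>: "\<mu> \<in> carrier (Lam D)" and L: "1 \<le> L" "L \<le> n" and \<mu>L: "at_G D \<mu> a = at_Gam D \<mu> X * q ^ (L - 1)"
begin

abbreviation "lg \<equiv> at_G D \<mu>"
abbreviation "lc \<equiv> at_Gam D \<mu>"
abbreviation "V \<equiv> V_mod D L \<mu>"

lemma cw: "charw lg lc"
  by (rule charw_Lam[OF \<mu>])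

lemma V_pre: "pre_module D V"
  unfolding V_mod_rep by (rule rep_pre_module) (rule V_gen_carrier)

lemma V_dim [simp]: "mdim V = L"
  by (simp add: V_mod_def)

lemma V_bas:
  assumes "j < L"
  shows "g \<in> GG \<Longrightarrow> app V (g_el g) (bas j) = upg j lg g *s bas j"
    "\<gamma> \<in> CC \<Longrightarrow> app V (c_el \<gamma>) (bas j) = upc j lc \<gamma> *s bas j"
    "app V x_el (bas j) = (if Suc j < L then bas (Suc j) else 0)"
    "app V xi_el (bas j) = alq (lg a) (lc X) j *s bas (j - 1)"
proof -
  have e: "mop (V_gen D L \<mu> z) (bas j) = (\<lambda>i. if i < L then V_gen D L \<mu> z $$ (i, j) else 0)" for z
    using mop_bas[OF V_gen_carrier assms] .
  \<comment> \<open>In the non-nilpotent type \<lambda>(\<chi>)^n = 1 and \<rho>^n = 1, so the entry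
    \<lambda>(a)^n - 1 that would close the cycle of x for L = n is 0.\<close>
  have z: "\<not> nilpotent_type D \<Longrightarrow> lg a ^ n = 1" using charw_pow_n[OF cw \<mu>L] by auto
  show "g \<in> GG \<Longrightarrow> app V (g_el g) (bas j) = upg j lg g *s bas j"
    unfolding V_mod_rep rep_mod_simps e using assms by (auto simp: phi_at[OF \<mu>] fun_eq_iff ptw bas_def)
  show "\<gamma> \<in> CC \<Longrightarrow> app V (c_el \<gamma>) (bas j) = upc j lc \<gamma> *s bas j"
    unfolding V_mod_rep rep_mod_simps e using assms by (auto simp: phi_at[OF \<mu>] fun_eq_iff ptw bas_def)
  show "app V x_el (bas j) = (if Suc j < L then bas (Suc j) else 0)"
    unfolding V_mod_rep rep_mod_simps e using assms z by (auto simp: fun_eq_iff ptw bas_def)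
  show "app V xi_el (bas j) = alq (lg a) (lc X) j *s bas (j - 1)"
    unfolding V_mod_rep rep_mod_simps e using assms by (cases j) (auto simp: fun_eq_iff ptw bas_def alpha_coeff_alq)
qed

lemma V_fsp [simp, intro]: "g \<in> GG \<Longrightarrow> app V (g_el g) v \<in> fsp L" "\<gamma> \<in> CC \<Longrightarrow> app V (c_el \<gamma>) v \<in> fsp L"
    "app V x_el v \<in> fsp L" "app V xi_el v \<in> fsp L"
  using app_fsp[OF V_pre] by simp_all

lemma V_xi_pow:
  assumes "j < L"
  shows "(app V xi_el ^^ k) (bas j) = (\<Prod>i<k. alq (lg a) (lc X) (j - i)) *s bas (j - k)"
proof (induction k)
  case (Suc k)
  have "app V xi_el (bas (j - k)) = alq (lg a) (lc X) (j - k) *s bas (j - Suc k)"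
    using V_bas(4)[of "j - k"] assms by (simp add: One_nat_def)
  then show ?case using Suc by simp
qed simp

lemma V_xi_pow_0: "j < L \<Longrightarrow> j < k \<Longrightarrow> (app V xi_el ^^ k) (bas j) = 0"
proof -
  assume a: "j < L" "j < k"
  have "(\<Prod>i<k. alq (lg a) (lc X) (j - i)) = 0"
    using a by (intro prod_zero) (auto intro!: bexI[of _ j])
  then show ?thesis unfolding V_xi_pow[OF a(1)] by (metis sc_simps(2))
qed

lemma V_x_pow: "j < L \<Longrightarrow> (app V x_el ^^ k) (bas j) = (if j + k < L then bas (j + k) else 0)"
  by (induction k) (auto simp: V_bas)

lemma V_torus: "torus D L (mg V) (mc V) (act V xi_el)"
proof
  fix g assume g: "g \<in> GG"
  show "act V (g_el g) \<in> carrier_mat L L" using pre_carrier[OF V_pre, of "g_el g"] g by simp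
  fix v :: "nat \<Rightarrow> 'k" assume v: "v \<in> fsp L"
  show "app V (g_el g) (app V (g_el h) v) = app V (g_el (g \<otimes>\<^bsub>grp D\<^esub> h)) v" if h: "h \<in> GG" for h
    by (rule lin_ext[OF _ _ _ v]) (use g h charwD(3)[OF charw_up[OF cw]] in \<open>auto simp: V_bas mult.commute\<close>)
  show "app V xi_el (app V (g_el g) v) = inverse (X g) *s app V (g_el g) (app V xi_el v)"
  proof (rule lin_ext[OF _ _ _ v])
    fix j assume j: "j < L"
    show "app V xi_el (app V (g_el g) (bas j)) = inverse (X g) *s app V (g_el g) (app V xi_el (bas j))"
      using g j by (cases j) (auto simp: V_bas upg_def mult_ac)
  qed auto
  show "app V (g_el g) (app V (c_el \<gamma>) v) = app V (c_el \<gamma>) (app V (g_el g) v)" if "\<gamma> \<in> CC" for \<gamma>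
    by (rule lin_ext[OF _ _ _ v]) (use g that in \<open>auto simp: V_bas mult.commute\<close>)
next
  fix \<gamma> assume g: "\<gamma> \<in> CC"
  show "act V (c_el \<gamma>) \<in> carrier_mat L L" using pre_carrier[OF V_pre, of "c_el \<gamma>"] g by simp
  fix v :: "nat \<Rightarrow> 'k" assume v: "v \<in> fsp L"
  show "app V (c_el \<gamma>) (app V (c_el \<delta>) v) = app V (c_el (\<gamma> \<otimes>\<^bsub>Gam D\<^esub> \<delta>)) v" if h: "\<delta> \<in> CC" for \<delta>
    by (rule lin_ext[OF _ _ _ v]) (use g h charwD(4)[OF charw_up[OF cw]] in \<open>auto simp: V_bas mult.commute\<close>)
  show "app V xi_el (app V (c_el \<gamma>) v) = \<gamma> a *s app V (c_el \<gamma>) (app V xi_el v)"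
  proof (rule lin_ext[OF _ _ _ v])
    fix j assume j: "j < L"
    show "app V xi_el (app V (c_el \<gamma>) (bas j)) = \<gamma> a *s app V (c_el \<gamma>) (app V xi_el (bas j))"
      using g j by (cases j) (auto simp: V_bas upc_def mult_ac)
  qed auto
next
  show "act V xi_el \<in> carrier_mat L L" using pre_carrier[OF V_pre, of xi_el] by simp
  fix v :: "nat \<Rightarrow> 'k" assume v: "v \<in> fsp L"
  show "app V (g_el \<one>\<^bsub>grp D\<^esub>) v = v"
    by (rule lin_ext[OF _ _ _ v]) (use charwD(6)[OF charw_up[OF cw]] in \<open>auto simp: V_bas\<close>)
  show "app V (c_el \<one>\<^bsub>Gam D\<^esub>) v = v"
    by (rule lin_ext[OF _ _ _ v]) (use charwD(7)[OF charw_up[OF cw]] in \<open>auto simp: V_bas\<close>)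
  show "(app V xi_el ^^ n) v = 0"
    by (rule lin_ext[OF _ _ _ v]) (use L in \<open>auto simp: V_xi_pow_0\<close>)
qed

lemma V_nilrep: "nilrep D L (mg V) (mc V) (act V xi_el) (act V x_el)"
proof -
  interpret torus D L "mg V" "mc V" "act V xi_el" by (rule V_torus)
  show ?thesis
  proof
    show "act V x_el \<in> carrier_mat L L" using pre_carrier[OF V_pre, of x_el] by simp
    fix v :: "nat \<Rightarrow> 'k" assume v: "v \<in> fsp L"
    show "app V x_el (app V (g_el g) v) = X g *s app V (g_el g) (app V x_el v)" if "g \<in> GG" for g
      by (rule lin_ext[OF _ _ _ v]) (use that in \<open>auto simp: V_bas upg_def mult.assoc[symmetric]\<close>)
    show "\<gamma> a *s app V x_el (app V (c_el \<gamma>) v) = app V (c_el \<gamma>) (app V x_el v)" if "\<gamma> \<in> CC" for \<gamma>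
      by (rule lin_ext[OF _ _ _ v]) (use that in \<open>auto simp: V_bas upc_def mult.assoc\<close>)
    show "app V x_el (app V xi_el v) - app V xi_el (app V x_el v) = app V (g_el a) v - app V (c_el X) v"
    proof (rule lin_ext[OF _ _ _ v])
      fix j assume j: "j < L"
      have 1: "app V x_el (app V xi_el (bas j)) = alq (lg a) (lc X) j *s bas j"
        using j by (cases j) (auto simp: V_bas)
      have 2: "app V xi_el (app V x_el (bas j)) = alq (lg a) (lc X) (Suc j) *s bas j"
      proof (cases "Suc j < L")
        case True
        then show ?thesis using j by (simp add: V_bas)
      next
        case False
        then have "Suc j = L" using j by simp
        then show ?thesis using j alq_z[OF \<mu>L] by (simp add: V_bas)
      qed
      show "app V x_el (app V xi_el (bas j)) - app V xi_el (app V x_el (bas j)) =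
          app V (g_el a) (bas j) - app V (c_el X) (bas j)"
        unfolding 1 2 using j
        by (simp add: V_bas shift_a alq_Suc sc_distrib(4)[symmetric])
    qed auto
  qed
qed

text \<open>\<xi>^(n-1) can be nonzero only for L = n and on v_(n-1), with image in the line of v_0;
  there \<rho>a and \<chi> agree, since \<rho>\<lambda>(a) = \<rho>^n \<lambda>(\<chi>).
  Consequently y acts as x on \<open>V\<close>.\<close>

lemma V_zop: "v \<in> fsp L \<Longrightarrow> torus.zop D (mg V) (mc V) (act V xi_el) v = 0"
proof -
  interpret torus D L "mg V" "mc V" "act V xi_el" by (rule V_torus)
  assume v: "v \<in> fsp L"
  show "zop v = 0" unfolding zop_def
  proof (rule lin_ext[OF _ _ _ v])
    fix j assume j: "j < L"
    show "q *s app V (g_el a) ((app V xi_el ^^ (n - 1)) (bas j)) - app V (c_el X) ((app V xi_el ^^ (n - 1)) (bas j)) = 0"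
    proof (cases "j < n - 1")
      case True
      then show ?thesis using j by (simp add: V_xi_pow_0)
    next
      case False
      then have jn: "j = n - 1" "L = n" using j L by auto
      have "q * q ^ (n - 1) = 1" using n2 by (simp flip: power_Suc)
      then have "q * lg a = lc X" using \<mu>L unfolding jn(2) by (simp add: mult.left_commute)
      define P where "P = (\<Prod>i<n - 1. alq (lg a) (lc X) (j - i))"
      have j0: "j - (n - 1) = 0" "0 < L" using jn L by simp_all
      have "q *s app V (g_el a) ((app V xi_el ^^ (n - 1)) (bas j)) - app V (c_el X) ((app V xi_el ^^ (n - 1)) (bas j))
          = (q * lg a * P) *s bas 0 - (lc X * P) *s bas 0"
        using j0 by (simp add: V_xi_pow[OF j] V_bas P_def mult_ac)
      then show ?thesis unfolding \<open>q * lg a = lc X\<close> by simp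
    qed
  qed auto
qed

lemma V_module: "dd_module D V"
proof (rule ddrep_dd_module[OF V_pre])
  interpret torus D L "mg V" "mc V" "act V xi_el" by (rule V_torus)
  interpret nilrep D L "mg V" "mc V" "act V xi_el" "act V x_el" by (rule V_nilrep)
  show "ddrep D (mdim V) (mg V) (mc V) (act V xi_el) (act V x_el)"
    unfolding V_dim
  proof (rule ddrep_twist[OF V_nilrep y_c])
    fix v :: "nat \<Rightarrow> 'k" assume v: "v \<in> fsp L"
    show "app V x_el v = app V x_el v + cw *s zop v" using V_zop[OF v] by simp
    show "(app V x_el ^^ n) v = alp D *s (app V (g_el (a [^]\<^bsub>grp D\<^esub> n)) v - v)"
    proof (rule lin_ext[OF _ _ _ v])
      fix j assume j: "j < L"
      have w: "wt (upg j lg) (upc j lc) (bas j)" using j V_bas by (auto simp: wt_def)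
      have "nilpotent_type D \<or> upg j lg a ^ n = 1"
        using charw_pow_n[OF cw \<mu>L]
        by (auto simp: shift_a power_mult_distrib power_mult[symmetric] power_inverse mult.commute[of _ n] power_mult[of q n])
      then have "alp D *s (app V (g_el (a [^]\<^bsub>grp D\<^esub> n)) (bas j) - bas j) = 0"
      proof
        assume "nilpotent_type D"
        then show ?thesis using kg_one[OF wtD(1)[OF w]] by (auto simp: nilpotent_type_def)
      qed (simp add: kg_pow[OF w closed(1)])
      then show "(app V x_el ^^ n) (bas j) = alp D *s (app V (g_el (a [^]\<^bsub>grp D\<^esub> n)) (bas j) - bas j)"
        using j L by (simp add: V_x_pow)
    qed auto
  qed
qed

lemma V_y: "v \<in> fsp L \<Longrightarrow> app V y_term v = app V x_el v"
  using app_y_term[OF V_pre, of v] V_zop[of v] torus.zop_def[OF V_torus, of v] by simp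

end

section \<open>The projective modules \<open>P(l,\<lambda>)\<close>\<close>

context datum
begin

abbreviation "wtm M \<equiv> torus.wt D (mdim M) (mg M) (mc M)"

lemma hom_cols:
  fixes M N :: "('g, 'k) ddmod"
  assumes M: "pre_module D M" and N: "pre_module D N"
    and c: "\<And>j. j < mdim M \<Longrightarrow> c j \<in> fsp (mdim N)"
    and bas: "\<And>u j. u \<in> g_el ` GG \<union> c_el ` CC \<union> {xi_el, y_term} \<Longrightarrow> j < mdim M \<Longrightarrow>
      mop (cols_mat (mdim N) (mdim M) c) (app M u (bas j)) = app N u (c j)"
  shows "cols_mat (mdim N) (mdim M) c \<in> dd_hom D M N"
proof -
  let ?F = "cols_mat (mdim N) (mdim M) c"
  have "mop ?F (app M u v) = app N u (mop ?F v)"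
    if u: "u \<in> g_el ` GG \<union> c_el ` CC \<union> {xi_el, y_term}" and v: "v \<in> fsp (mdim M)" for u v
    by (rule lin_ext[OF _ _ _ v]) (use bas[OF u] c in \<open>auto simp: mop_cols_mat\<close>)
  then show ?thesis by (intro dd_hom_yI[OF M N]) auto
qed

lemma hom_wt:
  fixes M N :: "('g, 'k) ddmod"
  assumes M: "dd_module D M" and N: "dd_module D N" and F: "F \<in> dd_hom D M N" and v: "wtm M lg lc v"
  shows "wtm N lg lc (mop F v)"
proof -
  interpret M: nilrep D "mdim M" "mg M" "mc M" "act M xi_el" "act M y_term" by (rule dd_module_nilrep[OF M])
  interpret N: nilrep D "mdim N" "mg N" "mc N" "act N xi_el" "act N y_term" by (rule dd_module_nilrep[OF N])
  have "app N u (mop F v) = mop F (app M u v)" if "u \<in> dd_terms D" for u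
    using dd_hom_app[OF dd_module_pre[OF M] dd_module_pre[OF N] F that] by simp
  then show ?thesis
    using v mop_fsp[OF dd_hom_carrier[OF F], of v] by (simp add: M.wt_def N.wt_def)
qed

lemma hom_wproj:
  fixes M N :: "('g, 'k) ddmod"
  assumes M: "dd_module D M" and N: "dd_module D N" and F: "F \<in> dd_hom D M N"
  shows "mop F (torus.wproj D (mg M) (mc M) lg lc v) = torus.wproj D (mg N) (mc N) lg lc (mop F v)"
proof -
  interpret M: nilrep D "mdim M" "mg M" "mc M" "act M xi_el" "act M y_term" by (rule dd_module_nilrep[OF M])
  interpret N: nilrep D "mdim N" "mg N" "mc N" "act N xi_el" "act N y_term" by (rule dd_module_nilrep[OF N])
  show ?thesis
    by (simp add: M.wproj_def N.wproj_def dd_hom_app[OF dd_module_pre[OF M] dd_module_pre[OF N] F])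
qed

lemma hom_pow:
  fixes M N :: "('g, 'k) ddmod"
  assumes M: "dd_module D M" and N: "dd_module D N" and F: "F \<in> dd_hom D M N" and u: "u \<in> dd_terms D"
  shows "mop F ((app M u ^^ k) v) = (app N u ^^ k) (mop F v)"
  by (induction k) (simp_all add: dd_hom_app[OF dd_module_pre[OF M] dd_module_pre[OF N] F u])

lemma module_y_n:
  fixes M :: "('g, 'k) ddmod"
  assumes M: "dd_module D M" and v: "wtm M lg lc v" and "nilpotent_type D \<or> lg a ^ n = 1"
  shows "(app M y_term ^^ n) v = 0"
proof -
  interpret M: nilrep D "mdim M" "mg M" "mc M" "act M xi_el" "act M y_term" by (rule dd_module_nilrep[OF M])
  show ?thesis
  proof (rule M.y_n_zero[OF dd_module_ddrep[OF M] _ v assms(3)])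
    fix v :: "nat \<Rightarrow> 'k" assume "v \<in> fsp (mdim M)"
    then show "app M x_el v = app M y_term v + cw *s M.zop v"
      using app_y_term[OF dd_module_pre[OF M], of v] by (simp add: M.zop_def)
  qed
qed

end

text \<open>By \<open>xi_y_pow\<close>, \<xi> acts on the y-powers of a vector killed by \<xi> with
  the structure constants of \<open>V\<close>; the condition on the L-th power closes the
  string.\<close>

lemma (in vmod) V_hom:
  fixes N :: "('g, 'k) ddmod"
  assumes N: "dd_module D N" and h: "wtm N lg lc h" and xi: "app N xi_el h = 0"
    and y: "(app N y_term ^^ L) h = 0"
  shows "cols_mat (mdim N) L (\<lambda>j. (app N y_term ^^ j) h) \<in> dd_hom D V N"
proof -
  let ?c = "\<lambda>j. (app N y_term ^^ j) h"
  interpret N: nilrep D "mdim N" "mg N" "mc N" "act N xi_el" "act N y_term" by (rule dd_module_nilrep[OF N])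
  have c: "?c j \<in> fsp (mdim N)" for j using N.wtD(1)[OF h] by simp
  have "cols_mat (mdim N) (mdim V) ?c \<in> dd_hom D V N"
  proof (rule hom_cols[OF V_pre dd_module_pre[OF N] c])
    fix u j assume u: "u \<in> g_el ` GG \<union> c_el ` CC \<union> {xi_el, y_term}" and "j < mdim V"
    then have j: "j < L" by simp
    note w = N.wt_y_pow[OF h, of j]
    have y': "(if Suc j < L then ?c (Suc j) else 0) = ?c (Suc j)"
    proof (cases "Suc j < L")
      case False
      then have "Suc j = L" using j by simp
      then show ?thesis using y by simp
    qed simp
    have "app N xi_el (?c j) = alq (lg a) (lc X) j *s ?c (j - 1)"
      using N.xi_y_pow[OF h, of j] xi by simp
    then show "mop (cols_mat (mdim N) (mdim V) ?c) (app V u (bas j)) = app N u (?c j)"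
      using u j y' by (auto simp: V_bas V_y mop_cols_mat c N.wtD(2,3)[OF w])
  qed
  then show ?thesis by simp
qed

context datum
begin

text \<open>The exponent of \<phi> in the weight of the i-th basis vector relative to u; the
  generator w has exponent m.\<close>

definition P_deg :: "nat \<Rightarrow> nat \<Rightarrow> nat" where
  "P_deg m i = (if i < n then i else m + (i - n))"

definition P_y :: "'k mat" where
  "P_y = cols_mat (2 * n) (2 * n) (\<lambda>i. if Suc i = n \<or> Suc i = 2 * n then 0 else bas (Suc i))"

text \<open>Forced by \<open>xi_y_pow\<close>: \<xi>y^j w is y^j \<xi>w plus a multiple of y^(j-1)
  w, and y^j \<xi>w = y^(m-1+j) u is cut off by y^n u = 0. At j = 0 the second coefficient is 0, so
  that the index \<open>i - 1\<close> there is harmless.\<close>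

definition P_xi :: "nat \<Rightarrow> 'k \<Rightarrow> 'k \<Rightarrow> 'k mat" where
  "P_xi m p r = cols_mat (2 * n) (2 * n) (\<lambda>i.
     if i < n then alq p r i *s bas (i - 1)
     else (if m - 1 + (i - n) < n then bas (m - 1 + (i - n)) else 0) +
       alq (p * inverse q ^ m) (r * q ^ m) (i - n) *s bas (i - 1))"

text \<open>The basis vectors \<open>u\<^sub>i = y\<^sup>i u\<close> and \<open>w\<^sub>i = y\<^sup>i w\<close>, \<open>i < n\<close>, have the indices \<open>i\<close> and \<open>n + i\<close>, respectively;
  the vector \<open>u\<close> has weight \<open>(lg, lc)\<close>, the generator \<open>w\<close> has the weight shifted by \<open>\<phi>\<^sup>m\<close>, and
  \<open>\<xi>w = y\<^sup>m\<^sup>-\<^sup>1u\<close>, where \<open>m = n - l\<close>.\<close>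

definition P_gen :: "nat \<Rightarrow> ('g \<Rightarrow> 'k) \<Rightarrow> (('g \<Rightarrow> 'k) \<Rightarrow> 'k) \<Rightarrow> ('g, 'k) ddgen \<Rightarrow> 'k mat" where
  "P_gen m lg lc z = (
     let kg = (\<lambda>g. cols_mat (2 * n) (2 * n) (\<lambda>i. upg (P_deg m i) lg g *s bas i));
         kc = (\<lambda>\<gamma>. cols_mat (2 * n) (2 * n) (\<lambda>i. upc (P_deg m i) lc \<gamma> *s bas i))
     in case z of GGen g \<Rightarrow> kg g | CGen \<gamma> \<Rightarrow> kc \<gamma> | XiGen \<Rightarrow> P_xi m (lg a) (lc X)
        | XGen \<Rightarrow> tw_mat (kg a) (kc X) (P_xi m (lg a) (lc X)) P_y)"

definition P_ex :: "nat \<Rightarrow> ('g \<Rightarrow> 'k) \<Rightarrow> (('g \<Rightarrow> 'k) \<Rightarrow> 'k) \<Rightarrow> ('g, 'k) ddmod" where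
  "P_ex m lg lc = rep_mod (2 * n) (P_gen m lg lc)"

end

text \<open>The weight (\<open>lg\<close>, \<open>lc\<close>) belongs to u. Assumption
  \<open>lm\<close> is the condition of I_m, so y^m u is again killed by \<xi>; the head, generated
  by w, has dimension n - m and weight shifted by the m-th power of \<phi>.\<close>

locale pmod = datum D for D :: "('g, 'k::field_char_0) group_datum" +
  fixes m :: nat and lg :: "'g \<Rightarrow> 'k" and lc :: "('g \<Rightarrow> 'k) \<Rightarrow> 'k"
  assumes cw: "charw lg lc" and m: "1 \<le> m" "m < n" and lm: "lg a = lc X * q ^ (m - 1)"
begin

abbreviation "P \<equiv> P_ex m lg lc"
abbreviation "al \<equiv> alq (lg a) (lc X)"
abbreviation "al' \<equiv> alq (lg a * inverse q ^ m) (lc X * q ^ m)"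

lemma P_dim [simp]: "mdim P = 2 * n"
  by (simp add: P_ex_def)

lemma P_gen_carrier: "P_gen m lg lc z \<in> carrier_mat (2 * n) (2 * n)"
  by (cases z) (auto simp: P_gen_def Let_def P_xi_def P_y_def intro!: tw_mat_c)

lemma P_pre: "pre_module D P"
  unfolding P_ex_def by (rule rep_pre_module) (rule P_gen_carrier)

lemma P_bas:
  assumes i: "i < 2 * n"
  shows "g \<in> GG \<Longrightarrow> app P (g_el g) (bas i) = upg (P_deg m i) lg g *s bas i"
    "\<gamma> \<in> CC \<Longrightarrow> app P (c_el \<gamma>) (bas i) = upc (P_deg m i) lc \<gamma> *s bas i"
    "i < n \<Longrightarrow> app P xi_el (bas i) = al i *s bas (i - 1)"
    "n \<le> i \<Longrightarrow> app P xi_el (bas i) = (if m - 1 + (i - n) < n then bas (m - 1 + (i - n)) else 0)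
       + al' (i - n) *s bas (i - 1)"
proof -
  show "g \<in> GG \<Longrightarrow> app P (g_el g) (bas i) = upg (P_deg m i) lg g *s bas i"
    "\<gamma> \<in> CC \<Longrightarrow> app P (c_el \<gamma>) (bas i) = upc (P_deg m i) lc \<gamma> *s bas i"
    using i by (auto simp: P_ex_def P_gen_def Let_def mop_cols_mat)
  show "i < n \<Longrightarrow> app P xi_el (bas i) = al i *s bas (i - 1)"
    "n \<le> i \<Longrightarrow> app P xi_el (bas i) = (if m - 1 + (i - n) < n then bas (m - 1 + (i - n)) else 0)
       + al' (i - n) *s bas (i - 1)"
    using i by (auto simp: P_ex_def P_gen_def Let_def P_xi_def mop_cols_mat)
qed

lemma P_y_bas:
  assumes i: "i < 2 * n"
  shows "app P y_term (bas i) = (if Suc i = n \<or> Suc i = 2 * n then 0 else bas (Suc i))"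
proof -
  have "app P y_term (bas i) = mop P_y (bas i)"
    using i P_pre app_y_term[OF P_pre, of "bas i"]
    by (simp add: P_ex_def P_gen_def Let_def mop_tw_mat[of _ "2 * n"] P_xi_def P_y_def)
  then show ?thesis using i by (auto simp: P_y_def mop_cols_mat)
qed

lemma P_y_pow: "i < n \<Longrightarrow> (app P y_term ^^ i) (bas 0) = bas i"
    "i < n \<Longrightarrow> (app P y_term ^^ i) (bas n) = bas (n + i)"
  by (induction i) (auto simp: P_y_bas)

lemma P_xi_pow: "j < n \<Longrightarrow> (app P xi_el ^^ k) (bas j) = (\<Prod>i<k. al (j - i)) *s bas (j - k)"
proof (induction k)
  case (Suc k)
  have "app P xi_el (bas (j - k)) = al (j - k) *s bas (j - Suc k)"
    using P_bas(3)[of "j - k"] Suc.prems by (simp add: One_nat_def)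
  then show ?case using Suc by simp
qed simp

lemma P_xi_n: "app P xi_el (bas n) = bas (m - 1)"
  using P_bas(4)[of n] m by simp

lemma lcX: "lc X \<noteq> 0"
  using charwD(2)[OF cw] by simp

lemma al_nz: "0 < i \<Longrightarrow> i < n \<Longrightarrow> i \<noteq> m \<Longrightarrow> al i \<noteq> 0" and al_m [simp]: "al m = 0"
  using alq_nz[OF lm lcX, of i] alq_z[OF lm] m by auto

lemma lm': "lg a * inverse q ^ m = lc X * q ^ m * q ^ (n - m - 1)"
proof -
  have "q ^ m * q ^ (n - m - 1) = inverse q"
    using m n2 by (simp add: power_add[symmetric] power_diff field_simps One_nat_def)
  moreover have "q ^ (m - 1) * inverse q ^ m = inverse q" using m by (cases m) (auto simp: field_simps)
  ultimately show ?thesis by (simp add: lm mult.assoc)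
qed

lemma al'_nz: "0 < i \<Longrightarrow> i < n \<Longrightarrow> i \<noteq> n - m \<Longrightarrow> al' i \<noteq> 0"
  using alq_nz[OF lm', of i] lcX m by auto

abbreviation "be \<equiv> beq (lg a * inverse q ^ m) (lc X * q ^ m)"

lemma be_nz: "0 < i \<Longrightarrow> i < n \<Longrightarrow> i \<noteq> m \<Longrightarrow> be i \<noteq> 0" and be_m [simp]: "be m = 0"
  using beq_nz[OF lm', of i] beq_z[OF lm'] lcX m by auto

lemma P_xi_at:
  assumes k: "k < n"
  shows "app P xi_el v k = (if Suc k < n then v (Suc k) * al (Suc k) else 0) +
      (if m - 1 \<le> k then v (n + (k - (m - 1))) else 0)"
    "app P xi_el v (n + k) = (if Suc k < n then v (n + Suc k) * al' (Suc k) else 0)"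
proof -
  have e: "app P xi_el v i = (\<Sum>j<n. v j * al j * bas (j - 1) i) +
    (\<Sum>j<n. v (n + j) * ((if m - 1 + j < n then bas (m - 1 + j) i else 0) + al' j * bas (n + j - 1) i))" for i
  proof -
    have "app P xi_el v i = (\<Sum>j<2 * n. v j * app P xi_el (bas j) i)"
      using mop_expand[of "act P xi_el" "2 * n" "2 * n" v] pre_carrier[OF P_pre, of xi_el]
      by (simp add: sum_fun_apply ptw)
    also have "\<dots> = (\<Sum>j<n. v j * app P xi_el (bas j) i) + (\<Sum>j<n. v (n + j) * app P xi_el (bas (n + j)) i)"
      using sum_split_at[of _ n n] by (simp add: mult_2 add.commute)
    also have "(\<Sum>j<n. v j * app P xi_el (bas j) i) = (\<Sum>j<n. v j * al j * bas (j - 1) i)"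
      by (rule sum.cong) (auto simp: P_bas ptw)
    also have "(\<Sum>j<n. v (n + j) * app P xi_el (bas (n + j)) i) =
      (\<Sum>j<n. v (n + j) * ((if m - 1 + j < n then bas (m - 1 + j) i else 0) + al' j * bas (n + j - 1) i))"
      by (rule sum.cong) (auto simp: P_bas ptw)
    finally show ?thesis .
  qed
  have 1: "(\<Sum>j<n. v j * al j * bas (j - 1) k) = (\<Sum>j<n. if j = Suc k then v (Suc k) * al (Suc k) else 0)"
  proof (rule sum.cong[OF HOL.refl])
    fix j show "v j * al j * bas (j - 1) k = (if j = Suc k then v (Suc k) * al (Suc k) else 0)"
      by (cases j) (auto simp: bas_def)
  qed
  have 2: "(\<Sum>j<n. v (n + j) * ((if m - 1 + j < n then bas (m - 1 + j) k else 0) + al' j * bas (n + j - 1) k)) =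
    (\<Sum>j<n. if j = k - (m - 1) then (if m - 1 \<le> k then v (n + (k - (m - 1))) else 0) else 0)"
  proof (rule sum.cong[OF HOL.refl])
    fix j assume "j \<in> {..<n}"
    moreover have "al' j * bas (n + j - 1) k = 0" using k by (cases j) (auto simp: bas_def)
    ultimately show "v (n + j) * ((if m - 1 + j < n then bas (m - 1 + j) k else 0) + al' j * bas (n + j - 1) k) =
      (if j = k - (m - 1) then (if m - 1 \<le> k then v (n + (k - (m - 1))) else 0) else 0)"
      using k m by (auto simp: bas_def)
  qed
  show "app P xi_el v k = (if Suc k < n then v (Suc k) * al (Suc k) else 0) +
      (if m - 1 \<le> k then v (n + (k - (m - 1))) else 0)"
    unfolding e 1 2 using k by auto
  have 3: "(\<Sum>j<n. v j * al j * bas (j - 1) (n + k)) = 0"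
    by (rule sum.neutral) (auto simp: bas_def)
  have 4: "(\<Sum>j<n. v (n + j) * ((if m - 1 + j < n then bas (m - 1 + j) (n + k) else 0) + al' j * bas (n + j - 1) (n + k))) =
    (\<Sum>j<n. if j = Suc k then v (n + Suc k) * al' (Suc k) else 0)"
  proof (rule sum.cong[OF HOL.refl])
    fix j show "v (n + j) * ((if m - 1 + j < n then bas (m - 1 + j) (n + k) else 0) + al' j * bas (n + j - 1) (n + k)) =
      (if j = Suc k then v (n + Suc k) * al' (Suc k) else 0)"
      by (cases j) (auto simp: bas_def)
  qed
  show "app P xi_el v (n + k) = (if Suc k < n then v (n + Suc k) * al' (Suc k) else 0)"
    unfolding e 3 4 by auto
qed

text \<open>For 0 < i < n, \<open>al' i\<close> vanishes only at n - m, so the coordinates of the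
  second string are killed by its own equations except at the indices 0 and n - m. These two are
  read off from coordinate m - 1, where \<open>al m\<close> = 0 removes the first string, and from
  coordinate n - 1, to which the first string does not contribute. In the first string only the
  indices 0 and m then remain.\<close>

lemma P_ker_xi:
  assumes v: "v \<in> fsp (2 * n)" and z: "app P xi_el v = 0"
  shows "v = v 0 *s bas 0 + v m *s bas m"
proof -
  have z': "app P xi_el v k = 0" for k using z by (simp add: ptw)
  have w: "v (n + i) = 0" if "i < n" for i
  proof -
    consider "i = 0" | "i = n - m" | "0 < i" "i \<noteq> n - m" by auto
    then show ?thesis
    proof cases
      case 1
      then show ?thesis using P_xi_at(1)[of "m - 1" v] z' m by (simp add: Suc_diff_le[symmetric])
    next
      case 2
      have e: "n - 1 - (m - 1) = n - m" "m - 1 \<le> n - 1" "n - 1 < n" "\<not> Suc (n - 1) < n" using m by auto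
      have "v (n + (n - 1 - (m - 1))) = 0" using P_xi_at(1)[OF e(3), of v] e(2,4) z' by simp
      then show ?thesis by (simp only: e 2)
    next
      case 3
      then show ?thesis using P_xi_at(2)[of "i - 1" v] z' that al'_nz[of i] by simp
    qed
  qed
  have u: "v i = 0" if i: "0 < i" "i < n" "i \<noteq> m" for i
  proof -
    have "v (n + (i - 1 - (m - 1))) = 0" by (rule w) (use i in linarith)
    then have "v i * al i = 0"
      using P_xi_at(1)[OF less_imp_diff_less[OF i(2)], of v 1] z' i by (simp del: diff_diff_left split: if_splits)
    then show ?thesis using al_nz[OF i] by simp
  qed
  show ?thesis
  proof
    fix i
    consider "i < n" | "n \<le> i" "i < 2 * n" | "2 * n \<le> i" by linarith
    then show "v i = (v 0 *s bas 0 + v m *s bas m) i"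
    proof cases
      case 1
      then show ?thesis using u[of i] m by (auto simp: ptw bas_def)
    next
      case 2
      then show ?thesis using w[of "i - n"] m by (auto simp: ptw bas_def)
    next
      case 3
      then show ?thesis using v m by (auto simp: ptw bas_def fsp_def)
    qed
  qed
qed

text \<open>The target is a module, the source only a \<open>pre_module\<close>: this serves both
  for embedding \<open>P_ex\<close> before it is known to be a module and for lifting maps out of it
  afterwards.\<close>

lemma P_hom:
  fixes N :: "('g, 'k) ddmod"
  assumes N: "dd_module D N" and u: "wtm N lg lc u" and w: "wtm N (upg m lg) (upc m lc) w"
    and xu: "app N xi_el u = 0" and xw: "app N xi_el w = (app N y_term ^^ (m - 1)) u"
    and yu: "(app N y_term ^^ n) u = 0" and yw: "(app N y_term ^^ n) w = 0"
  shows "\<exists>F\<in>dd_hom D P N. (\<forall>i<n. mop F (bas i) = (app N y_term ^^ i) u) \<and>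
    (\<forall>i<n. mop F (bas (n + i)) = (app N y_term ^^ i) w)"
proof -
  let ?y = "app N y_term"
  define c where "c i = (if i < n then (?y ^^ i) u else (?y ^^ (i - n)) w)" for i
  let ?F = "cols_mat (mdim N) (mdim P) c"
  interpret N: nilrep D "mdim N" "mg N" "mc N" "act N xi_el" "act N y_term" by (rule dd_module_nilrep[OF N])
  have c: "c i \<in> fsp (mdim N)" for i using N.wtD(1)[OF u] N.wtD(1)[OF w] by (simp add: c_def)
  have F: "mop ?F (bas i) = c i" if "i < 2 * n" for i using that c by (simp add: mop_cols_mat)
  note F' = F[unfolded P_dim]
  have yz: "(?y ^^ k) u = 0" if "n \<le> k" for k
  proof -
    have "(?y ^^ k) u = (?y ^^ (k - n)) ((?y ^^ n) u)"
      using that by (simp add: funpow_add[symmetric, THEN fun_cong, simplified])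
    then show ?thesis using yu by simp
  qed
  have "?F \<in> dd_hom D P N"
  proof (rule hom_cols[OF P_pre dd_module_pre[OF N] c])
    fix t i assume t: "t \<in> g_el ` GG \<union> c_el ` CC \<union> {xi_el, y_term}" and "i < mdim P"
    then have i: "i < 2 * n" by simp
    have wt: "N.wt (upg (P_deg m i) lg) (upc (P_deg m i) lc) (c i)"
      using N.wt_y_pow[OF u, of i] N.wt_y_pow[OF w, of "i - n"]
      unfolding P_deg_def c_def shift_up add.commute[of _ m] by (cases "i < n") simp_all
    have y: "mop ?F (app P y_term (bas i)) = ?y (c i)"
    proof -
      consider "Suc i = n" | "Suc i = 2 * n" | "Suc i < n" | "n \<le> i" "Suc i < 2 * n" using i by linarith
      then show ?thesis
      proof cases
        case 1
        then have "i < n" by simp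
        then have "?y (c i) = (?y ^^ Suc i) u" by (simp add: c_def)
        then have "?y (c i) = 0" by (simp only: 1 yu)
        then show ?thesis using P_y_bas[OF i] 1 by simp
      next
        case 2
        then have e: "Suc (i - n) = n" "\<not> i < n" using n2 by auto
        have "?y (c i) = (?y ^^ Suc (i - n)) w" using e(2) by (simp add: c_def)
        then have "?y (c i) = 0" by (simp only: e(1) yw)
        then show ?thesis using P_y_bas[OF i] 2 by simp
      next
        case 3
        then show ?thesis using P_y_bas[OF i] F[of "Suc i"] by (simp add: c_def)
      next
        case 4
        then show ?thesis using P_y_bas[OF i] F[of "Suc i"] by (simp add: c_def Suc_diff_le)
      qed
    qed
    have xi: "mop ?F (app P xi_el (bas i)) = app N xi_el (c i)"
    proof (cases "i < n")
      case True
      then show ?thesis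
        using P_bas(3)[OF i] F[of "i - 1"] N.xi_y_pow[OF u, of i] xu less_imp_diff_less[OF True, of 1]
        by (simp add: c_def)
    next
      case False
      define j where "j = i - n"
      have ij: "i = n + j" "j < n" using False i by (auto simp: j_def)
      have "app N xi_el (c i) = (?y ^^ (j + (m - 1))) u + al' j *s (?y ^^ (j - 1)) w"
        using N.xi_y_pow[OF w, of j] by (simp add: c_def ij xw shift_a funpow_add)
      also have "(?y ^^ (j + (m - 1))) u = (if m - 1 + j < n then c (m - 1 + j) else 0)"
        using yz[of "j + (m - 1)"] by (auto simp: c_def add.commute)
      also have "al' j *s (?y ^^ (j - 1)) w = al' j *s c (i - 1)"
        by (cases j) (auto simp: c_def ij)
      finally have x: "app N xi_el (c i) = (if m - 1 + j < n then c (m - 1 + j) else 0) + al' j *s c (i - 1)" .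
      have b: "app P xi_el (bas i) = (if m - 1 + j < n then bas (m - 1 + j) else 0) + al' j *s bas (i - 1)"
        using P_bas(4)[OF i] False by (simp add: j_def)
      have f: "mop ?F (bas (i - 1)) = c (i - 1)" "m - 1 + j < n \<Longrightarrow> mop ?F (bas (m - 1 + j)) = c (m - 1 + j)"
        using i by (simp_all add: F')
      show ?thesis unfolding x b using f by (cases "m - 1 + j < n") simp_all
    qed
    show "mop ?F (app P t (bas i)) = app N t (c i)"
      using t y xi i by (auto simp: P_bas F' N.wtD(2,3)[OF wt])
  qed
  then show ?thesis by (rule bexI[rotated]) (auto simp: F' c_def)
qed

end

section \<open>Solving the highest weight conditions on a weight space\<close>

context nilrep
begin

text \<open>A linear factor in y\<xi>; it preserves weight spaces and commutes with y\<xi>.\<close>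

definition step :: "'k \<Rightarrow> (nat \<Rightarrow> 'k) \<Rightarrow> nat \<Rightarrow> 'k" where
  "step b v = mop y (mop xi v) + b *s v"

lemma wt_yxi: "wt lg lc v \<Longrightarrow> wt lg lc (mop y (mop xi v))"
  by (rule wt_cong[OF wt_y[OF wt_xi]]) (auto simp: upg_def dng_def upc_def dnc_def)

lemma wt_step: "wt lg lc v \<Longrightarrow> wt lg lc (step b v)"
  unfolding step_def by (intro wt_lin wt_yxi)

lemma wt_fold_step: "wt lg lc v \<Longrightarrow> wt lg lc (fold step bs v)"
  by (induction bs arbitrary: v) (auto intro: wt_step)

lemma fold_step_yxi: "mop y (mop xi (fold step bs v)) = fold step bs (mop y (mop xi v))"
  by (induction bs arbitrary: v) (auto simp: step_def)

text \<open>By \<open>y_xi_pow\<close>, y\<xi>^(k+2) = \<xi>^(k+1) (y\<xi> + b) with b the constant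
  of index k + 1. Absorbing one y at a time leaves \<xi> applied to the product of the linear
  factors.\<close>

lemma y_pow_xi_pow:
  assumes "wt lg lc v"
  shows "(mop y ^^ k) ((mop xi ^^ Suc k) v) =
    mop xi (fold step (rev (map (beq (lg a) (lc X)) [1..<Suc k])) v)"
  using assms
proof (induction k arbitrary: v)
  case (Suc k)
  let ?b = "beq (lg a) (lc X) (Suc k)"
  have "(mop y ^^ Suc k) ((mop xi ^^ Suc (Suc k)) v) = (mop y ^^ k) (mop y ((mop xi ^^ Suc (Suc k)) v))"
    by (simp add: funpow_swap1)
  also have "mop y ((mop xi ^^ Suc (Suc k)) v) = (mop xi ^^ Suc k) (step ?b v)"
    unfolding y_xi_pow[OF Suc.prems, of "Suc k"] step_def funpow_mop_lin ..
  also have "(mop y ^^ k) \<dots> = mop xi (fold step (rev (map (beq (lg a) (lc X)) [1..<Suc k])) (step ?b v))"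
    by (rule Suc.IH[OF wt_step[OF Suc.prems]])
  finally show ?case by (simp add: One_nat_def)
qed (simp add: One_nat_def)

text \<open>On vectors with \<xi>y\<xi>v = 0 the operator y\<xi> has square 0, so y\<xi> + b has the
  inverse 1/b - y\<xi>/b^2.\<close>

lemma fold_step_inverse:
  assumes "wt lg lc v" "mop xi (mop y (mop xi v)) = 0" "0 \<notin> set bs"
  shows "\<exists>w. wt lg lc w \<and> mop xi (mop y (mop xi w)) = 0 \<and> fold step bs w = v"
  using assms(3)
proof (induction bs)
  case (Cons b bs)
  then obtain w where w: "wt lg lc w" "mop xi (mop y (mop xi w)) = 0" "fold step bs w = v" by auto
  define w' where "w' = inverse b *s w - (inverse b * inverse b) *s mop y (mop xi w)"
  have "step b w' = w" using Cons.prems w(2) by (simp add: step_def w'_def sc_distrib mult.assoc[symmetric])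
  moreover have "wt lg lc w'" unfolding w'_def by (intro wt_lin wt_yxi w)
  moreover have "mop xi (mop y (mop xi w')) = 0" using w(2) by (simp add: w'_def)
  ultimately show ?case using w(3) by auto
qed (use assms in auto)

text \<open>The list omits the factor of index m, which is y\<xi> itself because its constant is 0.
  Applying y\<xi> restores it, and a further \<xi> gives y^(n-1)\<xi>^n v = 0.\<close>

lemma fold_step_kernel:
  assumes v: "wt lg lc v" and m: "1 \<le> m" "m < n" and b: "beq (lg a) (lc X) m = 0"
    and bs: "bs = rev (map (beq (lg a) (lc X)) [Suc m..<n]) @ rev (map (beq (lg a) (lc X)) [1..<m])"
  shows "mop xi (mop y (mop xi (fold step bs v))) = 0"
proof -
  let ?b = "beq (lg a) (lc X)"
  have l: "[1..<n] = [1..<m] @ m # [Suc m..<n]"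
    using m upt_add_eq_append[of 1 m "n - m"] upt_conv_Cons[of m n] by simp
  let ?A = "rev (map ?b [Suc m..<n])" and ?B = "rev (map ?b [1..<m])"
  have "mop y (mop xi (fold step bs v)) = fold step ?B (mop y (mop xi (fold step ?A v)))"
    unfolding bs fold_append o_apply fold_step_yxi[of ?B] ..
  also have "\<dots> = fold step (rev (map ?b [1..<n])) v"
    unfolding l by (simp add: step_def b)
  finally have "mop xi (mop y (mop xi (fold step bs v))) = (mop y ^^ (n - 1)) ((mop xi ^^ Suc (n - 1)) v)"
    using y_pow_xi_pow[OF v, of "n - 1"] n2 by simp
  then show ?thesis using xi_n[OF wtD(1)[OF v]] n2 by simp
qed

text \<open>The term \<xi>^(k+1)y\<xi>v vanishes, so each y removes one \<xi> at the cost of one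
  constant. For k = m - 1 this makes a multiple of \<xi>^m w the vector u with y^(m-1)u =
  \<xi>w.\<close>

lemma y_pow_xi_pow_kernel:
  assumes v: "wt lg lc v" and k: "mop xi (mop y (mop xi v)) = 0"
  shows "(mop y ^^ k) ((mop xi ^^ Suc k) v) = (\<Prod>i=1..k. beq (lg a) (lc X) i) *s mop xi v"
proof (induction k)
  case (Suc k)
  have 0: "(mop xi ^^ Suc k) (mop y (mop xi v)) = 0" using k by (simp add: funpow_swap1)
  have "(mop y ^^ Suc k) ((mop xi ^^ Suc (Suc k)) v) = (mop y ^^ k) (mop y ((mop xi ^^ Suc (Suc k)) v))"
    by (simp add: funpow_swap1)
  also have "mop y ((mop xi ^^ Suc (Suc k)) v) = beq (lg a) (lc X) (Suc k) *s (mop xi ^^ Suc k) v"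
    unfolding y_xi_pow[OF v, of "Suc k"] 0 by simp
  also have "(mop y ^^ k) \<dots> = beq (lg a) (lc X) (Suc k) *s ((\<Prod>i=1..k. beq (lg a) (lc X) i) *s mop xi v)"
    unfolding funpow_mop_lin Suc ..
  finally show ?case by (simp add: mult.commute)
qed simp

text \<open>Descent from \<xi>^n v = 0: on such v and for m < j < n, y\<xi>^(j+1) v is a nonzero
  multiple of \<xi>^j v.\<close>

lemma xi_pow_kernel:
  assumes v: "wt lg lc v" and k: "mop xi (mop y (mop xi v)) = 0"
    and b: "\<And>i. m < i \<Longrightarrow> i < n \<Longrightarrow> beq (lg a) (lc X) i \<noteq> 0" and m: "m < n"
  shows "mop xi ((mop xi ^^ m) v) = 0"
proof -
  have "(mop xi ^^ j) v = 0" if "Suc m \<le> j" "j \<le> n" for j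
    using that(2,1)
  proof (induction j rule: inc_induct)
    case base
    then show ?case using xi_n[OF wtD(1)[OF v]] by simp
  next
    case (step j)
    then obtain i where i: "j = Suc i" by (cases j) auto
    have 0: "(mop xi ^^ j) (mop y (mop xi v)) = 0" using k by (simp add: i funpow_swap1)
    have "beq (lg a) (lc X) j *s (mop xi ^^ j) v = 0"
      using y_xi_pow[OF v, of j] step 0 by simp
    then show ?case using b[of j] step by (simp add: sc_eq_0_iff)
  qed
  from this[of "Suc m"] m show ?thesis by simp
qed

end

text \<open>That \<open>P\<close> is a module is an assumption here; \<open>emb_P\<close> provides
  it from the embedding into the tensor product. The weight \<open>\<nu>\<close> is that of
  w.\<close>

locale pcov = pmod D m lg lc + V: vmod D "nn D - m" \<nu>
  for D :: "('g, 'k::field_char_0) group_datum" and m lg lc \<nu> +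
  assumes P: "dd_module D P"
    and \<nu>g: "\<And>g. g \<in> GG \<Longrightarrow> at_G D \<nu> g = upg m lg g"
    and \<nu>c: "\<And>\<gamma>. \<gamma> \<in> CC \<Longrightarrow> at_Gam D \<nu> \<gamma> = upc m lc \<gamma>"
begin

lemma shift_m: "upg m lg a = lg a * inverse q ^ m" "upc m lc X = lc X * q ^ m"
  by (simp_all add: shift_a)

lemma P_wt: "wtm P lg lc (bas 0)" "wtm P (upg m lg) (upc m lc) (bas n)"
proof -
  interpret P: nilrep D "mdim P" "mg P" "mc P" "act P xi_el" "act P y_term" by (rule dd_module_nilrep[OF P])
  show "P.wt lg lc (bas 0)" "P.wt (upg m lg) (upc m lc) (bas n)"
    unfolding P.wt_def using n2 by (auto simp: P_bas P_deg_def)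
qed

lemma P_kernel: "app P xi_el (app P y_term (app P xi_el (bas n))) = 0"
  using m n2 by (simp add: P_xi_n P_y_bas P_bas)

text \<open>Both sides lie on the line of u, on which y^(m-1) is injective. Comparing images
  identifies the constant as the product that also occurs in the lift, without an identity between
  products of \<open>al\<close> and of \<open>be\<close>.\<close>

lemma P_xi_pow_n: "(app P xi_el ^^ m) (bas n) = (\<Prod>i=1..m - 1. be i) *s bas 0"
proof -
  interpret P: nilrep D "mdim P" "mg P" "mc P" "act P xi_el" "act P y_term" by (rule dd_module_nilrep[OF P])
  have ms: "Suc (m - 1) = m" using m by simp
  have "(app P xi_el ^^ m) (bas n) = (app P xi_el ^^ (m - 1)) (bas (m - 1))"
    using P_xi_n ms by (metis funpow_swap1 funpow.simps(2) o_apply)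
  then obtain K where K: "(app P xi_el ^^ m) (bas n) = K *s bas 0"
    using P_xi_pow[of "m - 1" "m - 1"] m by auto
  have "(app P y_term ^^ (m - 1)) (K *s bas 0) = (\<Prod>i=1..m - 1. be i) *s bas (m - 1)"
    using P.y_pow_xi_pow_kernel[OF P_wt(2) P_kernel, of "m - 1"] unfolding ms K shift_m P_xi_n .
  then have "K *s bas (m - 1) = (\<Prod>i=1..m - 1. be i) *s (bas (m - 1) :: nat \<Rightarrow> 'k)"
    using P_y_pow(1)[of "m - 1"] m by simp
  then have "K * bas (m - 1) (m - 1) = (\<Prod>i=1..m - 1. be i) * bas (m - 1) (m - 1)"
    by (metis sc_apply)
  then show ?thesis using K by (simp add: bas_def)
qed

lemma projective: "dd_projective D P"
  unfolding dd_projective_def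
proof (intro conjI P allI ballI impI)
  fix M N E F
  assume E: "E \<in> dd_hom D M N" and F: "F \<in> dd_hom D P N" and M: "dd_module D M" and N: "dd_module D N"
    and sE: "surj_mat E"
  interpret P: nilrep D "mdim P" "mg P" "mc P" "act P xi_el" "act P y_term" by (rule dd_module_nilrep[OF P])
  interpret M: nilrep D "mdim M" "mg M" "mc M" "act M xi_el" "act M y_term" by (rule dd_module_nilrep[OF M])
  interpret N: nilrep D "mdim N" "mg N" "mc N" "act N xi_el" "act N y_term" by (rule dd_module_nilrep[OF N])
  note pre = dd_module_pre[OF M] dd_module_pre[OF N]
  note homE = dd_hom_app[OF pre(1,2) E] and homF = dd_hom_app[OF P_pre pre(2) F]
  let ?lg = "upg m lg" and ?lc = "upc m lc"
  let ?b = "beq (?lg a) (?lc X)"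
  have be: "?b = be" by (simp add: shift_m)
  define bs where "bs = rev (map ?b [Suc m..<n]) @ rev (map ?b [1..<m])"
  have bs0: "0 \<notin> set bs" using be_nz m by (auto simp: bs_def be One_nat_def Suc_le_eq)
  define n0 where "n0 = mop F (bas n)"
  have n0: "N.wt ?lg ?lc n0" unfolding n0_def by (rule hom_wt[OF P N F P_wt(2)])
  have k0: "app N xi_el (app N y_term (app N xi_el n0)) = 0"
    unfolding n0_def using P_kernel by (simp add: homF[symmetric])
  \<comment> \<open>The division takes place in \<open>N\<close>: any weight vector over
    \<open>n1\<close> yields, after the same product of factors in \<open>M\<close>, a vector over
    \<open>n0\<close> that satisfies the kernel condition.\<close>
  obtain n1 where n1: "N.wt ?lg ?lc n1" "fold N.step bs n1 = n0"
    using N.fold_step_inverse[OF n0 k0 bs0] by blast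
  obtain m' where m': "m' \<in> fsp (mdim M)" "mop E m' = n1"
    using sE surj_mat_mop[OF dd_hom_carrier[OF E]] N.wtD(1)[OF n1(1)] by blast
  define m1 where "m1 = M.wproj ?lg ?lc m'"
  note cwu = charw_up[OF cw, of m]
  have m1: "M.wt ?lg ?lc m1"
    unfolding m1_def by (rule M.wt_wproj) (use charwD[OF cwu] m' in auto)
  have Em1: "mop E m1 = n1"
    unfolding m1_def hom_wproj[OF M N E] m' by (rule N.wproj_wt) (use charwD[OF cwu] n1 in auto)
  define m0 where "m0 = fold M.step bs m1"
  have "mop E (fold M.step bs v) = fold N.step bs (mop E v)" for v
    by (induction bs arbitrary: v) (auto simp: M.step_def N.step_def homE)
  then have Em0: "mop E m0 = n0" using Em1 n1 by (simp add: m0_def)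
  have m0: "M.wt ?lg ?lc m0" unfolding m0_def by (rule M.wt_fold_step[OF m1])
  have km: "app M xi_el (app M y_term (app M xi_el m0)) = 0"
    unfolding m0_def by (rule M.fold_step_kernel[OF m1 m _ bs_def]) (simp add: be)
  define C where "C = (\<Prod>i=1..m - 1. be i)"
  have C: "C \<noteq> 0" unfolding C_def using be_nz m by (auto simp: One_nat_def Suc_le_eq)
  \<comment> \<open>In \<open>P\<close> the vector \<xi>^m w equals C u, so this is the only
    possible image of u.\<close>
  define u where "u = inverse C *s (app M xi_el ^^ m) m0"
  have u: "M.wt lg lc u"
    unfolding u_def
    by (rule M.wt_lin(2), rule M.wt_cong[OF M.wt_xi_pow[OF m0]])
      (auto simp: dng_def dnc_def upg_def upc_def field_simps)
  have xu: "app M xi_el u = 0"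
    unfolding u_def mop_sc
    using M.xi_pow_kernel[OF m0 km, of m] be_nz m by (simp add: be)
  have ms: "Suc (m - 1) = m" using m by simp
  have "(app M y_term ^^ (m - 1)) ((app M xi_el ^^ m) m0) = C *s app M xi_el m0"
    using M.y_pow_xi_pow_kernel[OF m0 km, of "m - 1"] unfolding ms C_def be .
  then have xw: "app M xi_el m0 = (app M y_term ^^ (m - 1)) u"
    using C by (simp add: u_def)
  have nil: "nilpotent_type D \<or> lg a ^ n = 1" by (rule charw_pow_n[OF cw lm])
  have nil': "nilpotent_type D \<or> ?lg a ^ n = 1"
    using nil by (auto simp: shift_a power_mult_distrib power_inverse power_mult[symmetric] mult.commute[of m n] power_mult[of q n])
  obtain H where H: "H \<in> dd_hom D P M" "\<And>i. i < n \<Longrightarrow> mop H (bas i) = (app M y_term ^^ i) u"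
      "\<And>i. i < n \<Longrightarrow> mop H (bas (n + i)) = (app M y_term ^^ i) m0"
    using P_hom[OF M u m0 xu xw module_y_n[OF M u nil] module_y_n[OF M m0 nil']] by blast
  have Fu: "mop E u = mop F (bas 0)"
  proof -
    have "mop E u = inverse C *s (app N xi_el ^^ m) n0"
      by (simp add: u_def hom_pow[OF M N E] Em0)
    also have "(app N xi_el ^^ m) n0 = mop F ((app P xi_el ^^ m) (bas n))"
      by (simp add: n0_def hom_pow[OF P N F])
    also have "\<dots> = C *s mop F (bas 0)" by (simp add: P_xi_pow_n C_def)
    finally show ?thesis using C by simp
  qed
  have c: "E \<in> carrier_mat (mdim N) (mdim M)" "H \<in> carrier_mat (mdim M) (mdim P)" "F \<in> carrier_mat (mdim N) (mdim P)"
    using E F H by (auto dest: dd_hom_carrier)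
  have "E * H = F"
  proof (rule mop_eqI)
    fix j assume "j < mdim P"
    then consider "j < n" | i where "i < n" "j = n + i" by (auto simp: mult_2) (metis add_less_cancel_left le_Suc_ex not_le)
    then have "mop E (mop H (bas j)) = mop F (bas j)"
    proof cases
      case 1
      have "mop F (bas j) = mop F ((app P y_term ^^ j) (bas 0))" using 1 by (simp add: P_y_pow)
      then show ?thesis using 1 by (simp add: H hom_pow[OF M N E] hom_pow[OF P N F] Fu)
    next
      case 2
      have "mop F (bas j) = mop F ((app P y_term ^^ i) (bas n))" using 2 by (simp add: P_y_pow)
      then show ?thesis using 2 by (simp add: H hom_pow[OF M N E] hom_pow[OF P N F] Em0 n0_def)
    qed
    then show "mop (E * H) (bas j) = mop F (bas j)" by (simp add: mop_mult[OF c(1,2)])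
  qed (use c in auto)
  then show "\<exists>H\<in>dd_hom D P M. E * H = F" using H by blast
qed

text \<open>The map sends w to v_0 and kills the string of u. A submodule \<open>I\<close> that
  still surjects contains a weight vector v over v_0. It has the form w + c y^m u, so \<xi>v =
  y^(m-1)u, and \<xi>^(m-1) leads from there to a nonzero multiple of u. Hence \<open>I\<close>
  contains u, then w, then everything.\<close>

lemma cover: "projective_cover D P V.V"
proof -
  interpret P: nilrep D "mdim P" "mg P" "mc P" "act P xi_el" "act P y_term" by (rule dd_module_nilrep[OF P])
  interpret W: nilrep D "mdim V.V" "mg V.V" "mc V.V" "act V.V xi_el" "act V.V y_term" by (rule dd_module_nilrep[OF V.V_module])
  let ?lg = "upg m lg" and ?lc = "upc m lc"
  have L0: "0 < n - m" using m by simp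
  have b0: "W.wt ?lg ?lc (bas 0)"
    unfolding W.wt_def using L0 by (auto simp: V.V_bas \<nu>g \<nu>c)
  have y_pow: "(app V.V y_term ^^ k) (bas 0) = (if k < n - m then bas k else 0)" for k
    using L0 by (induction k) (auto simp: V.V_y V.V_bas)
  have "\<exists>E\<in>dd_hom D P V.V. (\<forall>i<n. mop E (bas i) = (app V.V y_term ^^ i) 0) \<and>
      (\<forall>i<n. mop E (bas (n + i)) = (app V.V y_term ^^ i) (bas 0))"
    by (rule P_hom[OF V.V_module W.wt_lin(3) b0]) (use L0 in \<open>auto simp: V.V_bas y_pow\<close>)
  then obtain E where E: "E \<in> dd_hom D P V.V" "\<And>i. i < n \<Longrightarrow> mop E (bas i) = 0"
      "\<And>i. i < n \<Longrightarrow> mop E (bas (n + i)) = (if i < n - m then bas i else 0)"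
    by (auto simp: y_pow)
  note cE = dd_hom_carrier[OF E(1)]
  have sE: "surj_mat E"
    unfolding surj_mat_mop[OF cE]
  proof
    fix g :: "nat \<Rightarrow> 'k" assume "g \<in> fsp (mdim V.V)"
    then have g: "g \<in> fsp (n - m)" by simp
    have "mop E (\<Sum>j<n - m. g j *s bas (n + j)) = (\<Sum>j<n - m. g j *s bas j)"
      by (simp add: E)
    then have "mop E (\<Sum>j<n - m. g j *s bas (n + j)) = g" using fsp_expand[OF g] by simp
    moreover have "(\<Sum>j<n - m. g j *s bas (n + j)) \<in> fsp (mdim P)" by (rule fsp_sum) auto
    ultimately show "\<exists>f\<in>fsp (mdim P). mop E f = g" by blast
  qed
  have "surj_mat F" if F: "F \<in> dd_hom D M P" and M: "dd_module D M" and sEF: "surj_mat (E * F)" for M F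
  proof -
    interpret M: nilrep D "mdim M" "mg M" "mc M" "act M xi_el" "act M y_term" by (rule dd_module_nilrep[OF M])
    note cF = dd_hom_carrier[OF F]
    note homF = dd_hom_app[OF dd_module_pre[OF M] P_pre F]
    define I where "I = mop F ` fsp (mdim M)"
    have I_add: "v + w \<in> I" if "v \<in> I" "w \<in> I" for v w
    proof -
      from that(1) obtain f where "f \<in> fsp (mdim M)" "v = mop F f" unfolding I_def by (elim imageE)
      moreover from that(2) obtain g where "g \<in> fsp (mdim M)" "w = mop F g" unfolding I_def by (elim imageE)
      ultimately show ?thesis unfolding I_def by (intro image_eqI[of _ _ "f + g"]) simp_all
    qed
    have I_sc: "c *s v \<in> I" if "v \<in> I" for c v
    proof -
      from that obtain f where "f \<in> fsp (mdim M)" "v = mop F f" unfolding I_def by (elim imageE)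
      then show ?thesis unfolding I_def by (intro image_eqI[of _ _ "c *s f"]) simp_all
    qed
    have I_app: "app P t v \<in> I" if "v \<in> I" "t \<in> dd_terms D" for t v
    proof -
      from that(1) obtain f where "f \<in> fsp (mdim M)" "v = mop F f" unfolding I_def by (elim imageE)
      then show ?thesis unfolding I_def using app_fsp[OF dd_module_pre[OF M] that(2), of f] that(2)
        by (intro image_eqI[of _ _ "app M t f"]) (simp_all add: homF)
    qed
    have I_pow: "(app P t ^^ k) v \<in> I" if "v \<in> I" "t \<in> dd_terms D" for t v k
      by (induction k) (use that I_app in auto)
    have "\<exists>f\<in>fsp (mdim M). mop (E * F) f = bas 0"
      using sEF surj_mat_mop[of "E * F" "mdim V.V" "mdim M"] cE cF L0 by auto
    then obtain m0 where m0: "m0 \<in> fsp (mdim M)" "mop E (mop F m0) = bas 0"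
      using mop_mult[OF cE cF] by auto
    define m1 where "m1 = M.wproj ?lg ?lc m0"
    note cwu = charw_up[OF cw, of m]
    have m1: "M.wt ?lg ?lc m1"
      unfolding m1_def by (rule M.wt_wproj) (use charwD[OF cwu] m0 in auto)
    define v where "v = mop F m1"
    have v: "P.wt ?lg ?lc v" unfolding v_def by (rule hom_wt[OF M P F m1])
    have Ev: "mop E v = bas 0"
      unfolding v_def m1_def hom_wproj[OF M P F] hom_wproj[OF P V.V_module E(1)] m0(2)
      by (rule W.wproj_wt) (use charwD[OF cwu] b0 in auto)
    have vI: "v \<in> I" unfolding v_def I_def using M.wtD(1)[OF m1] by blast
    have vd: "v \<in> fsp (2 * n)" using P.wtD(1)[OF v] by simp
    \<comment> \<open>The eigenvalue of a alone determines \<open>P_deg\<close> modulo n, and only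
      the indices m and n have degree m modulo n.\<close>
    have v0: "v i = 0" if "i \<noteq> m" "i \<noteq> n" for i
    proof (cases "i < 2 * n")
      case True
      have cP: "act P (g_el a) \<in> carrier_mat (2 * n) (2 * n)" using pre_carrier[OF P_pre, of "g_el a"] by simp
      have "app P (g_el a) v i = (\<Sum>j<2 * n. v j * (upg (P_deg m j) lg a * bas j i))"
        unfolding mop_expand[OF cP, of v] by (simp add: sum_fun_apply ptw P_bas mult.assoc)
      also have "\<dots> = (\<Sum>j<2 * n. if j = i then v i * upg (P_deg m i) lg a else 0)"
        by (rule sum.cong) (auto simp: bas_def)
      finally have "v i * upg (P_deg m i) lg a = upg m lg a * v i"
        using True P.wtD(2)[OF v closed(1)] by (auto simp: ptw)
      then have e: "v i = 0 \<or> q ^ P_deg m i = q ^ m"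
        using charwD(1)[OF cw closed(1)] by (auto simp: shift_a field_simps)
      have "q ^ P_deg m i \<noteq> q ^ m"
      proof (cases "i < n")
        case True
        then show ?thesis using q_pow_inj[of i m] m that by (auto simp: P_deg_def)
      next
        case False
        then have "0 < i - n" "i - n < n" using True that by auto
        then have "q ^ (i - n) \<noteq> 1" by (rule q_pow_neq_1)
        moreover have "P_deg m i = m + (i - n)" using False by (simp add: P_deg_def)
        ultimately show ?thesis by (simp only: power_add) simp
      qed
      then show ?thesis using e by simp
    qed (use vd in \<open>auto simp: fsp_def\<close>)
    have vv: "v = v m *s bas m + v n *s bas n"
      using m v0 by (auto simp: fun_eq_iff ptw bas_def)
    have "mop E (v m *s bas m + v n *s bas n) = bas 0" using Ev vv by simp
    then have "v n *s bas 0 = (bas 0 :: nat \<Rightarrow> 'k)"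
      using m E(2)[of m] E(3)[of 0] L0 by simp
    then have vn: "v n = 1" by (auto simp: fun_eq_iff ptw bas_def split: if_splits)
    have "app P xi_el v = bas (m - 1)"
      by (subst vv) (use m in \<open>simp add: vn P_xi_n P_bas\<close>)
    then have bm: "bas (m - 1) \<in> I" using I_app[OF vI, of xi_el] by simp
    define K where "K = (\<Prod>i<m - 1. al (m - 1 - i))"
    have "al (m - 1 - i) \<noteq> 0" if "i < m - 1" for i
      by (rule al_nz) (use that m in linarith)+
    then have K: "K \<noteq> 0" by (simp add: K_def)
    have "(app P xi_el ^^ (m - 1)) (bas (m - 1)) = K *s bas 0"
      using P_xi_pow[of "m - 1" "m - 1"] m by (simp add: K_def)
    then have "K *s bas 0 \<in> I" using I_pow[OF bm, of xi_el "m - 1"] by simp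
    then have "inverse K *s K *s bas 0 \<in> I" by (rule I_sc)
    then have u0: "bas 0 \<in> I" using K by simp
    have ui: "bas i \<in> I" if "i < n" for i
      using I_pow[OF u0, of y_term i] P_y_pow(1)[OF that] by simp
    have "bas n = v + (- v m) *s bas m" by (subst vv) (simp add: vn sc_distrib fun_eq_iff ptw)
    then have w0: "bas n \<in> I" using I_add[OF vI I_sc[OF ui[OF m(2)], of "- v m"]] by simp
    have wi: "bas (n + i) \<in> I" if "i < n" for i
      using I_pow[OF w0, of y_term i] P_y_pow(2)[OF that] by simp
    have bI: "bas i \<in> I" if "i < 2 * n" for i
      using ui[of i] wi[of "i - n"] that by (cases "i < n") auto
    show "surj_mat F"
      unfolding surj_mat_mop[OF cF]
    proof
      fix g :: "nat \<Rightarrow> 'k" assume "g \<in> fsp (mdim P)"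
      then have g: "g \<in> fsp (2 * n)" by simp
      have "(\<Sum>j\<in>S. g j *s bas j) \<in> I" if "S \<subseteq> {..<2 * n}" for S
        using that
      proof (induction S rule: infinite_finite_induct)
        case empty
        have "mop F 0 \<in> I" unfolding I_def by blast
        then show ?case by simp
      next
        case (insert j S)
        then show ?case using I_add I_sc bI by auto
      qed (auto dest: finite_subset)
      from this[of "{..<2 * n}"] have "g \<in> I" unfolding fsp_expand[OF g, symmetric] by blast
      then show "\<exists>f\<in>fsp (mdim M). mop F f = g" by (auto simp: I_def)
    qed
  qed
  then show ?thesis using projective V.V_module E(1) sE by (auto simp: projective_cover_def)
qed

end

section \<open>A quantum binomial formula\<close>

text \<open>A q-Leibniz rule: the commutator can occur at r + 1 places, and moving A and H to the
  front, at the cost of powers of 1/q and of q, produces geometric sums.\<close>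

lemma (in datum) commutator_pow:
  assumes c: "U \<in> carrier_mat N N" "Q \<in> carrier_mat N N" "A \<in> carrier_mat N N" "H \<in> carrier_mat N N"
    and v: "v \<in> fsp N"
    and QU: "\<And>v. v \<in> fsp N \<Longrightarrow> mop Q (mop U v) = mop U (mop Q v) + (mop A v - mop H v)"
    and UA: "\<And>v. v \<in> fsp N \<Longrightarrow> mop U (mop A v) = inverse q *s mop A (mop U v)"
    and UH: "\<And>v. v \<in> fsp N \<Longrightarrow> mop U (mop H v) = q *s mop H (mop U v)"
  shows "mop Q ((mop U ^^ Suc r) v) = (mop U ^^ Suc r) (mop Q v) +
    ((qnum q (Suc r) * inverse q ^ r) *s mop A ((mop U ^^ r) v) - qnum q (Suc r) *s mop H ((mop U ^^ r) v))"
proof (induction r)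
  case (Suc r)
  let ?u = "(mop U ^^ Suc r) v"
  note f = funpow_fsp[OF c(1) v]
  have "mop Q (mop U ?u) = mop U (mop Q ?u) + (mop A ?u - mop H ?u)" by (rule QU[OF f])
  also have "mop U (mop Q ?u) = (mop U ^^ Suc (Suc r)) (mop Q v) +
    ((qnum q (Suc r) * inverse q ^ r * inverse q) *s mop A ?u - (qnum q (Suc r) * q) *s mop H ?u)"
    unfolding Suc using UA[OF f, of r] UH[OF f, of r] by (simp del: qnum_simps)
  finally have 1: "mop Q (mop U ?u) = (mop U ^^ Suc (Suc r)) (mop Q v) +
    ((1 + qnum q (Suc r) * inverse q ^ r * inverse q) *s mop A ?u - (1 + qnum q (Suc r) * q) *s mop H ?u)"
    by (simp only: sc_distrib sc_simps) (simp add: algebra_simps)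
  have 2: "1 + qnum q (Suc r) * q = qnum q (Suc (Suc r))" by (simp only: qnum_Suc'[of q "Suc r"] mult.commute)
  have 3: "1 + qnum q (Suc r) * inverse q ^ r * inverse q = qnum q (Suc (Suc r)) * inverse q ^ Suc r"
    unfolding qnum_simps(2)[of q "Suc r"] by (simp add: field_simps del: qnum_simps)
  show ?case using 1 unfolding 2 3 by simp
qed (use v QU in \<open>simp add: One_nat_def\<close>)

text \<open>Applied to the two summands of the coproduct of \<xi>, and in \<open>xM_n\<close> to
  those of x in the opposite order.\<close>

locale qbinom = datum D for D :: "('g, 'k::field_char_0) group_datum" +
  fixes N :: nat and U W :: "'k mat"
  assumes U_c: "U \<in> carrier_mat N N" and W_c: "W \<in> carrier_mat N N"
    and UW: "v \<in> fsp N \<Longrightarrow> mop U (mop W v) = q *s mop W (mop U v)"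
    and U_n: "v \<in> fsp N \<Longrightarrow> (mop U ^^ n) v = 0"
    and W_n: "v \<in> fsp N \<Longrightarrow> (mop W ^^ n) v = 0"
begin

lemma UW_fsp [simp, intro]: "mop U v \<in> fsp N" "mop W v \<in> fsp N"
    "v \<in> fsp N \<Longrightarrow> (mop U ^^ k) v \<in> fsp N" "v \<in> fsp N \<Longrightarrow> (mop W ^^ k) v \<in> fsp N"
  using mop_fsp[OF U_c] mop_fsp[OF W_c] funpow_fsp[OF U_c] funpow_fsp[OF W_c] by auto

text \<open>The quantum divided power \<open>(U + W)\<^sup>k / (k)!\<close>. As \<open>(n)! = 0\<close> and \<open>inverse 0 = 0\<close>, the terms with
  \<open>p = 0\<close> and \<open>p = n\<close> are absent for \<open>k = n\<close>.\<close>

definition cf :: "nat \<Rightarrow> nat \<Rightarrow> 'k" where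
  "cf p r = inverse (qfact q p * qfact q r)"

definition dvp :: "nat \<Rightarrow> (nat \<Rightarrow> 'k) \<Rightarrow> nat \<Rightarrow> 'k" where
  "dvp k v = (\<Sum>p\<le>k. cf p (k - p) *s (mop W ^^ p) ((mop U ^^ (k - p)) v))"

lemma cf_n [simp]: "cf n r = 0" "cf p n = 0"
  by (simp_all add: cf_def)

lemma dvp_fsp [simp, intro]: "v \<in> fsp N \<Longrightarrow> dvp k v \<in> fsp N"
  unfolding dvp_def by (rule fsp_sum) auto

lemma dvp_0 [simp]: "dvp 0 v = v"
  by (simp add: dvp_def cf_def)

lemma dvp_lin [simp]: "dvp k (v + w) = dvp k v + dvp k w" "dvp k (c *s v) = c *s dvp k v"
  by (simp_all add: dvp_def sc_distrib sum.distrib mult.commute)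

lemma U_W_pow: "v \<in> fsp N \<Longrightarrow> mop U ((mop W ^^ s) v) = q ^ s *s (mop W ^^ s) (mop U v)"
  by (induction s) (simp_all add: UW mult.commute)

lemma U_pow_W: "v \<in> fsp N \<Longrightarrow> (mop U ^^ r) (mop W v) = q ^ r *s mop W ((mop U ^^ r) v)"
  by (induction r) (simp_all add: UW mult.commute)

lemma U_pow_W_pow: "v \<in> fsp N \<Longrightarrow> (mop U ^^ r) ((mop W ^^ s) v) = q ^ (r * s) *s (mop W ^^ s) ((mop U ^^ r) v)"
  by (induction s) (simp_all add: U_pow_W power_add mult.commute)

lemma U_n': "v \<in> fsp N \<Longrightarrow> n \<le> k \<Longrightarrow> (mop U ^^ k) v = 0"
  using U_n[of v] by (subst le_add_diff_inverse2[symmetric, of n k]) (simp_all only: funpow_add o_apply funpow_mop_lin)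

lemma W_n': "v \<in> fsp N \<Longrightarrow> n \<le> k \<Longrightarrow> (mop W ^^ k) v = 0"
  using W_n[of v] by (subst le_add_diff_inverse2[symmetric, of n k]) (simp_all only: funpow_add o_apply funpow_mop_lin)

text \<open>The two q-Pascal rules in divided form, from (p+r) = (p) + q^p (r) = (r) + q^r
  (p).\<close>

lemma cf_rec:
  assumes "0 < p" "0 < r" "p < n" "r < n"
  shows "q ^ p * cf p (r - 1) + cf (p - 1) r = qnum q (p + r) * cf p r"
    "cf p (r - 1) + q ^ r * cf (p - 1) r = qnum q (p + r) * cf p r"
    "qnum q r * cf p r = cf p (r - 1)" "qnum q p * cf p r = cf (p - 1) r"
proof -
  obtain i j where ij: "p = Suc i" "r = Suc j" using assms by (metis not0_implies_Suc less_numeral_extra(3))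
  have "i < n" "j < n" using assms by (auto simp: ij)
  then have nz: "qfact q i \<noteq> 0" "qfact q j \<noteq> 0" "qnum q p \<noteq> 0" "qnum q r \<noteq> 0"
    using assms by (simp_all only: qfact_nz qnum_nz not_False_eq_True)
  have f: "qfact q p = qfact q i * qnum q p" "qfact q r = qfact q j * qnum q r"
    by (simp_all only: ij qfact_simps qnum_simps)
  have c: "cf p (r - 1) = qnum q r * cf p r" "cf (p - 1) r = qnum q p * cf p r"
    using nz by (simp_all only: cf_def f) (simp_all add: ij cf_def)
  then show "qnum q r * cf p r = cf p (r - 1)" "qnum q p * cf p r = cf (p - 1) r" by simp_all
  show "q ^ p * cf p (r - 1) + cf (p - 1) r = qnum q (p + r) * cf p r"
    unfolding c qnum_add by (simp only: ring_distribs mult_ac add_ac)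
  show "cf p (r - 1) + q ^ r * cf (p - 1) r = qnum q (p + r) * cf p r"
    unfolding c add.commute[of p] qnum_add by (simp only: ring_distribs mult_ac)
qed

lemma UW_dvp:
  assumes v: "v \<in> fsp N"
  shows "mop U (dvp k v) + mop W (dvp k v) = (\<Sum>p\<le>Suc k.
    ((if p \<le> k then q ^ p * cf p (k - p) else 0) + (if 0 < p then cf (p - 1) (Suc k - p) else 0))
     *s (mop W ^^ p) ((mop U ^^ (Suc k - p)) v))"
proof -
  let ?M = "\<lambda>p. (mop W ^^ p) ((mop U ^^ (Suc k - p)) v)"
  have "mop U (dvp k v) = (\<Sum>p\<le>k. (q ^ p * cf p (k - p)) *s ?M p)"
    unfolding dvp_def mop_sum by (rule sum.cong) (use v in \<open>auto simp: U_W_pow Suc_diff_le mult.commute\<close>)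
  also have "\<dots> = (\<Sum>p\<le>Suc k. (if p \<le> k then q ^ p * cf p (k - p) else 0) *s ?M p)" by simp
  finally have 1: "mop U (dvp k v) = \<dots>" .
  have "mop W (dvp k v) = (\<Sum>p\<le>k. cf p (k - p) *s ?M (Suc p))"
    unfolding dvp_def mop_sum by simp
  also have "\<dots> = (\<Sum>p\<le>Suc k. (if 0 < p then cf (p - 1) (Suc k - p) else 0) *s ?M p)"
    unfolding sum.atMost_Suc_shift by simp
  finally have 2: "mop W (dvp k v) = \<dots>" .
  show ?thesis unfolding 1 2 sum.distrib[symmetric] sc_distrib(2) ..
qed

text \<open>For \<open>Suc k = n\<close> the factor (n) is 0, and the terms with p = 0 or p = n
  escape the Pascal rule; there U^n = W^n = 0 takes over.\<close>

lemma UW_dvp_Suc: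
  assumes v: "v \<in> fsp N" and k: "k < n"
  shows "mop U (dvp k v) + mop W (dvp k v) = qnum q (Suc k) *s dvp (Suc k) v"
  unfolding UW_dvp[OF v] dvp_def[of "Suc k"] sc_distrib(6)
proof (rule sum.cong[OF HOL.refl])
  fix p assume "p \<in> {..Suc k}"
  then consider "p = 0" | "p = Suc k" | "0 < p" "p < Suc k" by fastforce
  then show "((if p \<le> k then q ^ p * cf p (k - p) else 0) + (if 0 < p then cf (p - 1) (Suc k - p) else 0))
     *s (mop W ^^ p) ((mop U ^^ (Suc k - p)) v) =
     qnum q (Suc k) *s cf p (Suc k - p) *s (mop W ^^ p) ((mop U ^^ (Suc k - p)) v)" (is "?c *s ?M = _")
  proof cases
    case 1
    show ?thesis
    proof (cases "Suc k < n")
      case True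
      then have "cf 0 k = qnum q (Suc k) * cf 0 (Suc k)"
        using qnum_nz[of "Suc k"] by (simp add: cf_def)
      then show ?thesis using 1 by simp
    next
      case False
      then have "(mop U ^^ Suc k) v = 0" by (intro U_n'[OF v]) simp
      then show ?thesis using 1 by simp
    qed
  next
    case 2
    show ?thesis
    proof (cases "Suc k < n")
      case True
      then have "cf k 0 = qnum q (Suc k) * cf (Suc k) 0"
        using qnum_nz[of "Suc k"] by (simp add: cf_def)
      then show ?thesis using 2 by simp
    next
      case False
      then have "(mop W ^^ Suc k) v = 0" by (intro W_n'[OF v]) simp
      then show ?thesis using 2 by simp
    qed
  next
    case 3
    then have "0 < Suc k - p" "p < n" "Suc k - p < n" "Suc k - p - 1 = k - p" "p + (Suc k - p) = Suc k" using k by auto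
    with cf_rec(1)[of p "Suc k - p"] 3 have "?c = qnum q (Suc k) * cf p (Suc k - p)" by simp
    then show ?thesis by simp
  qed
qed

lemma UW_pow:
  assumes v: "v \<in> fsp N" and s: "\<And>v. v \<in> fsp N \<Longrightarrow> mop S v = mop U v + mop W v" and k: "k < n"
  shows "(mop S ^^ k) v = qfact q k *s dvp k v"
  using k
proof (induction k)
  case (Suc k)
  have "(mop S ^^ Suc k) v = qfact q k *s (mop U (dvp k v) + mop W (dvp k v))"
    using Suc v by (simp add: s)
  then show ?case using Suc.prems UW_dvp_Suc[OF v, of k] by simp
qed simp

text \<open>The last step from (U + W)^(n-1) produces the factor (n) = 0.\<close>

lemma UW_pow_n:
  assumes v: "v \<in> fsp N" and s: "\<And>v. v \<in> fsp N \<Longrightarrow> mop S v = mop U v + mop W v"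
  shows "(mop S ^^ n) v = 0"
proof -
  have n: "Suc (n - 1) = n" "n - 1 < n" using n2 by auto
  have "(mop S ^^ n) v = mop S ((mop S ^^ (n - 1)) v)" by (subst n(1)[symmetric]) simp
  also have "\<dots> = qfact q (n - 1) *s (mop U (dvp (n - 1) v) + mop W (dvp (n - 1) v))"
    using v by (simp add: UW_pow[OF v s n(2)] s)
  finally show ?thesis using UW_dvp_Suc[OF v n(2)] n(1) by simp
qed

text \<open>In total degree n + 1 the monomials with p \<le> 1 or p \<ge> n contain U^n or W^n and
  vanish; for the others the two Pascal rules give the same coefficient on both sides.\<close>

lemma dvp_n_comm:
  assumes v: "v \<in> fsp N"
  shows "mop U (dvp n v) + mop W (dvp n v) = dvp n (mop U v + mop W v)"
proof -
  let ?M = "\<lambda>p. (mop W ^^ p) ((mop U ^^ (Suc n - p)) v)"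
  have "dvp n (mop U v) = (\<Sum>p\<le>n. cf p (n - p) *s ?M p)"
    unfolding dvp_def by (rule sum.cong) (auto simp: Suc_diff_le funpow_swap1)
  also have "\<dots> = (\<Sum>p\<le>Suc n. (if p \<le> n then cf p (n - p) else 0) *s ?M p)" by simp
  finally have 1: "dvp n (mop U v) = \<dots>" .
  have "dvp n (mop W v) = (\<Sum>p\<le>n. (cf p (n - p) * q ^ (n - p)) *s ?M (Suc p))"
    unfolding dvp_def by (rule sum.cong) (use v in \<open>auto simp: U_pow_W funpow_swap1\<close>)
  also have "\<dots> = (\<Sum>p\<le>Suc n. (if 0 < p then cf (p - 1) (Suc n - p) * q ^ (Suc n - p) else 0) *s ?M p)"
    unfolding sum.atMost_Suc_shift by simp
  finally have 2: "dvp n (mop W v) = \<dots>" .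
  show ?thesis
    unfolding dvp_lin 1 2 sum.distrib[symmetric] sc_distrib(2)[symmetric] UW_dvp[OF v]
  proof (rule sum.cong[OF HOL.refl])
    fix p assume "p \<in> {..Suc n}"
    then have "p \<le> 1 \<or> n \<le> p \<or> (1 < p \<and> p < n)" by auto
    then show "((if p \<le> n then q ^ p * cf p (n - p) else 0) + (if 0 < p then cf (p - 1) (Suc n - p) else 0)) *s ?M p =
      ((if p \<le> n then cf p (n - p) else 0) + (if 0 < p then cf (p - 1) (Suc n - p) * q ^ (Suc n - p) else 0)) *s ?M p"
      (is "?c *s _ = ?c' *s _")
    proof (elim disjE)
      assume "p \<le> 1"
      then have "?M p = 0" using U_n'[OF v, of "Suc n - p"] by simp
      then show ?thesis by simp
    next
      assume "n \<le> p"
      then have "?M p = 0" using W_n'[of "(mop U ^^ (Suc n - p)) v" p] v by simp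
      then show ?thesis by simp
    next
      assume p: "1 < p \<and> p < n"
      then have "0 < p" "0 < Suc n - p" "p < n" "Suc n - p < n" "Suc n - p - 1 = n - p" by auto
      with cf_rec(1,2)[of p "Suc n - p"] have "?c = ?c'" using p by (simp add: mult.commute)
      then show ?thesis by simp
    qed
  qed
qed

text \<open>In total degree at least 2n - 1 each monomial has exponent at least n in U or in W. In
  particular Z^2 = 0, and Z kills the image of the divided power of index n - 1.\<close>

lemma dvp_dvp:
  assumes v: "v \<in> fsp N" and jk: "2 * n \<le> Suc (j + k)"
  shows "dvp j (dvp k v) = 0"
proof -
  have "(mop W ^^ p) ((mop U ^^ (j - p)) ((mop W ^^ p') ((mop U ^^ (k - p')) v))) = 0"
    if "p \<le> j" "p' \<le> k" for p p'
  proof -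
    have "(mop W ^^ p) ((mop U ^^ (j - p)) ((mop W ^^ p') ((mop U ^^ (k - p')) v))) =
        q ^ ((j - p) * p') *s (mop W ^^ (p + p')) ((mop U ^^ (j - p + (k - p'))) v)"
      using v by (simp add: U_pow_W_pow funpow_add)
    moreover have "n \<le> p + p' \<or> n \<le> j - p + (k - p')" using that jk by linarith
    ultimately show ?thesis using U_n'[OF v] W_n'[of "(mop U ^^ (j - p + (k - p'))) v"] v by auto
  qed
  moreover have "(mop A ^^ i) (sum f S) = (\<Sum>s\<in>S. (mop A ^^ i) (f s))" for A :: "'k mat" and i f and S :: "nat set"
    by (induction i) auto
  ultimately show ?thesis by (auto simp: dvp_def intro!: sum.neutral)
qed

text \<open>Commutators with an operator \<open>Q\<^sub>1 + Q\<^sub>2\<close> such that \<open>[Q\<^sub>1, U] = A - H\<close> and \<open>[Q\<^sub>2, W] = H - C\<close>: the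
  contributions of \<open>H\<close> cancel.\<close>

lemma dvp_commutator:
  assumes v: "v \<in> fsp N"
    and c': "Q1 \<in> carrier_mat N N" "Q2 \<in> carrier_mat N N" "A \<in> carrier_mat N N" "H \<in> carrier_mat N N" "C \<in> carrier_mat N N"
    and Q1W: "\<And>v. v \<in> fsp N \<Longrightarrow> mop Q1 (mop W v) = mop W (mop Q1 v)"
    and Q2U: "\<And>v. v \<in> fsp N \<Longrightarrow> mop Q2 (mop U v) = mop U (mop Q2 v)"
    and Q1U: "\<And>v. v \<in> fsp N \<Longrightarrow> mop Q1 (mop U v) = mop U (mop Q1 v) + (mop A v - mop H v)"
    and Q2W: "\<And>v. v \<in> fsp N \<Longrightarrow> mop Q2 (mop W v) = mop W (mop Q2 v) + (mop H v - mop C v)"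
    and UA: "\<And>v. v \<in> fsp N \<Longrightarrow> mop U (mop A v) = inverse q *s mop A (mop U v)"
    and UH: "\<And>v. v \<in> fsp N \<Longrightarrow> mop U (mop H v) = q *s mop H (mop U v)"
    and WA: "\<And>v. v \<in> fsp N \<Longrightarrow> mop W (mop A v) = inverse q *s mop A (mop W v)"
    and WH: "\<And>v. v \<in> fsp N \<Longrightarrow> mop W (mop H v) = inverse q *s mop H (mop W v)"
    and WC: "\<And>v. v \<in> fsp N \<Longrightarrow> mop W (mop C v) = q *s mop C (mop W v)"
    and U1: "(mop U ^^ (n - 1)) v = 0" and W1: "\<And>v. v \<in> fsp N \<Longrightarrow> (mop W ^^ (n - 1)) v = 0"
  shows "mop Q1 (dvp n v) + mop Q2 (dvp n v) =
    dvp n (mop Q1 v + mop Q2 v) + (q *s mop A (dvp (n - 1) v) - mop C (dvp (n - 1) v))"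
proof -
  note [simp] = mop_fsp[OF c'(1)] mop_fsp[OF c'(2)] mop_fsp[OF c'(3)] mop_fsp[OF c'(4)] mop_fsp[OF c'(5)]
  have W: "(mop W ^^ p) (mop A v) = inverse q ^ p *s mop A ((mop W ^^ p) v) \<and>
      (mop W ^^ p) (mop H v) = inverse q ^ p *s mop H ((mop W ^^ p) v) \<and>
      mop Q1 ((mop W ^^ p) v) = (mop W ^^ p) (mop Q1 v) \<and>
      mop Q2 ((mop U ^^ p) v) = (mop U ^^ p) (mop Q2 v)" if "v \<in> fsp N" for p v
    by (induction p) (use that in \<open>simp_all add: WA WH Q1W Q2U mult.commute\<close>)
  note W = W[THEN conjunct1] W[THEN conjunct2, THEN conjunct1]
    W[THEN conjunct2, THEN conjunct2, THEN conjunct1] W[THEN conjunct2, THEN conjunct2, THEN conjunct2]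
  let ?M = "\<lambda>p. (mop W ^^ p) ((mop U ^^ (n - 1 - p)) v)"
  \<comment> \<open>\<open>?f p\<close> is the contribution of Q1 at p and \<open>?g p\<close> that
    of Q2 at p + 1 to the same monomial \<open>?M p\<close>; this shift of index makes their H-parts
    opposite.\<close>
  let ?f = "\<lambda>p. cf p (n - 1 - p) *s (q *s mop A (?M p) - inverse q ^ p *s mop H (?M p))"
  let ?g = "\<lambda>p. cf p (n - 1 - p) *s (inverse q ^ p *s mop H (?M p) - mop C (?M p))"
  define F where "F p = cf p (n - p) *s ((mop W ^^ p) (mop Q1 ((mop U ^^ (n - p)) v)) -
    (mop W ^^ p) ((mop U ^^ (n - p)) (mop Q1 v)))" for p
  define G where "G p = cf p (n - p) *s (mop Q2 ((mop W ^^ p) ((mop U ^^ (n - p)) v)) -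
    (mop W ^^ p) ((mop U ^^ (n - p)) (mop Q2 v)))" for p
  \<comment> \<open>Coefficients with an index n are 0 by convention, so at p = 0 and p = n - 1 the
    formulas hold because U^(n-1)v and W^(n-1) vanish.\<close>
  have M0: "?M 0 = 0" using U1 by simp
  have Mn: "?M (n - 1) = 0" using W1[of "(mop U ^^ (n - 1 - (n - 1))) v"] v by simp
  \<comment> \<open>This makes the coefficient of A independent of p: the powers of 1/q with
    exponents r and p, r + p = n - 1, multiply to q.\<close>
  have qn: "inverse q ^ (n - 1) = q"
    using n2 q_n by (metis One_nat_def Suc_pred inverse_unique less_le_trans mult.commute pos2 power_Suc power_inverse)
  have Ff: "F p = ?f p" if p: "p < n" for p
  proof (cases p)
    case 0
    then show ?thesis using M0 by (simp add: F_def)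
  next
    case (Suc i)
    then obtain r where r: "n - p = Suc r" "n - 1 - p = r" "r + p = n - 1" using p by (intro that[of "n - 1 - p"]) auto
    have c: "qnum q (Suc r) * cf p (Suc r) = cf p r"
      using cf_rec(3)[of p "Suc r"] p Suc r by simp
    have "mop Q1 ((mop U ^^ Suc r) v) - (mop U ^^ Suc r) (mop Q1 v) =
        (qnum q (Suc r) * inverse q ^ r) *s mop A ((mop U ^^ r) v) - qnum q (Suc r) *s mop H ((mop U ^^ r) v)"
      using commutator_pow[OF U_c c'(1,3,4) v Q1U UA UH, of r] by (simp only: add_diff_cancel_left')
    then have "F p = cf p (Suc r) *s (mop W ^^ p) ((qnum q (Suc r) * inverse q ^ r) *s mop A ((mop U ^^ r) v)
        - qnum q (Suc r) *s mop H ((mop U ^^ r) v))"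
      unfolding F_def r(1) funpow_mop_lin(2)[symmetric] by (rule arg_cong)
    also have "\<dots> = (qnum q (Suc r) * cf p (Suc r)) *s ((inverse q ^ r * inverse q ^ p) *s mop A (?M p)
        - inverse q ^ p *s mop H (?M p))"
      using v by (simp add: W r(2) sc_distrib(3) mult_ac del: qnum_simps diff_diff_left)
    finally show ?thesis unfolding c power_add[symmetric] r(3) qn r(2) .
  qed
  have Gg: "G (Suc p) = ?g p" if p: "p < n" for p
  proof (cases "Suc p = n")
    case True
    then have "p = n - 1" by simp
    then show ?thesis using Mn True by (simp add: G_def)
  next
    case False
    then have r: "n - 1 - p = n - Suc p" "0 < n - Suc p" "Suc p < n" using p by auto
    have c: "qnum q (Suc p) * cf (Suc p) (n - Suc p) = cf p (n - Suc p)"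
      using cf_rec(4)[of "Suc p" "n - Suc p"] r by simp
    let ?u = "(mop U ^^ (n - Suc p)) v"
    have u: "?u \<in> fsp N" using v by simp
    have "mop Q2 ((mop W ^^ Suc p) ?u) = (mop W ^^ Suc p) (mop Q2 ?u) +
        ((qnum q (Suc p) * inverse q ^ p) *s mop H ((mop W ^^ p) ?u) - qnum q (Suc p) *s mop C ((mop W ^^ p) ?u))"
      by (rule commutator_pow[OF W_c c'(2,4,5) u Q2W WH WC])
    then have "mop Q2 ((mop W ^^ Suc p) ?u) - (mop W ^^ Suc p) ((mop U ^^ (n - Suc p)) (mop Q2 v)) =
        (qnum q (Suc p) * inverse q ^ p) *s mop H ((mop W ^^ p) ?u) - qnum q (Suc p) *s mop C ((mop W ^^ p) ?u)"
      unfolding W(4)[OF v] by (simp only: add_diff_cancel_left')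
    then have "G (Suc p) = cf (Suc p) (n - Suc p) *s ((qnum q (Suc p) * inverse q ^ p) *s mop H ((mop W ^^ p) ?u)
        - qnum q (Suc p) *s mop C ((mop W ^^ p) ?u))"
      unfolding G_def by (rule arg_cong)
    also have "\<dots> = (qnum q (Suc p) * cf (Suc p) (n - Suc p)) *s (inverse q ^ p *s mop H ((mop W ^^ p) ?u) - mop C ((mop W ^^ p) ?u))"
      by (simp add: sc_distrib(3) mult_ac del: qnum_simps)
    finally show ?thesis unfolding c r(1) .
  qed
  have 1: "mop Q1 (dvp n v) = dvp n (mop Q1 v) + (\<Sum>p\<le>n. F p)"
    unfolding dvp_def mop_sum F_def sum.distrib[symmetric]
    by (rule sum.cong) (use v in \<open>simp_all add: W sc_distrib\<close>)
  have 2: "mop Q2 (dvp n v) = dvp n (mop Q2 v) + (\<Sum>p\<le>n. G p)"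
    unfolding dvp_def mop_sum G_def sum.distrib[symmetric]
    by (rule sum.cong) (use v in \<open>simp_all add: W sc_distrib\<close>)
  have 3: "(\<Sum>p\<le>n. F p) = (\<Sum>p<n. ?f p)"
    using Ff by (simp add: lessThan_Suc_atMost[symmetric] F_def[of n])
  have 4: "(\<Sum>p\<le>n. G p) = (\<Sum>p<n. ?g p)"
    using Gg by (simp add: sum.atMost_shift G_def[of 0])
  have e: "{..<n} = {..n - 1}" using n2 by auto
  have "(\<Sum>p<n. ?f p) + (\<Sum>p<n. ?g p) = (\<Sum>p<n. cf p (n - 1 - p) *s (q *s mop A (?M p) - mop C (?M p)))"
    unfolding sum.distrib[symmetric] by (rule sum.cong) (simp_all add: sc_distrib)
  also have "\<dots> = q *s mop A (dvp (n - 1) v) - mop C (dvp (n - 1) v)"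
    unfolding dvp_def e mop_sum sc_distrib(6) sum_subtractf[symmetric]
    by (rule sum.cong) (simp_all add: sc_distrib mult.commute)
  finally have 5: "(\<Sum>p<n. ?f p) + (\<Sum>p<n. ?g p) = q *s mop A (dvp (n - 1) v) - mop C (dvp (n - 1) v)" .
  show ?thesis unfolding 1 2 3 4 dvp_lin 5[symmetric] by (simp only: add_ac)
qed

end

section \<open>Tensor products\<close>

lemma sum_grid: "(\<Sum>k<l * (m::nat). f k) = (\<Sum>i<l. \<Sum>j<m. f (i * m + j) :: 'k::comm_monoid_add)"
proof (induction l)
  case (Suc l)
  have "(\<Sum>k<Suc l * m. f k) = (\<Sum>k<l * m. f k) + (\<Sum>j<m. f (j + l * m))"
    using sum_split_at[of f "l * m" m] by (simp add: add.commute)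
  then show ?case using Suc by (simp add: add.commute)
qed simp

definition kron :: "nat \<Rightarrow> nat \<Rightarrow> 'k::field mat \<Rightarrow> 'k mat \<Rightarrow> 'k mat" where
  "kron l m A B = mat (l * m) (l * m) (\<lambda>(i, j). A $$ (i div m, j div m) * B $$ (i mod m, j mod m))"

definition ten :: "nat \<Rightarrow> nat \<Rightarrow> (nat \<Rightarrow> 'k::field) \<Rightarrow> (nat \<Rightarrow> 'k) \<Rightarrow> nat \<Rightarrow> 'k" where
  "ten l m v w = (\<lambda>k. if k < l * m then v (k div m) * w (k mod m) else 0)"

lemma kron_carrier [simp]: "kron l m A B \<in> carrier_mat (l * m) (l * m)"
  by (simp add: kron_def)

lemma ten_fsp [simp, intro]: "ten l m v w \<in> fsp (l * m)"
  by (auto simp: ten_def fsp_def)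

lemma grid_less: "i < l \<Longrightarrow> j < m \<Longrightarrow> i * m + j < l * (m::nat)"
  by (metis add_less_cancel_left less_le_trans mult_Suc mult_le_mono1 Suc_leI add.commute)

lemma ten_grid: "i < l \<Longrightarrow> j < m \<Longrightarrow> ten l m v w (i * m + j) = v i * w j"
  using grid_less[of i l j m] by (simp add: ten_def)

lemma grid_div: "k < l * m \<Longrightarrow> k div m < l \<and> k mod m < (m::nat)"
  by (cases "m = 0") (auto simp: less_mult_imp_div_less)

lemma ten_lin [simp]:
  "ten l m (c *s v) w = c *s ten l m v w" "ten l m v (c *s w) = c *s ten l m v w"
  "ten l m (v + v') w = ten l m v w + ten l m v' w" "ten l m v (w + w') = ten l m v w + ten l m v w'"
  "ten l m (v - v') w = ten l m v w - ten l m v' w" "ten l m v (w - w') = ten l m v w - ten l m v w'"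
  "ten l m 0 w = 0" "ten l m v 0 = 0"
  by (auto simp: ten_def fun_eq_iff ptw algebra_simps)

lemma bas_ten: "k < l * m \<Longrightarrow> bas k = ten l m (bas (k div m)) (bas (k mod m))"
proof
  fix i assume k: "k < l * m"
  then have "i = k \<longleftrightarrow> i div m = k div m \<and> i mod m = k mod m" by (metis div_mod_decomp)
  then show "bas k i = ten l m (bas (k div m)) (bas (k mod m)) i"
    using k by (auto simp: bas_def ten_def)
qed

lemma mop_kron:
  assumes A: "A \<in> carrier_mat l l" and B: "B \<in> carrier_mat m m"
  shows "mop (kron l m A B) (ten l m v w) = ten l m (mop A v) (mop B w)"
proof
  fix k
  show "mop (kron l m A B) (ten l m v w) k = ten l m (mop A v) (mop B w) k"
  proof (cases "k < l * m")
    case True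
    let ?i = "k div m" and ?j = "k mod m"
    have ij: "?i < l" "?j < m" using grid_div[OF True] by auto
    have "mop (kron l m A B) (ten l m v w) k = (\<Sum>i<l. \<Sum>j<m. kron l m A B $$ (k, i * m + j) * ten l m v w (i * m + j))"
      using True carrier_matD[OF kron_carrier[of l m A B]] by (simp add: mop_def sum_grid)
    also have "\<dots> = (\<Sum>i<l. \<Sum>j<m. (A $$ (?i, i) * v i) * (B $$ (?j, j) * w j))"
      using True by (intro sum.cong HOL.refl) (simp add: kron_def grid_less ten_grid)
    also have "\<dots> = (\<Sum>i<l. A $$ (?i, i) * v i) * (\<Sum>j<m. B $$ (?j, j) * w j)"
      by (simp add: sum_product)
    finally show ?thesis using True ij A B by (simp add: ten_def mop_def)
  qed (use carrier_matD[OF kron_carrier[of l m A B]] in \<open>simp add: mop_def ten_def\<close>)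
qed

lemma ten_ext:
  assumes "lin T" "lin S" "v \<in> fsp (l * m)"
    "\<And>i j. i < l \<Longrightarrow> j < m \<Longrightarrow> T (ten l m (bas i) (bas j)) = S (ten l m (bas i) (bas j))"
  shows "T v = S v"
  by (rule lin_ext[OF assms(1,2) _ assms(3)]) (use assms(4) grid_div in \<open>auto simp: bas_ten\<close>)

lemma kron_mult:
  assumes "A \<in> carrier_mat l l" "B \<in> carrier_mat m m" "A' \<in> carrier_mat l l" "B' \<in> carrier_mat m m"
  shows "kron l m (A * A') (B * B') = kron l m A B * kron l m A' B'"
proof (rule mop_eqI_fsp[of _ "l * m" "l * m"])
  fix f :: "nat \<Rightarrow> 'a" assume f: "f \<in> fsp (l * m)"
  show "mop (kron l m (A * A') (B * B')) f = mop (kron l m A B * kron l m A' B') f"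
    unfolding mop_mult[OF kron_carrier kron_carrier]
    by (rule ten_ext[OF _ _ f]) (use assms in \<open>auto simp: mop_kron mop_mult\<close>)
qed (use mult_carrier_mat[OF kron_carrier kron_carrier] in auto)

lemma app_tensor:
  fixes f f' :: "('g, 'k::field) ddgen \<Rightarrow> 'k mat"
  shows "app (dd_tensor D (rep_mod l f) (rep_mod m f')) u v =
    (\<Sum>(p, r)\<leftarrow>comult D u. mop (kron l m (eval_term l f p) (eval_term m f' r)) v)"
proof
  fix i
  have s: "(\<Sum>(p, r)\<leftarrow>ps. g p r :: nat \<Rightarrow> 'k) i = (\<Sum>(p, r)\<leftarrow>ps. g p r i)" for ps :: "(('g, 'k) ddterm \<times> ('g, 'k) ddterm) list" and g
    by (induction ps) (auto simp: ptw)
  have d: "(\<Sum>j\<in>S. (\<Sum>(p, r)\<leftarrow>ps. g p r j) * v j) = (\<Sum>(p, r)\<leftarrow>ps. \<Sum>j\<in>S. g p r j * v j)"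
    for ps :: "(('g, 'k) ddterm \<times> ('g, 'k) ddterm) list" and g :: "_ \<Rightarrow> _ \<Rightarrow> nat \<Rightarrow> 'k" and S :: "nat set"
    by (induction ps) (auto simp: ring_distribs sum.distrib)
  show "app (dd_tensor D (rep_mod l f) (rep_mod m f')) u v i =
    (\<Sum>(p, r)\<leftarrow>comult D u. mop (kron l m (eval_term l f p) (eval_term m f' r)) v) i"
  proof (cases "i < l * m")
    case True
    have "app (dd_tensor D (rep_mod l f) (rep_mod m f')) u v i =
      (\<Sum>j<l * m. (\<Sum>(p, r)\<leftarrow>comult D u. eval_term l f p $$ (i div m, j div m) * eval_term m f' r $$ (i mod m, j mod m)) * v j)"
      using True by (simp add: mop_def dd_tensor_def rep_mod_def)
    also have "\<dots> = (\<Sum>(p, r)\<leftarrow>comult D u. \<Sum>j<l * m. eval_term l f p $$ (i div m, j div m) * eval_term m f' r $$ (i mod m, j mod m) * v j)"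
      by (rule d)
    also have "\<dots> = (\<Sum>(p, r)\<leftarrow>comult D u. mop (kron l m (eval_term l f p) (eval_term m f' r)) v i)"
      using True by (intro arg_cong[where f = sum_list] map_cong) (auto simp: mop_def kron_def)
    finally show ?thesis unfolding s .
  next
    case False
    have "(\<Sum>(p, r)\<leftarrow>ps. mop (kron l m (eval_term l f p) (eval_term m f' r)) v i) = 0" for ps
      using False by (induction ps) (auto simp: mop_def kron_def)
    then show ?thesis using False unfolding s by (simp add: mop_def dd_tensor_def rep_mod_def)
  qed
qed

lemma tensor_dim [simp]: "mdim (dd_tensor D M N) = mdim M * mdim N"
  by (simp add: dd_tensor_def)

lemma tensor_carrier: "act (dd_tensor D M N) u \<in> carrier_mat (mdim M * mdim N) (mdim M * mdim N)"
  by (simp add: dd_tensor_def)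

lemma eval_term_carrier': "(\<And>x. f x \<in> carrier_mat d d) \<Longrightarrow> eval_term d f u \<in> carrier_mat d d"
  by (rule eval_term_carrier[of UNIV]) (auto simp: terms_def)

lemma tensor_pre_module:
  fixes f f' :: "('g, 'k::field) ddgen \<Rightarrow> 'k mat"
  assumes f: "\<And>x. f x \<in> carrier_mat l l" "\<And>x. f' x \<in> carrier_mat m m"
  shows "pre_module D (dd_tensor D (rep_mod l f) (rep_mod m f'))" (is "pre_module D ?T")
  unfolding pre_module_def
proof (intro conjI allI ballI)
  note c = eval_term_carrier'[of f, OF f(1)] eval_term_carrier'[of f', OF f(2)]
  show tc: "act ?T u \<in> carrier_mat (mdim ?T) (mdim ?T)" for u
    using tensor_carrier[of D "rep_mod l f" "rep_mod m f'" u] by simp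
  show "act ?T (Const k) = k \<cdot>\<^sub>m 1\<^sub>m (mdim ?T)" for k
  proof (rule mop_eqI_fsp[OF tc])
    fix v :: "nat \<Rightarrow> 'k" assume v: "v \<in> fsp (mdim ?T)"
    then have v': "v \<in> fsp (l * m)" by simp
    have "mop (kron l m (k \<cdot>\<^sub>m 1\<^sub>m l) (1 \<cdot>\<^sub>m 1\<^sub>m m)) v = k *s v"
      by (rule ten_ext[OF _ _ v']) (auto simp: mop_kron mop_mat_smult mop_one)
    then show "app ?T (Const k) v = mop (k \<cdot>\<^sub>m 1\<^sub>m (mdim ?T)) v"
      using v by (simp add: app_tensor mop_mat_smult mop_one one_fterm_def)
  qed auto
  fix u v :: "('g, 'k) ddterm"
  show "act ?T (u + v) = act ?T u + act ?T v"
    by (rule mop_eqI_fsp[OF tc])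
      (use tc in \<open>auto simp: mop_mat_add[OF tc tc] app_tensor plus_fterm_def\<close>)
  have e: "(\<Sum>(p, r)\<leftarrow>concat (map (\<lambda>(p, q). map (\<lambda>(r, s). (p * r, q * s)) ys) xs).
      mop (kron l m (eval_term l f p) (eval_term m f' r)) w) =
      (\<Sum>(p, r)\<leftarrow>xs. mop (kron l m (eval_term l f p) (eval_term m f' r))
        (\<Sum>(p, r)\<leftarrow>ys. mop (kron l m (eval_term l f p) (eval_term m f' r)) w))"
    for xs ys :: "(('g, 'k) ddterm \<times> ('g, 'k) ddterm) list" and w
  proof (induction xs)
    case (Cons x xs)
    obtain p r where x: "x = (p, r)" by (cases x)
    have "(\<Sum>(p', r')\<leftarrow>map (\<lambda>(p', r'). (p * p', r * r')) ys. mop (kron l m (eval_term l f p') (eval_term m f' r')) w) =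
      mop (kron l m (eval_term l f p) (eval_term m f' r)) (\<Sum>(p', r')\<leftarrow>ys. mop (kron l m (eval_term l f p') (eval_term m f' r')) w)"
      by (induction ys) (auto simp: times_fterm_def kron_mult[OF c c] mop_mult[OF kron_carrier kron_carrier])
    then show ?case using Cons by (simp add: x)
  qed simp
  show "act ?T (u * v) = act ?T u * act ?T v"
    by (rule mop_eqI_fsp[OF tc])
      (use tc mult_carrier_mat[OF tc tc, of u v] e in \<open>auto simp: mop_mult[OF tc tc] app_tensor times_fterm_def\<close>)
qed

section \<open>The tensor product of two simple modules\<close>

locale tens = datum D + V1: vmod D l \<mu> + V2: vmod D l' \<mu>'
  for D :: "('g, 'k::field_char_0) group_datum" and l \<mu> l' \<mu>' +
  assumes ll: "l \<le> l'" "l' < nn D"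
begin

abbreviation "N \<equiv> l * l'"
abbreviation "kr \<equiv> kron l l'"
abbreviation "te \<equiv> ten l l'"
abbreviation "g1 \<equiv> \<lambda>g. act V1.V (g_el g)"
abbreviation "g2 \<equiv> \<lambda>g. act V2.V (g_el g)"
abbreviation "c1 \<equiv> \<lambda>\<gamma>. act V1.V (c_el \<gamma>)"
abbreviation "c2 \<equiv> \<lambda>\<gamma>. act V2.V (c_el \<gamma>)"
abbreviation "x1 \<equiv> act V1.V x_el"
abbreviation "x2 \<equiv> act V2.V x_el"
abbreviation "xi1 \<equiv> act V1.V xi_el"
abbreviation "xi2 \<equiv> act V2.V xi_el"

text \<open>\<open>U\<close>, \<open>W\<close> are the summands of \<Delta>(\<xi>) and
  \<open>Q1\<close>, \<open>Q2\<close> those of \<Delta>(x); \<open>H\<close> is \<chi> \<otimes> a,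
  which enters the commutators of \<open>Q1\<close> with \<open>U\<close> and of \<open>Q2\<close>
  with \<open>W\<close> with opposite signs.\<close>

definition U where "U = kr xi1 (1\<^sub>m l')"
definition W where "W = kr (c1 X) xi2"
definition Q1 where "Q1 = kr x1 (g2 a)"
definition Q2 where "Q2 = kr (1\<^sub>m l) x2"
definition H where "H = kr (c1 X) (g2 a)"
definition kgM where "kgM g = kr (g1 g) (g2 g)"
definition kcM where "kcM \<gamma> = kr (c1 \<gamma>) (c2 \<gamma>)"
definition xiM where "xiM = U + W"
definition xM where "xM = Q1 + Q2"

lemma carriers [simp]: "U \<in> carrier_mat N N" "W \<in> carrier_mat N N" "Q1 \<in> carrier_mat N N" "Q2 \<in> carrier_mat N N"
    "H \<in> carrier_mat N N" "kgM g \<in> carrier_mat N N" "kcM \<gamma> \<in> carrier_mat N N"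
    "xiM \<in> carrier_mat N N" "xM \<in> carrier_mat N N"
  by (simp_all add: U_def W_def Q1_def Q2_def H_def kgM_def kcM_def xiM_def xM_def)

lemma M_fsp [simp, intro]: "mop U v \<in> fsp N" "mop W v \<in> fsp N" "mop Q1 v \<in> fsp N" "mop Q2 v \<in> fsp N"
    "mop H v \<in> fsp N" "mop (kgM g) v \<in> fsp N" "mop (kcM \<gamma>) v \<in> fsp N" "mop xiM v \<in> fsp N" "mop xM v \<in> fsp N"
  by (simp_all add: mop_fsp[where d = N and e = N])

interpretation N1: nilrep D l "mg V1.V" "mc V1.V" xi1 x1 by (rule V1.V_nilrep)
interpretation N2: nilrep D l' "mg V2.V" "mc V2.V" xi2 x2 by (rule V2.V_nilrep)

lemma M_te:
  "w \<in> fsp l' \<Longrightarrow> mop U (te v w) = te (mop xi1 v) w"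
  "mop W (te v w) = te (mop (c1 X) v) (mop xi2 w)"
  "mop Q1 (te v w) = te (mop x1 v) (mop (g2 a) w)"
  "v \<in> fsp l \<Longrightarrow> mop Q2 (te v w) = te v (mop x2 w)"
  "mop H (te v w) = te (mop (c1 X) v) (mop (g2 a) w)"
  "g \<in> GG \<Longrightarrow> mop (kgM g) (te v w) = te (mop (g1 g) v) (mop (g2 g) w)"
  "\<gamma> \<in> CC \<Longrightarrow> mop (kcM \<gamma>) (te v w) = te (mop (c1 \<gamma>) v) (mop (c2 \<gamma>) w)"
  by (simp_all add: U_def W_def Q1_def Q2_def H_def kgM_def kcM_def mop_kron mop_one
      N1.xi_c N2.xi_c N1.y_c N2.y_c N1.kg_c N2.kg_c N1.kc_c N2.kc_c)

lemma mop_xiM: "mop xiM v = mop U v + mop W v" and mop_xM: "mop xM v = mop Q1 v + mop Q2 v"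
  by (simp_all add: xiM_def xM_def mop_mat_add[where a = N and b = N])

lemma U_pow_te: "w \<in> fsp l' \<Longrightarrow> (mop U ^^ k) (te v w) = te ((mop xi1 ^^ k) v) w"
  by (induction k) (simp_all add: M_te)

lemma W_pow_te: "(mop W ^^ k) (te v w) = te ((mop (c1 X) ^^ k) v) ((mop xi2 ^^ k) w)"
  by (induction k) (simp_all add: M_te)

lemma Q1_pow_te: "(mop Q1 ^^ k) (te v w) = te ((mop x1 ^^ k) v) ((mop (g2 a) ^^ k) w)"
  by (induction k) (simp_all add: M_te)

lemma Q2_pow_te: "v \<in> fsp l \<Longrightarrow> (mop Q2 ^^ k) (te v w) = te v ((mop x2 ^^ k) w)"
  by (induction k) (simp_all add: M_te)

text \<open>The exponent n - 1 rather than n is available because l and l' are less than n;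
  \<open>dvp_commutator\<close> relies on it.\<close>

lemma UW_n1: "v \<in> fsp N \<Longrightarrow> n - 1 \<le> k \<Longrightarrow> (mop U ^^ k) v = 0" "v \<in> fsp N \<Longrightarrow> n - 1 \<le> k \<Longrightarrow> (mop W ^^ k) v = 0"
proof -
  show "(mop U ^^ k) v = 0" if "v \<in> fsp N" "n - 1 \<le> k"
    by (rule ten_ext[OF _ _ that(1)]) (use that ll in \<open>auto simp: U_pow_te V1.V_xi_pow_0\<close>)
  show "(mop W ^^ k) v = 0" if "v \<in> fsp N" "n - 1 \<le> k"
    by (rule ten_ext[OF _ _ that(1)]) (use that ll in \<open>auto simp: W_pow_te V2.V_xi_pow_0\<close>)
qed

sublocale B: qbinom D N U W
proof
  show "U \<in> carrier_mat N N" "W \<in> carrier_mat N N" by simp_all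
  fix v :: "nat \<Rightarrow> 'k" assume v: "v \<in> fsp N"
  show "mop U (mop W v) = q *s mop W (mop U v)"
    by (rule ten_ext[OF _ _ v]) (auto simp: M_te N1.xi_kc q_X)
  show "(mop U ^^ n) v = 0" "(mop W ^^ n) v = 0" using UW_n1[OF v] by simp_all
qed

lemma xM_n: "v \<in> fsp N \<Longrightarrow> (mop xM ^^ n) v = 0"
proof -
  assume v: "v \<in> fsp N"
  have "qbinom D N Q2 Q1"
  proof
    show "Q2 \<in> carrier_mat N N" "Q1 \<in> carrier_mat N N" by simp_all
    fix v :: "nat \<Rightarrow> 'k" assume v: "v \<in> fsp N"
    show "mop Q2 (mop Q1 v) = q *s mop Q1 (mop Q2 v)"
      by (rule ten_ext[OF _ _ v]) (auto simp: M_te N2.y_kg q_X)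
    show "(mop Q2 ^^ n) v = 0"
      by (rule ten_ext[OF _ _ v]) (use ll in \<open>auto simp: Q2_pow_te V2.V_x_pow\<close>)
    show "(mop Q1 ^^ n) v = 0"
      by (rule ten_ext[OF _ _ v]) (use ll in \<open>auto simp: Q1_pow_te V1.V_x_pow\<close>)
  qed
  then show ?thesis by (rule qbinom.UW_pow_n[OF _ v]) (simp add: mop_xM add.commute)
qed

lemma lin_dvp [intro, simp]: "lin T \<Longrightarrow> lin (\<lambda>v. B.dvp k (T v))"
  by (auto simp: lin_def)

lemma M_torus: "torus D N kgM kcM xiM"
proof
  show "kgM g \<in> carrier_mat N N" "kcM \<gamma> \<in> carrier_mat N N" "xiM \<in> carrier_mat N N" for g \<gamma> by simp_all
  fix v :: "nat \<Rightarrow> 'k" assume v: "v \<in> fsp N"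
  show "mop (kgM g) (mop (kgM h) v) = mop (kgM (g \<otimes>\<^bsub>grp D\<^esub> h)) v" if "g \<in> GG" "h \<in> GG" for g h
    by (rule ten_ext[OF _ _ v]) (use that in \<open>auto simp: M_te N1.kg_mult N2.kg_mult\<close>)
  show "mop (kcM g) (mop (kcM h) v) = mop (kcM (g \<otimes>\<^bsub>Gam D\<^esub> h)) v" if "g \<in> CC" "h \<in> CC" for g h
    by (rule ten_ext[OF _ _ v]) (use that in \<open>auto simp: M_te N1.kc_mult N2.kc_mult\<close>)
  show "mop (kgM \<one>\<^bsub>grp D\<^esub>) v = v"
    by (rule ten_ext[OF _ _ v]) (auto simp: M_te N1.kg_one N2.kg_one)
  show "mop (kcM \<one>\<^bsub>Gam D\<^esub>) v = v"
    by (rule ten_ext[OF _ _ v]) (auto simp: M_te N1.kc_one N2.kc_one)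
  show "mop (kgM g) (mop (kcM h) v) = mop (kcM h) (mop (kgM g) v)" if "g \<in> GG" "h \<in> CC" for g h
    by (rule ten_ext[OF _ _ v]) (use that in \<open>auto simp: M_te N1.kg_kc N2.kg_kc\<close>)
  show "mop xiM (mop (kgM g) v) = inverse (X g) *s mop (kgM g) (mop xiM v)" if "g \<in> GG" for g
    unfolding mop_xiM
    by (rule ten_ext[OF _ _ v])
      (use that in \<open>auto simp: M_te N1.xi_kg N2.xi_kg N1.kg_kc[of g X] sc_distrib\<close>)
  show "mop xiM (mop (kcM g) v) = g a *s mop (kcM g) (mop xiM v)" if "g \<in> CC" for g
    unfolding mop_xiM
    by (rule ten_ext[OF _ _ v])
      (use that in \<open>auto simp: M_te N1.xi_kc N2.xi_kc N1.kc_comm[of g X] sc_distrib\<close>)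
  show "(mop xiM ^^ n) v = 0" by (rule B.UW_pow_n[OF v]) (simp add: mop_xiM)
qed

lemma comms:
  assumes v: "v \<in> fsp N"
  shows "mop Q1 (mop W v) = mop W (mop Q1 v)" "mop Q2 (mop U v) = mop U (mop Q2 v)"
    "mop Q1 (mop U v) = mop U (mop Q1 v) + (mop (kgM a) v - mop H v)"
    "mop Q2 (mop W v) = mop W (mop Q2 v) + (mop H v - mop (kcM X) v)"
    "mop U (mop (kgM a) v) = inverse q *s mop (kgM a) (mop U v)"
    "mop U (mop H v) = q *s mop H (mop U v)"
    "mop W (mop (kgM a) v) = inverse q *s mop (kgM a) (mop W v)"
    "mop W (mop H v) = inverse q *s mop H (mop W v)"
    "mop W (mop (kcM X) v) = q *s mop (kcM X) (mop W v)"
proof -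
  have xc: "mop x1 (mop (c1 X) u) = inverse q *s mop (c1 X) (mop x1 u)" if "u \<in> fsp l" for u
    using N1.y_kc[OF closed(2) that, symmetric] by (simp add: q_X)
  have xg: "mop (g2 a) (mop xi2 u) = q *s mop xi2 (mop (g2 a) u)" if "u \<in> fsp l'" for u
    using N2.xi_kg[OF closed(1) that] by (simp add: q_X)
  have x1xi: "mop x1 (mop xi1 u) = mop xi1 (mop x1 u) + (mop (g1 a) u - mop (c1 X) u)" if "u \<in> fsp l" for u
    using N1.comm[OF that] by (simp add: algebra_simps)
  have x2xi: "mop x2 (mop xi2 u) = mop xi2 (mop x2 u) + (mop (g2 a) u - mop (c2 X) u)" if "u \<in> fsp l'" for u
    using N2.comm[OF that] by (simp add: algebra_simps)
  show "mop Q1 (mop W v) = mop W (mop Q1 v)"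
    by (rule ten_ext[OF _ _ v]) (auto simp: M_te xc xg)
  show "mop Q2 (mop U v) = mop U (mop Q2 v)"
    by (rule ten_ext[OF _ _ v]) (auto simp: M_te)
  show "mop Q1 (mop U v) = mop U (mop Q1 v) + (mop (kgM a) v - mop H v)"
    by (rule ten_ext[OF _ _ v]) (auto simp: M_te x1xi)
  show "mop Q2 (mop W v) = mop W (mop Q2 v) + (mop H v - mop (kcM X) v)"
    by (rule ten_ext[OF _ _ v]) (auto simp: M_te x2xi)
  show "mop U (mop (kgM a) v) = inverse q *s mop (kgM a) (mop U v)"
    by (rule ten_ext[OF _ _ v]) (auto simp: M_te N1.xi_kg q_X)
  show "mop U (mop H v) = q *s mop H (mop U v)"
    by (rule ten_ext[OF _ _ v]) (auto simp: M_te N1.xi_kc q_X)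
  show "mop W (mop (kgM a) v) = inverse q *s mop (kgM a) (mop W v)"
    by (rule ten_ext[OF _ _ v]) (auto simp: M_te N2.xi_kg q_X N1.kg_kc)
  show "mop W (mop H v) = inverse q *s mop H (mop W v)"
    by (rule ten_ext[OF _ _ v]) (auto simp: M_te N2.xi_kg q_X)
  show "mop W (mop (kcM X) v) = q *s mop (kcM X) (mop W v)"
    by (rule ten_ext[OF _ _ v]) (auto simp: M_te N2.xi_kc q_X)
qed

lemma M_nilrep: "nilrep D N kgM kcM xiM xM"
proof -
  interpret torus D N kgM kcM xiM by (rule M_torus)
  show ?thesis
  proof
    show "xM \<in> carrier_mat N N" by simp
    fix v :: "nat \<Rightarrow> 'k" assume v: "v \<in> fsp N"
    show "mop xM (mop (kgM g) v) = X g *s mop (kgM g) (mop xM v)" if "g \<in> GG" for g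
      unfolding mop_xM
      by (rule ten_ext[OF _ _ v]) (use that in \<open>auto simp: M_te N1.y_kg N2.y_kg N2.kg_comm[of a g] sc_distrib\<close>)
    show "\<gamma> a *s mop xM (mop (kcM \<gamma>) v) = mop (kcM \<gamma>) (mop xM v)" if g: "\<gamma> \<in> CC" for \<gamma>
    proof -
      have 1: "mop x1 (mop (c1 \<gamma>) u) = inverse (\<gamma> a) *s mop (c1 \<gamma>) (mop x1 u)" if "u \<in> fsp l" for u
        using N1.y_kc[OF g that, symmetric] g by simp
      have 2: "mop x2 (mop (c2 \<gamma>) u) = inverse (\<gamma> a) *s mop (c2 \<gamma>) (mop x2 u)" if "u \<in> fsp l'" for u
        using N2.y_kc[OF g that, symmetric] g by simp
      show ?thesis unfolding mop_xM
        by (rule ten_ext[OF _ _ v]) (use g in \<open>auto simp: M_te 1 2 N2.kg_kc[of a \<gamma>] sc_distrib\<close>)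
    qed
    show "mop xM (mop xiM v) - mop xiM (mop xM v) = mop (kgM a) v - mop (kcM X) v"
      unfolding mop_xM mop_xiM mop_add comms(1-4)[OF v] by (simp add: algebra_simps)
  qed
qed

interpretation M: nilrep D N kgM kcM xiM xM by (rule M_nilrep)

text \<open>\<xi>^(n-1) is its divided power times the q-factorial of n - 1, which \<open>cw\<close>
  cancels; what remains is the commutator term of \<open>dvp_commutator\<close>.\<close>

lemma zop_dvp: "v \<in> fsp N \<Longrightarrow> cw *s M.zop v =
    (if twisted then q *s mop (kgM a) (B.dvp (n - 1) v) - mop (kcM X) (B.dvp (n - 1) v) else 0)"
  using B.UW_pow[of v xiM "n - 1"] mop_xiM n2 qfact_nz[of "n - 1"]
  by (simp add: M.zop_def cw_def sc_distrib mult_ac)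

text \<open>Conjugation by \<open>1 + Z\<close>, where \<open>Z\<close> is the \<open>n\<close>-th divided power of \<open>\<xi>\<close>, takes the tensor product to this
  module, on which \<open>\<Gamma>\<close> acts diagonally.\<close>

definition f1 :: "('g, 'k) ddgen \<Rightarrow> 'k mat" where
  "f1 z = (case z of GGen g \<Rightarrow> kgM g | CGen \<gamma> \<Rightarrow> kcM \<gamma> | XiGen \<Rightarrow> xiM
     | XGen \<Rightarrow> tw_mat (kgM a) (kcM X) xiM xM)"

abbreviation "M1 \<equiv> rep_mod N f1"
abbreviation "T \<equiv> dd_tensor D V1.V V2.V"

lemma f1_simps [simp]: "f1 (GGen g) = kgM g" "f1 (CGen \<gamma>) = kcM \<gamma>" "f1 XiGen = xiM"
  by (simp_all add: f1_def)

lemma M1_act: "act M1 (g_el g) = kgM g" "act M1 (c_el \<gamma>) = kcM \<gamma>" "act M1 xi_el = xiM"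
  by simp_all

lemma M1_x: "v \<in> fsp N \<Longrightarrow> app M1 x_el v = mop xM v + cw *s M.zop v"
  by (simp add: f1_def mop_tw_mat[of _ N] M.zop_def)

lemma M1_pre: "pre_module D M1"
  by (rule rep_pre_module) (auto simp: f1_def tw_mat_c split: ddgen.split)

lemma M1_y: "v \<in> fsp N \<Longrightarrow> app M1 y_term v = mop xM v"
  using app_y_term[OF M1_pre, of v] M1_x[of v] by (simp add: M.zop_def)

lemma T_pre: "pre_module D T"
  unfolding V_mod_rep by (rule tensor_pre_module) (rule V_gen_carrier)+

lemma app_T: "app T u v = (\<Sum>(p, r)\<leftarrow>comult D u. mop (kr (act V1.V p) (act V2.V r)) v)"
  unfolding V_mod_rep app_tensor by (simp add: rep_mod_def)

lemma act_one: "act V1.V 1 = 1\<^sub>m l" "act V2.V 1 = 1\<^sub>m l'"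
  by (simp_all add: V_mod_def one_fterm_def) (auto simp: fun_eq_iff)

lemma T_g: "app T (g_el g) v = mop (kgM g) v" and T_xi: "app T xi_el v = mop xiM v"
  and T_x: "app T x_el v = mop xM v"
  by (simp_all add: app_T mop_xiM mop_xM kgM_def U_def W_def Q1_def Q2_def act_one)

text \<open>The summand \<gamma>\<chi>^p\<xi>^(n-p) \<otimes> \<gamma>\<xi>^p acts as W^p U^(n-p)
  followed by \<gamma> \<otimes> \<gamma>, so the extra terms of \<Delta>(\<gamma>) add up to the
  n-th divided power; its terms for p = 0 and p = n are 0 by convention.\<close>

lemma T_c:
  assumes g: "\<gamma> \<in> CC" and v: "v \<in> fsp N"
  shows "app T (c_el \<gamma>) v = mop (kcM \<gamma>) (v + (if nilpotent_type D then 0 else (\<gamma> a ^ n - 1)) *s B.dvp n v)"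
proof (rule ten_ext[OF _ _ v])
  fix i j assume ij: "i < l" "j < l'"
  let ?b = "bas i :: nat \<Rightarrow> 'k" and ?b' = "bas j :: nat \<Rightarrow> 'k"
  let ?u = "\<lambda>p. Const ((\<gamma> a ^ n - 1) / (qfact q p * qfact q (n - p))) * (c_el \<gamma> * c_el X ^ p * xi_el ^ (n - p))"
  let ?r = "\<lambda>p. c_el \<gamma> * xi_el ^ p"
  let ?t = "\<lambda>p. te ((mop (c1 X) ^^ p) ((mop xi1 ^^ (n - p)) ?b)) ((mop xi2 ^^ p) ?b')"
  have dv: "B.dvp n (te ?b ?b') = (\<Sum>p\<le>n. B.cf p (n - p) *s ?t p)"
    using ij by (simp add: B.dvp_def U_pow_te W_pow_te)
  also have "\<dots> = (\<Sum>p\<in>{1..<n}. B.cf p (n - p) *s ?t p)"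
    by (rule sum.mono_neutral_right) (use less_le_trans[OF pos2 n2] in \<open>auto simp: not_less Suc_le_eq One_nat_def le_less\<close>)
  finally have dv: "B.dvp n (te ?b ?b') = \<dots>" .
  have k: "mop (kr (act V1.V (?u p)) (act V2.V (?r p))) (te ?b ?b') =
      (\<gamma> a ^ n - 1) *s mop (kcM \<gamma>) (B.cf p (n - p) *s ?t p)" for p
  proof -
    have "mop (kr (act V1.V (?u p)) (act V2.V (?r p))) (te ?b ?b') = te (app V1.V (?u p) ?b) (app V2.V (?r p) ?b')"
      using g pre_carrier[OF V1.V_pre, of "?u p"] pre_carrier[OF V2.V_pre, of "?r p"] by (intro mop_kron) simp_all
    also have "app V1.V (?u p) ?b = ((\<gamma> a ^ n - 1) * B.cf p (n - p)) *s mop (c1 \<gamma>) ((mop (c1 X) ^^ p) ((mop xi1 ^^ (n - p)) ?b))"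
      using g ij by (simp add: app_const_mult[OF V1.V_pre] app_mult[OF V1.V_pre] app_power[OF V1.V_pre]
          app_const[OF V1.V_pre] app_fsp[OF V1.V_pre] B.cf_def field_simps)
    also have "app V2.V (?r p) ?b' = mop (c2 \<gamma>) ((mop xi2 ^^ p) ?b')"
      using g ij by (simp add: app_mult[OF V2.V_pre] app_power[OF V2.V_pre])
    finally show ?thesis using g by (simp add: M_te)
  qed
  show "app T (c_el \<gamma>) (te ?b ?b') = mop (kcM \<gamma>) (te ?b ?b' +
      (if nilpotent_type D then 0 else (\<gamma> a ^ n - 1)) *s B.dvp n (te ?b ?b'))"
  proof (cases "nilpotent_type D")
    case True
    then show ?thesis by (simp add: app_T kcM_def)
  next
    case False
    have "app T (c_el \<gamma>) (te ?b ?b') = mop (kcM \<gamma>) (te ?b ?b') +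
        (\<Sum>p\<leftarrow>[1..<n]. mop (kr (act V1.V (?u p)) (act V2.V (?r p))) (te ?b ?b'))"
      using False by (simp add: app_T kcM_def o_def)
    also have "\<dots> = mop (kcM \<gamma>) (te ?b ?b') + (\<gamma> a ^ n - 1) *s mop (kcM \<gamma>) (B.dvp n (te ?b ?b'))"
      unfolding k dv interv_sum_list_conv_sum_set_nat mop_sum sc_distrib(6) by simp
    finally show ?thesis using False by simp
  qed
qed (auto intro!: lin_intros)

text \<open>This is 1 + Z in the twisted case and the identity otherwise, as a map from
  \<open>M1\<close> to \<open>T\<close>.\<close>

definition sop :: "(nat \<Rightarrow> 'k) \<Rightarrow> nat \<Rightarrow> 'k" where
  "sop v = v + (if twisted then 1 else 0) *s B.dvp n v"

definition sinv :: "(nat \<Rightarrow> 'k) \<Rightarrow> nat \<Rightarrow> 'k" where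
  "sinv v = v - (if twisted then 1 else 0) *s B.dvp n v"

lemma dvp_diff [simp]: "B.dvp k (v - w) = B.dvp k v - B.dvp k w"
  using B.dvp_lin(1)[of k "v - w" w] by simp

lemma sop_sinv: "v \<in> fsp N \<Longrightarrow> sop (sinv v) = v" "v \<in> fsp N \<Longrightarrow> sinv (sop v) = v"
  by (simp_all add: sop_def sinv_def B.dvp_dvp)

lemma s_fsp [simp, intro]: "v \<in> fsp N \<Longrightarrow> sop v \<in> fsp N" "v \<in> fsp N \<Longrightarrow> sinv v \<in> fsp N"
  by (simp_all add: sop_def sinv_def)

lemma s_lin [intro, simp]: "lin R \<Longrightarrow> lin (\<lambda>v. sop (R v))" "lin R \<Longrightarrow> lin (\<lambda>v. sinv (R v))"
  by (auto simp: sop_def sinv_def lin_def sc_distrib algebra_simps)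

lemma dvp_kg: "v \<in> fsp N \<Longrightarrow> g \<in> GG \<Longrightarrow> B.dvp k (mop (kgM g) v) = inverse (X g) ^ k *s mop (kgM g) (B.dvp k v)"
  and dvp_kc: "v \<in> fsp N \<Longrightarrow> \<gamma> \<in> CC \<Longrightarrow> B.dvp k (mop (kcM \<gamma>) v) = \<gamma> a ^ k *s mop (kcM \<gamma>) (B.dvp k v)"
proof -
  have Ug: "(mop U ^^ r) (mop (kgM g) v) = inverse (X g) ^ r *s mop (kgM g) ((mop U ^^ r) v)"
    and Wg: "(mop W ^^ r) (mop (kgM g) v) = inverse (X g) ^ r *s mop (kgM g) ((mop W ^^ r) v)"
    if v: "v \<in> fsp N" and g: "g \<in> GG" for r g v
  proof -
    have "mop U (mop (kgM g) v) = inverse (X g) *s mop (kgM g) (mop U v)" if "v \<in> fsp N" for v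
      by (rule ten_ext[OF _ _ that]) (use g in \<open>auto simp: M_te N1.xi_kg\<close>)
    then show "(mop U ^^ r) (mop (kgM g) v) = inverse (X g) ^ r *s mop (kgM g) ((mop U ^^ r) v)"
      using v by (induction r) (simp_all add: mult.commute)
    have "mop W (mop (kgM g) v) = inverse (X g) *s mop (kgM g) (mop W v)" if "v \<in> fsp N" for v
      by (rule ten_ext[OF _ _ that]) (use g in \<open>auto simp: M_te N2.xi_kg N1.kg_kc[of g X]\<close>)
    then show "(mop W ^^ r) (mop (kgM g) v) = inverse (X g) ^ r *s mop (kgM g) ((mop W ^^ r) v)"
      using v by (induction r) (simp_all add: mult.commute)
  qed
  have Uc: "(mop U ^^ r) (mop (kcM \<gamma>) v) = \<gamma> a ^ r *s mop (kcM \<gamma>) ((mop U ^^ r) v)"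
    and Wc: "(mop W ^^ r) (mop (kcM \<gamma>) v) = \<gamma> a ^ r *s mop (kcM \<gamma>) ((mop W ^^ r) v)"
    if v: "v \<in> fsp N" and g: "\<gamma> \<in> CC" for r \<gamma> v
  proof -
    have "mop U (mop (kcM \<gamma>) v) = \<gamma> a *s mop (kcM \<gamma>) (mop U v)" if "v \<in> fsp N" for v
      by (rule ten_ext[OF _ _ that]) (use g in \<open>auto simp: M_te N1.xi_kc\<close>)
    then show "(mop U ^^ r) (mop (kcM \<gamma>) v) = \<gamma> a ^ r *s mop (kcM \<gamma>) ((mop U ^^ r) v)"
      using v by (induction r) (simp_all add: mult.commute)
    have "mop W (mop (kcM \<gamma>) v) = \<gamma> a *s mop (kcM \<gamma>) (mop W v)" if "v \<in> fsp N" for v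
      by (rule ten_ext[OF _ _ that]) (use g in \<open>auto simp: M_te N2.xi_kc N1.kc_comm[of \<gamma> X]\<close>)
    then show "(mop W ^^ r) (mop (kcM \<gamma>) v) = \<gamma> a ^ r *s mop (kcM \<gamma>) ((mop W ^^ r) v)"
      using v by (induction r) (simp_all add: mult.commute)
  qed
  show "v \<in> fsp N \<Longrightarrow> g \<in> GG \<Longrightarrow> B.dvp k (mop (kgM g) v) = inverse (X g) ^ k *s mop (kgM g) (B.dvp k v)"
    unfolding B.dvp_def mop_sum sc_distrib(6)
    by (rule sum.cong) (auto simp: Ug Wg power_add[symmetric] mult_ac)
  show "v \<in> fsp N \<Longrightarrow> \<gamma> \<in> CC \<Longrightarrow> B.dvp k (mop (kcM \<gamma>) v) = \<gamma> a ^ k *s mop (kcM \<gamma>) (B.dvp k v)"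
    unfolding B.dvp_def mop_sum sc_distrib(6)
    by (rule sum.cong) (auto simp: Uc Wc power_add[symmetric] mult_ac)
qed

lemma sop_g: "v \<in> fsp N \<Longrightarrow> g \<in> GG \<Longrightarrow> sop (mop (kgM g) v) = mop (kgM g) (sop v)"
  using X_pow_n[of g] by (auto simp: sop_def dvp_kg twisted_def power_inverse)

lemma sop_xi: "v \<in> fsp N \<Longrightarrow> sop (mop xiM v) = mop xiM (sop v)"
  using B.dvp_n_comm[of v] by (simp add: sop_def mop_xiM[of "B.dvp n v"] mop_xiM[of v])

text \<open>From Z\<gamma> = \<gamma>(a)^n \<gamma>Z and Z^2 = 0 follows (1 + Z)\<gamma> =
  \<gamma>(1 + (\<gamma>(a)^n - 1)Z)(1 + Z), where \<gamma>(1 + (\<gamma>(a)^n - 1)Z) is the action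
  of \<gamma> on \<open>T\<close>.\<close>

lemma sop_c:
  assumes v: "v \<in> fsp N" and g: "\<gamma> \<in> CC"
  shows "sop (mop (kcM \<gamma>) v) = app T (c_el \<gamma>) (sop v)"
proof (cases twisted)
  case True
  then have "\<not> nilpotent_type D" by (simp add: twisted_def)
  then show ?thesis using True v g
    by (simp add: T_c sop_def dvp_kc B.dvp_dvp sc_distrib)
next
  case False
  then have "nilpotent_type D \<or> \<gamma> a ^ n = 1" using g by (auto simp: twisted_def)
  then show ?thesis using False v g by (auto simp: T_c sop_def)
qed

text \<open>The commutator of the coproduct of x with Z is the correction term that separates x from
  y on \<open>M1\<close>, and Z annihilates that term.\<close>

lemma sop_x:
  assumes v: "v \<in> fsp N"
  shows "sop (app M1 x_el v) = mop xM (sop v)"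
proof (cases twisted)
  case True
  let ?z = "q *s mop (kgM a) (B.dvp (n - 1) v) - mop (kcM X) (B.dvp (n - 1) v)"
  have z: "B.dvp n ?z = 0"
    using v n2 by (simp add: dvp_kg dvp_kc B.dvp_dvp)
  have "mop xM (B.dvp n v) = B.dvp n (mop xM v) + ?z"
    unfolding mop_xM
    by (rule B.dvp_commutator[OF v, where H = H]) (use UW_n1 v in \<open>simp_all add: comms\<close>)
  then have 2: "mop xM (B.dvp n v) = B.dvp n (mop xM v) + ?z" .
  have e: "app M1 x_el v = mop xM v + ?z" unfolding M1_x[OF v] zop_dvp[OF v] using True by simp
  have "sop (mop xM v + ?z) = mop xM v + ?z + (B.dvp n (mop xM v) + B.dvp n ?z)"
    using True by (simp only: sop_def if_True sc_simps B.dvp_lin)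
  also have "\<dots> = mop xM v + mop xM (B.dvp n v)" unfolding z 2 add_0_right by (simp only: add_ac)
  also have "\<dots> = mop xM (sop v)" using True by (simp only: sop_def if_True sc_simps mop_add)
  finally show ?thesis unfolding e .
next
  case False
  then show ?thesis unfolding M1_x[OF v] zop_dvp[OF v] by (simp add: sop_def)
qed

lemma M1_module: "dd_module D M1"
proof (rule ddrep_dd_module[OF M1_pre])
  have t: "ddrep D N kgM kcM xiM (act M1 x_el)"
  proof (rule M.ddrep_twist[OF M_nilrep])
    show "act M1 x_el \<in> carrier_mat N N" using pre_carrier[OF M1_pre, of x_el] by simp
    fix v :: "nat \<Rightarrow> 'k" assume v: "v \<in> fsp N"
    show "app M1 x_el v = mop xM v + cw *s M.zop v" by (rule M1_x[OF v])
    \<comment> \<open>The power is computed through the bijection \<open>sop\<close>, which turns it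
      into a power of x on the tensor product, where x^n = 0.\<close>
    have m: "(app M1 x_el ^^ k) v \<in> fsp N \<and> sop ((app M1 x_el ^^ k) v) = (mop xM ^^ k) (sop v)" for k
      by (induction k) (use v app_fsp[OF M1_pre, of x_el] in \<open>auto simp: sop_x[simplified]\<close>)
    let ?z = "(app M1 x_el ^^ n) v"
    have "sop ?z = 0" using m[of n] xM_n[of "sop v"] v by simp
    then have "sinv (sop ?z) = 0" by (simp add: sinv_def B.dvp_def)
    moreover have "sinv (sop ?z) = ?z" by (rule sop_sinv(2)) (use m in blast)
    ultimately have 0: "?z = 0" by metis
    \<comment> \<open>In the nilpotent type \<alpha>(a^n - 1) = 0; otherwise every weight occurring
      here takes the value 1 on a^n.\<close>
    have "alp D *s (mop (kgM (a [^]\<^bsub>grp D\<^esub> n)) v - v) = 0"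
    proof (rule ten_ext[OF _ _ v])
      fix i j assume ij: "i < l" "j < l'"
      let ?v = "te (bas i) (bas j)"
      let ?lg = "\<lambda>g. upg i V1.lg g * upg j V2.lg g" and ?lc = "\<lambda>\<gamma>. upc i V1.lc \<gamma> * upc j V2.lc \<gamma>"
      have w: "M.wt ?lg ?lc ?v"
        using ij by (auto simp: M.wt_def M_te V1.V_bas V2.V_bas mult.commute)
      have "nilpotent_type D \<or> ?lg a ^ n = 1"
        using charw_pow_n[OF V1.cw V1.\<mu>L] charw_pow_n[OF V2.cw V2.\<mu>L]
        by (auto simp: shift_a power_mult_distrib power_mult[symmetric] power_inverse mult.commute[of _ n] power_mult[of q n])
      then show "alp D *s (mop (kgM (a [^]\<^bsub>grp D\<^esub> n)) ?v - ?v) = 0"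
      proof
        assume "nilpotent_type D"
        then show ?thesis using M.kg_one[OF M.wtD(1)[OF w]] by (auto simp: nilpotent_type_def)
      qed (simp add: M.kg_pow[OF w closed(1)])
    qed auto
    then show "(app M1 x_el ^^ n) v = alp D *s (mop (kgM (a [^]\<^bsub>grp D\<^esub> n)) v - v)" using 0 by simp
  qed
  show "ddrep D (mdim M1) (mg M1) (mc M1) (act M1 xi_el) (act M1 x_el)"
    using t unfolding M1_act rep_mod_simps(1) .
qed

lemma T_iso: "dd_iso D T M1"
proof -
  define F where "F = cols_mat N N (\<lambda>j. sinv (bas j))"
  define E where "E = cols_mat N N (\<lambda>j. sop (bas j))"
  have F: "mop F v = sinv v" and E: "mop E v = sop v" if "v \<in> fsp N" for v
    by (rule lin_ext[OF _ _ _ that]; use that in \<open>auto simp: F_def E_def mop_cols_mat\<close>)+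
  have c: "F \<in> carrier_mat N N" "E \<in> carrier_mat N N" by (simp_all add: F_def E_def)
  have g: "sop (app M1 (Gen z) v) = app T (Gen z) (sop v)" if "z \<in> dd_gens D" "v \<in> fsp N" for z v
    using that(1) sop_g[OF that(2)] sop_c[OF that(2)] sop_xi[OF that(2)] sop_x[OF that(2)]
    by (auto simp: dd_gens_def T_g T_xi T_x)
  have F_hom: "F \<in> dd_hom D T M1"
  proof (rule dd_homI[OF T_pre M1_pre])
    show "F \<in> carrier_mat (mdim M1) (mdim T)" using c by simp
    fix z and v :: "nat \<Rightarrow> 'k" assume z: "z \<in> dd_gens D" and "v \<in> fsp (mdim T)"
    then have v: "v \<in> fsp N" by simp
    have "sop (app M1 (Gen z) (sinv v)) = app T (Gen z) v"
      using g[OF z, of "sinv v"] v by (simp add: sop_sinv)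
    then have "sinv (app T (Gen z) v) = app M1 (Gen z) (sinv v)"
      using sop_sinv(2)[of "app M1 (Gen z) (sinv v)"] app_fsp[OF M1_pre, of "Gen z"] z by (metis rep_mod_simps(1) terms_simps(2))
    then show "mop F (app T (Gen z) v) = app M1 (Gen z) (mop F v)"
      using F[of "app T (Gen z) v"] F[OF v] app_fsp[OF T_pre, of "Gen z" v] z by simp
  qed
  have EF: "E * F = 1\<^sub>m N" and FE: "F * E = 1\<^sub>m N"
    by (rule mop_eqI_fsp[of _ N N]; use c in \<open>simp add: mop_mult[OF c(2,1)] mop_mult[OF c] E F sop_sinv mop_one\<close>)+
  have T: "dd_module D T"
  proof (rule dd_module_embedded[OF M1_module T_pre F_hom])
    fix v assume "v \<in> fsp (mdim T)" "mop F v = 0"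
    then show "v = 0" using F[of v] sop_sinv(1)[of v] by (simp add: sop_def B.dvp_def)
  qed
  show ?thesis by (rule dd_isoI[OF T M1_module F_hom, of E]) (use c EF FE in simp_all)
qed

end

section \<open>Embeddings with prescribed support\<close>

text \<open>The function \<open>dg\<close> is a grading of the basis of \<open>M\<close>. For disjoint \<open>S\<close> the sum of such submodules is
  direct, since a nonzero module with a nilpotent action of \<open>\<xi>\<close> contains nonzero vectors killed by
  \<open>\<xi>\<close>.\<close>

definition emb :: "('g, 'k::field) group_datum \<Rightarrow> ('g, 'k) ddmod \<Rightarrow> (nat \<Rightarrow> nat) \<Rightarrow> ('g, 'k) ddmod \<Rightarrow> nat set \<Rightarrow> bool" where
  "emb D M dg N S \<longleftrightarrow> dd_module D N \<and> (\<exists>F\<in>dd_hom D N M.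
     (\<forall>v\<in>fsp (mdim N). mop F v = 0 \<longrightarrow> v = 0) \<and>
     (\<forall>v\<in>fsp (mdim N). app N xi_el v = 0 \<longrightarrow> (\<forall>k. mop F v k \<noteq> 0 \<longrightarrow> dg k \<in> S)))"

lemma XiGen_gens [simp]: "XiGen \<in> dd_gens D"
  by (simp add: dd_gens_def)

text \<open>The kernel of \<open>F\<close> is stable under \<xi>; were it nonzero, the last nonzero
  vector among the \<xi>^k v would be a nonzero element of it killed by \<xi>.\<close>

lemma inj_if_inj_on_xi_kernel:
  assumes N: "pre_module D N" and M: "pre_module D M" and F: "F \<in> dd_hom D N M"
    and nil: "\<And>v. v \<in> fsp (mdim N) \<Longrightarrow> \<exists>k. (app N xi_el ^^ k) v = 0"
    and ker: "\<And>v. v \<in> fsp (mdim N) \<Longrightarrow> app N xi_el v = 0 \<Longrightarrow> mop F v = 0 \<Longrightarrow> v = 0"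
    and v: "v \<in> fsp (mdim N)" "mop F v = 0"
  shows "v = 0"
proof -
  have "v = 0" if "(app N xi_el ^^ k) v = 0" "v \<in> fsp (mdim N)" "mop F v = 0" for k v
    using that
  proof (induction k arbitrary: v)
    case (Suc k)
    have "app N xi_el v = 0"
    proof (rule Suc.IH)
      show "(app N xi_el ^^ k) (app N xi_el v) = 0" using Suc.prems(1) by (simp add: funpow_swap1)
      show "app N xi_el v \<in> fsp (mdim N)" by (rule app_fsp[OF N]) simp
      show "mop F (app N xi_el v) = 0" using dd_hom_app[OF N M F, of xi_el v] Suc.prems(3) by simp
    qed
    then show ?case using ker Suc.prems by blast
  qed simp
  then show ?thesis using nil v by blast
qed

text \<open>\<open>N\<close> is only a \<open>pre_module\<close> and nilpotency of \<xi> is a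
  separate premise; that \<open>N\<close> is a module is part of the conclusion.\<close>

lemma embI:
  assumes M: "dd_module D M" and N: "pre_module D N" and F: "F \<in> dd_hom D N M"
    and nil: "\<And>v. v \<in> fsp (mdim N) \<Longrightarrow> \<exists>k. (app N xi_el ^^ k) v = 0"
    and ker: "\<And>v. v \<in> fsp (mdim N) \<Longrightarrow> app N xi_el v = 0 \<Longrightarrow> mop F v = 0 \<Longrightarrow> v = 0"
    and supp: "\<And>v k. v \<in> fsp (mdim N) \<Longrightarrow> app N xi_el v = 0 \<Longrightarrow> mop F v k \<noteq> 0 \<Longrightarrow> dg k \<in> S"
  shows "emb D M dg N S"
proof -
  have inj: "v = 0" if "v \<in> fsp (mdim N)" "mop F v = 0" for v
    by (rule inj_if_inj_on_xi_kernel[OF N dd_module_pre[OF M] F nil ker that])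
  have "dd_module D N" by (rule dd_module_embedded[OF M N F inj])
  then show ?thesis using F inj supp unfolding emb_def by blast
qed

context datum
begin

lemma module_xi_n:
  fixes M :: "('g, 'k) ddmod"
  shows "dd_module D M \<Longrightarrow> v \<in> fsp (mdim M) \<Longrightarrow> (app M xi_el ^^ n) v = 0"
proof -
  assume M: "dd_module D M" and v: "v \<in> fsp (mdim M)"
  interpret ddrep D "mdim M" "mg M" "mc M" "act M xi_el" "act M x_el" by (rule dd_module_ddrep[OF M])
  show ?thesis by (rule xi_n[OF v])
qed

lemma emb_Nil:
  fixes M :: "('g, 'k) ddmod"
  assumes M: "dd_module D M"
  shows "emb D M dg (dd_sum []) {}"
proof -
  have f: "v = 0" if "v \<in> fsp 0" for v :: "nat \<Rightarrow> 'k" using that by (auto simp: fsp_def fun_eq_iff ptw)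
  have "0\<^sub>m (mdim M) 0 \<in> dd_hom D (dd_sum []) M"
  proof (rule dd_homI[OF dd_module_pre[OF pre_module_dd_sum_Nil] dd_module_pre[OF M]])
    fix w :: "nat \<Rightarrow> 'k" and x assume "w \<in> fsp (mdim (dd_sum [] :: ('g, 'k) ddmod))"
    then have "w = 0" using f by simp
    then show "mop (0\<^sub>m (mdim M) 0) (app (dd_sum []) (Gen x) w) = app M (Gen x) (mop (0\<^sub>m (mdim M) 0) w)"
      by simp
  qed simp
  moreover have "v = 0" if "v \<in> fsp (mdim (dd_sum [] :: ('g, 'k) ddmod))" for v :: "nat \<Rightarrow> 'k"
    using that f by simp
  moreover have "mop (0\<^sub>m (mdim M) 0) v = 0" for v :: "nat \<Rightarrow> 'k"
    by (auto simp: mop_def fun_eq_iff ptw)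
  ultimately show ?thesis unfolding emb_def using pre_module_dd_sum_Nil
    by (intro conjI bexI[of _ "0\<^sub>m (mdim M) 0"] ballI impI allI) (auto simp: ptw)
qed

lemma emb_Cons:
  fixes M N :: "('g, 'k) ddmod"
  assumes M: "dd_module D M" and e1: "emb D M dg N S" and e2: "emb D M dg (dd_sum Ns) S'" and d: "S \<inter> S' = {}"
  shows "emb D M dg (dd_sum (N # Ns)) (S \<union> S')"
proof -
  let ?a = "mdim N" and ?N = "dd_sum Ns" and ?S = "dd_sum (N # Ns)"
  obtain F where N: "dd_module D N" and F: "F \<in> dd_hom D N M"
      "\<And>v. v \<in> fsp ?a \<Longrightarrow> mop F v = 0 \<Longrightarrow> v = 0"
      "\<And>v k. v \<in> fsp ?a \<Longrightarrow> app N xi_el v = 0 \<Longrightarrow> mop F v k \<noteq> 0 \<Longrightarrow> dg k \<in> S"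
    using e1 unfolding emb_def by blast
  obtain E where Ns: "dd_module D ?N" and E: "E \<in> dd_hom D ?N M"
      "\<And>v. v \<in> fsp (mdim ?N) \<Longrightarrow> mop E v = 0 \<Longrightarrow> v = 0"
      "\<And>v k. v \<in> fsp (mdim ?N) \<Longrightarrow> app ?N xi_el v = 0 \<Longrightarrow> mop E v k \<noteq> 0 \<Longrightarrow> dg k \<in> S'"
    using e2 unfolding emb_def by blast
  have SS: "dd_module D ?S" by (rule dd_module_dd_sum_Cons[OF N Ns])
  note pN = dd_module_pre[OF N] and pNs = dd_module_pre[OF Ns] and pM = dd_module_pre[OF M] and pS = dd_module_pre[OF SS]
  note cF = dd_hom_carrier[OF F(1)] and cE = dd_hom_carrier[OF E(1)]
  note app = app_dd_sum_Cons[OF pN pNs]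
  define lo where "lo v = (\<lambda>i. if i < ?a then v i else 0)" for v :: "nat \<Rightarrow> 'k"
  have lo0: "lo 0 = 0" by (auto simp: lo_def fun_eq_iff ptw)
  have lo_fsp: "lo v \<in> fsp ?a" for v by (auto simp: lo_def fsp_def)
  have hi_fsp': "hi ?a v \<in> fsp (mdim ?N)" if "v \<in> fsp (mdim ?S)" for v :: "nat \<Rightarrow> 'k"
    using that by (intro hi_fsp) simp
  have trunc: "mop A v = mop A (lo v)" if "A \<in> carrier_mat b ?a" for A :: "'k mat" and b v
    using that by (auto simp: mop_def fun_eq_iff lo_def)
  define K where "K = cols_mat (mdim M) (mdim ?S) (\<lambda>j. if j < ?a then mop F (bas j) else mop E (bas (j - ?a)))"
  have cK: "K \<in> carrier_mat (mdim M) (mdim ?S)" by (simp add: K_def)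
  have K: "mop K v = mop F (lo v) + mop E (hi ?a v)" if v: "v \<in> fsp (mdim ?S)" for v
  proof (rule lin_ext[OF _ _ _ v])
    show "lin (mop K)" by (auto simp: lin_def)
    have "lo (v + w) = lo v + lo w" "lo (c *s v) = c *s lo v" "hi ?a (c *s v) = c *s hi ?a v" for v w :: "nat \<Rightarrow> 'k" and c
      by (auto simp: lo_def hi_def fun_eq_iff ptw)
    then show "lin (\<lambda>v. mop F (lo v) + mop E (hi ?a v))"
      by (auto simp: lin_def sc_distrib add_ac)
    fix j assume j: "j < mdim ?S"
    have 1: "lo (bas j) = (if j < ?a then bas j else 0)" "hi ?a (bas j) = (if j < ?a then 0 else bas (j - ?a))"
      by (auto simp: lo_def hi_def bas_def fun_eq_iff ptw)
    show "mop K (bas j) = mop F (lo (bas j)) + mop E (hi ?a (bas j))"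
      unfolding 1 using j mop_fsp[OF cF] mop_fsp[OF cE] by (auto simp: K_def mop_cols_mat)
  qed
  have split: "lo (app ?S u v) = app N u (lo v)" "hi ?a (app ?S u v) = app ?N u (hi ?a v)" if "u \<in> dd_terms D" for u v
    using that trunc[OF pre_carrier[OF pN that], of v] app_fsp[OF pN that, of v]
    by (auto simp: app lo_def hi_def fun_eq_iff fsp_def)
  have hom: "K \<in> dd_hom D ?S M"
  proof (rule dd_homI[OF pS pM cK])
    fix x and v :: "nat \<Rightarrow> 'k" assume x: "x \<in> dd_gens D" and v: "v \<in> fsp (mdim ?S)"
    then have "app ?S (Gen x) v \<in> fsp (mdim ?S)" by (intro app_fsp[OF pS]) simp
    then show "mop K (app ?S (Gen x) v) = app M (Gen x) (mop K v)"
      using x v by (simp only: K split terms_simps mop_add dd_hom_app[OF pN pM F(1)] dd_hom_app[OF pNs pM E(1)])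
  qed
  show ?thesis
  proof (rule embI[OF M pS hom])
    fix v :: "nat \<Rightarrow> 'k" assume v: "v \<in> fsp (mdim ?S)"
    show "\<exists>k. (app ?S xi_el ^^ k) v = 0" using module_xi_n[OF SS v] by blast
    assume z: "app ?S xi_el v = 0"
    have zl: "app N xi_el (lo v) = 0" "app ?N xi_el (hi ?a v) = 0"
      using split(1)[of xi_el v, symmetric] split(2)[of xi_el v, symmetric] unfolding z lo0 hi_simps by simp_all
    note f = F(3)[OF lo_fsp zl(1)] and e = E(3)[OF hi_fsp'[OF v] zl(2)]
    show "dg k \<in> S \<union> S'" if "mop K v k \<noteq> 0" for k
    proof -
      have "mop F (lo v) k + mop E (hi ?a v) k \<noteq> 0" using that by (simp add: K[OF v] ptw)
      then have "mop F (lo v) k \<noteq> 0 \<or> mop E (hi ?a v) k \<noteq> 0" by (metis add_0_left)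
      then show ?thesis using f[of k] e[of k] by blast
    qed
    assume k: "mop K v = 0"
    \<comment> \<open>The two terms are supported in the disjoint sets of degrees \<open>S\<close>
      and \<open>S'\<close>, so they cannot cancel.\<close>
    have "mop F (lo v) k = 0 \<and> mop E (hi ?a v) k = 0" for k
    proof -
      have "mop F (lo v) k + mop E (hi ?a v) k = 0" using fun_cong[OF k, of k] by (simp add: K[OF v] ptw)
      then show ?thesis using f[of k] e[of k] d by (metis add.left_neutral add.right_neutral disjoint_iff)
    qed
    then have "mop F (lo v) = 0" "mop E (hi ?a v) = 0" by (auto simp: fun_eq_iff ptw)
    then have "lo v = 0" "hi ?a v = 0" using F(2)[OF lo_fsp] E(2)[OF hi_fsp'[OF v]] by auto
    then have "lo v i = 0" "hi ?a v i = 0" for i by (simp_all add: ptw)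
    then have "v i = 0" for i
    proof (cases "i < ?a")
      case False
      then show ?thesis using \<open>\<And>i. hi ?a v i = 0\<close>[of "i - ?a"] by (simp add: hi_def)
    qed (metis lo_def)
    then show "v = 0" by (auto simp: fun_eq_iff ptw)
  qed
qed

lemma emb_list:
  fixes M :: "('g, 'k) ddmod"
  assumes M: "dd_module D M" and "distinct xs" and "\<And>s. s \<in> set xs \<Longrightarrow> emb D M dg (N s) (S s)"
    and "\<And>s s'. s \<in> set xs \<Longrightarrow> s' \<in> set xs \<Longrightarrow> s \<noteq> s' \<Longrightarrow> S s \<inter> S s' = {}"
  shows "emb D M dg (dd_sum (map N xs)) (\<Union>s\<in>set xs. S s)"
  using assms(2-)
proof (induction xs)
  case Nil
  show ?case using emb_Nil[OF M, of dg] by simp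
next
  case (Cons x xs)
  have "emb D M dg (dd_sum (map N xs)) (\<Union>s\<in>set xs. S s)"
    by (rule Cons.IH) (use Cons.prems in auto)
  moreover have "S x \<inter> (\<Union>s\<in>set xs. S s) = {}"
  proof -
    have "S x \<inter> S s = {}" if "s \<in> set xs" for s
      using Cons.prems(1) that by (intro Cons.prems(3)) auto
    then show ?thesis by blast
  qed
  ultimately show ?case using emb_Cons[OF M Cons.prems(2)[of x]] by simp
qed

lemma emb_pair:
  fixes M :: "('g, 'k) ddmod"
  assumes M: "dd_module D M" and "emb D M dg A S" "emb D M dg B S'" "S \<inter> S' = {}"
  shows "emb D M dg (dd_sum [A, B]) (S \<union> S')"
  using emb_Cons[OF M assms(2) emb_Cons[OF M assms(3) emb_Nil[OF M]]] assms(4) by simp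

text \<open>Needed because \<open>P_mod\<close> is a chosen projective cover, identified with
  \<open>P_ex\<close> only up to isomorphism.\<close>

lemma emb_iso:
  fixes M A B :: "('g, 'k) ddmod"
  assumes M: "dd_module D M" and A: "emb D M dg A S" and i: "dd_iso D B A"
  shows "emb D M dg B S"
proof -
  obtain F where mA: "dd_module D A" and F: "F \<in> dd_hom D A M"
      "\<And>v. v \<in> fsp (mdim A) \<Longrightarrow> mop F v = 0 \<Longrightarrow> v = 0"
      "\<And>v k. v \<in> fsp (mdim A) \<Longrightarrow> app A xi_el v = 0 \<Longrightarrow> mop F v k \<noteq> 0 \<Longrightarrow> dg k \<in> S"
    using A unfolding emb_def by blast
  obtain J K where mB: "dd_module D B" and J: "J \<in> dd_hom D B A" "K \<in> dd_hom D A B" "K * J = 1\<^sub>m (mdim B)"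
    using i unfolding dd_iso_def by blast
  note p = dd_module_pre[OF M] dd_module_pre[OF mA] dd_module_pre[OF mB]
  note cJ = dd_hom_carrier[OF J(1)] and cK = dd_hom_carrier[OF J(2)] and cF = dd_hom_carrier[OF F(1)]
  have FJ: "mop (F * J) v = mop F (mop J v)" for v by (rule mop_mult[OF cF cJ])
  have Jd: "mop J v \<in> fsp (mdim A)" for v by (rule mop_fsp[OF cJ])
  have "v = 0" if "v \<in> fsp (mdim B)" "mop (F * J) v = 0" for v
  proof -
    have "mop J v = 0" using that(2) F(2)[OF Jd] by (simp add: FJ)
    then have "mop (K * J) v = 0" by (simp add: mop_mult[OF cK cJ])
    then show ?thesis using J(3) mop_one[OF that(1)] by simp
  qed
  moreover have "dg k \<in> S" if "app B xi_el v = 0" "mop (F * J) v k \<noteq> 0" for v k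
    using F(3)[OF Jd, of v k] dd_hom_app[OF p(3,2) J(1), of xi_el v] that by (simp add: FJ)
  ultimately show ?thesis
    unfolding emb_def using mB dd_hom_comp[OF p(3,2,1) J(1) F(1)] by blast
qed

lemma emb_dd_iso:
  fixes M B :: "('g, 'k) ddmod"
  assumes M: "dd_module D M" and B: "emb D M dg B S" and d: "mdim B = mdim M"
  shows "dd_iso D M B"
proof -
  obtain F where mB: "dd_module D B" and F: "F \<in> dd_hom D B M"
      "\<And>v. v \<in> fsp (mdim B) \<Longrightarrow> mop F v = 0 \<Longrightarrow> v = 0"
    using B unfolding emb_def by blast
  have "F \<in> carrier_mat (mdim B) (mdim B)" using dd_hom_carrier[OF F(1)] d by simp
  from inverse_of_inj[OF this F(2)] obtain E where "E \<in> carrier_mat (mdim B) (mdim B)"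
      "F * E = 1\<^sub>m (mdim B)" "E * F = 1\<^sub>m (mdim B)" by blast
  then have "dd_iso D B M" using dd_isoI[OF mB M F(1), of E] d by simp
  then show ?thesis by (rule dd_iso_sym)
qed

end

section \<open>Highest weight vectors in the tensor product\<close>

context tens
begin

interpretation N1: nilrep D l "mg V1.V" "mc V1.V" xi1 x1 by (rule V1.V_nilrep)
interpretation N2: nilrep D l' "mg V2.V" "mc V2.V" xi2 x2 by (rule V2.V_nilrep)
interpretation M: nilrep D N kgM kcM xiM xM by (rule M_nilrep)

abbreviation "al1 \<equiv> alq (V1.lg a) (V1.lc X)"
abbreviation "al2 \<equiv> alq (V2.lg a) (V2.lc X)"

lemma lin_const: "(\<And>f g. R (f + g) = R f + R g) \<Longrightarrow> (\<And>c f. R (c *s f) = c * R f) \<Longrightarrow> lin (\<lambda>v _. R v)"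
  by (auto simp: lin_def fun_eq_iff ptw)

lemma linear_form_ext:
  fixes R S :: "(nat \<Rightarrow> 'k) \<Rightarrow> 'k"
  assumes "v \<in> fsp N" "\<And>i j. i < l \<Longrightarrow> j < l' \<Longrightarrow> R (te (bas i) (bas j)) = S (te (bas i) (bas j))"
    "\<And>f g. R (f + g) = R f + R g" "\<And>c f. R (c *s f) = c * R f"
    "\<And>f g. S (f + g) = S f + S g" "\<And>c f. S (c *s f) = c * S f"
  shows "R v = S v"
proof -
  have "(\<lambda>_ :: nat. R v) = (\<lambda>_. S v)"
    by (rule ten_ext[OF lin_const lin_const assms(1)]) (use assms in auto)
  then show ?thesis by (rule fun_cong)
qed

lemma xi_at:
  assumes v: "v \<in> fsp N" and ij: "i < l" "j < l'"
  shows "mop xiM v (i * l' + j) = (if Suc i < l then al1 (Suc i) * v (Suc i * l' + j) else 0) +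
    (if Suc j < l' then V1.lc X * q ^ i * al2 (Suc j) * v (i * l' + Suc j) else 0)"
proof (rule linear_form_ext[OF v])
  fix i2 j2 assume ij2: "i2 < l" "j2 < l'"
  have "mop xiM (te (bas i2) (bas j2)) (i * l' + j) =
      al1 i2 * (bas (i2 - 1) i * bas j2 j) + (V1.lc X * q ^ i2 * al2 j2) * (bas i2 i * bas (j2 - 1) j)"
    using ij2 ij by (simp add: mop_xiM M_te V1.V_bas V2.V_bas ptw ten_grid shift_a)
  moreover have "al1 i2 * (bas (i2 - 1) i * bas j2 j) =
      (if Suc i < l then al1 (Suc i) * te (bas i2) (bas j2) (Suc i * l' + j) else 0)"
    using ij2 ij ten_grid[of "Suc i" l j l' "bas i2 :: nat \<Rightarrow> 'k" "bas j2"] by (cases i2) (auto simp: bas_def simp del: mult_Suc)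
  moreover have "V1.lc X * q ^ i2 * al2 j2 * (bas i2 i * bas (j2 - 1) j) =
      (if Suc j < l' then V1.lc X * q ^ i * al2 (Suc j) * te (bas i2) (bas j2) (i * l' + Suc j) else 0)"
    using ij2 ij ten_grid[of i l "Suc j" l' "bas i2 :: nat \<Rightarrow> 'k" "bas j2"] by (cases j2) (auto simp: bas_def simp del: add_Suc_right)
  ultimately show "mop xiM (te (bas i2) (bas j2)) (i * l' + j) =
      (if Suc i < l then al1 (Suc i) * te (bas i2) (bas j2) (Suc i * l' + j) else 0) +
      (if Suc j < l' then V1.lc X * q ^ i * al2 (Suc j) * te (bas i2) (bas j2) (i * l' + Suc j) else 0)"
    by simp
qed ((simp_all only: mop_add mop_sc)?, (simp_all only: ptw)?, simp_all add: algebra_simps)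

lemma x_at:
  assumes v: "v \<in> fsp N" and ij: "i < l" "j < l'"
  shows "mop xM v (i * l' + j) = (if 0 < i then V2.lg a * inverse q ^ j * v ((i - 1) * l' + j) else 0) +
    (if 0 < j then v (i * l' + (j - 1)) else 0)"
proof (rule linear_form_ext[OF v])
  fix i2 j2 assume ij2: "i2 < l" "j2 < l'"
  have "mop xM (te (bas i2) (bas j2)) (i * l' + j) =
      V2.lg a * inverse q ^ j2 * ((if Suc i2 < l then bas (Suc i2) i else 0) * bas j2 j) +
      bas i2 i * (if Suc j2 < l' then bas (Suc j2) j else 0)"
    using ij2 ij by (simp add: mop_xM M_te V1.V_bas V2.V_bas ptw ten_grid shift_a)
  moreover have "V2.lg a * inverse q ^ j2 * ((if Suc i2 < l then bas (Suc i2) i else 0) * bas j2 j) =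
      (if 0 < i then V2.lg a * inverse q ^ j * te (bas i2) (bas j2) ((i - 1) * l' + j) else 0)"
    using ij2 ij ten_grid[of "i - 1" l j l' "bas i2 :: nat \<Rightarrow> 'k" "bas j2"] by (cases i) (auto simp: bas_def)
  moreover have "bas i2 i * (if Suc j2 < l' then bas (Suc j2) j else 0) =
      (if 0 < j then te (bas i2) (bas j2) (i * l' + (j - 1)) else 0)"
    unfolding ten_grid[OF ij(1) less_imp_diff_less[OF ij(2)]]
    using ij by (cases j) (auto simp: bas_def)
  ultimately show "mop xM (te (bas i2) (bas j2)) (i * l' + j) =
      (if 0 < i then V2.lg a * inverse q ^ j * te (bas i2) (bas j2) ((i - 1) * l' + j) else 0) +
      (if 0 < j then te (bas i2) (bas j2) (i * l' + (j - 1)) else 0)"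
    by simp
qed ((simp_all only: mop_add mop_sc)?, (simp_all only: ptw)?, simp_all add: algebra_simps)

definition dgr :: "nat \<Rightarrow> (nat \<Rightarrow> 'k) \<Rightarrow> bool" where
  "dgr s v \<longleftrightarrow> v \<in> fsp N \<and> (\<forall>i<l. \<forall>j<l'. i + j \<noteq> s \<longrightarrow> v (i * l' + j) = 0)"

definition dg :: "nat \<Rightarrow> nat" where
  "dg k = k div l' + k mod l'"

lemma grid_zeroI:
  assumes "v \<in> fsp N" "\<And>i j. i < l \<Longrightarrow> j < l' \<Longrightarrow> v (i * l' + j) = 0"
  shows "v = 0"
proof
  fix k
  show "v k = 0 k"
  proof (cases "k < N")
    case True
    then show ?thesis using assms(2)[of "k div l'" "k mod l'"] grid_div[OF True] by (simp add: ptw)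
  qed (use assms(1) in \<open>auto simp: fsp_def ptw\<close>)
qed

lemma dgrD: "dgr s v \<Longrightarrow> v \<in> fsp N" "dgr s v \<Longrightarrow> i < l \<Longrightarrow> j < l' \<Longrightarrow> i + j \<noteq> s \<Longrightarrow> v (i * l' + j) = 0"
  by (auto simp: dgr_def)

lemma dgr_dg: "dgr s v \<Longrightarrow> v k \<noteq> 0 \<Longrightarrow> dg k = s"
proof -
  assume v: "dgr s v" and k: "v k \<noteq> 0"
  have kN: "k < N"
  proof (rule ccontr)
    assume "\<not> k < N"
    then show False using dgrD(1)[OF v] k by (simp add: fsp_def)
  qed
  show ?thesis
  proof (rule ccontr)
    assume "dg k \<noteq> s"
    then have "v (k div l' * l' + k mod l') = 0"
      using grid_div[OF kN] by (intro dgrD(2)[OF v]) (simp_all add: dg_def)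
    then show False using k by simp
  qed
qed

lemma dgr_x: "dgr s v \<Longrightarrow> dgr (Suc s) (mop xM v)"
proof -
  assume v: "dgr s v"
  have "mop xM v (i * l' + j) = 0" if "i < l" "j < l'" "i + j \<noteq> Suc s" for i j
  proof -
    have "v ((i - 1) * l' + j) = 0" if "0 < i" using that \<open>i < l\<close> \<open>j < l'\<close> \<open>i + j \<noteq> Suc s\<close> by (intro dgrD(2)[OF v]) auto
    moreover have "v (i * l' + (j - 1)) = 0" if "0 < j" using that \<open>i < l\<close> \<open>j < l'\<close> \<open>i + j \<noteq> Suc s\<close> by (intro dgrD(2)[OF v]) auto
    ultimately show ?thesis unfolding x_at[OF dgrD(1)[OF v] that(1,2)] by (cases "j = 0") simp_all
  qed
  then show ?thesis by (simp add: dgr_def)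
qed

lemma dgr_x_pow: "dgr s v \<Longrightarrow> dgr (s + k) ((mop xM ^^ k) v)"
  by (induction k) (auto dest: dgr_x)

lemma dgr_wt:
  assumes v: "dgr s v"
  shows "M.wt (upg s (\<lambda>g. V1.lg g * V2.lg g)) (upc s (\<lambda>\<gamma>. V1.lc \<gamma> * V2.lc \<gamma>)) v"
proof -
  have vN: "v \<in> fsp N" by (rule dgrD(1)[OF v])
  have g: "mop (kgM g) v (i * l' + j) = (upg i V1.lg g * upg j V2.lg g) * v (i * l' + j)"
    if g: "g \<in> GG" and ij: "i < l" "j < l'" for g i j
  proof (rule linear_form_ext[OF vN])
    fix i2 j2 assume "i2 < l" "j2 < l'"
    then show "mop (kgM g) (te (bas i2) (bas j2)) (i * l' + j) = (upg i V1.lg g * upg j V2.lg g) * te (bas i2) (bas j2) (i * l' + j)"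
      using g ij by (simp add: M_te V1.V_bas V2.V_bas ptw ten_grid) (auto simp: bas_def)
  qed ((simp_all only: mop_add mop_sc)?, (simp_all only: ptw)?, simp_all add: algebra_simps)
  have c: "mop (kcM g) v (i * l' + j) = (upc i V1.lc g * upc j V2.lc g) * v (i * l' + j)"
    if g: "g \<in> CC" and ij: "i < l" "j < l'" for g i j
  proof (rule linear_form_ext[OF vN])
    fix i2 j2 assume "i2 < l" "j2 < l'"
    then show "mop (kcM g) (te (bas i2) (bas j2)) (i * l' + j) = (upc i V1.lc g * upc j V2.lc g) * te (bas i2) (bas j2) (i * l' + j)"
      using g ij by (simp add: M_te V1.V_bas V2.V_bas ptw ten_grid) (auto simp: bas_def)
  qed ((simp_all only: mop_add mop_sc)?, (simp_all only: ptw)?, simp_all add: algebra_simps)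
  have "mop (kgM g) v - upg s (\<lambda>g. V1.lg g * V2.lg g) g *s v = 0" if "g \<in> GG" for g
  proof (rule grid_zeroI)
    fix i j assume ij: "i < l" "j < l'"
    show "(mop (kgM g) v - upg s (\<lambda>g. V1.lg g * V2.lg g) g *s v) (i * l' + j) = 0"
    proof (cases "i + j = s")
      case True
      then show ?thesis using g[OF that ij] by (auto simp: ptw upg_def power_add)
    next
      case False
      then show ?thesis using g[OF that ij] dgrD(2)[OF v ij] by (simp add: ptw)
    qed
  qed (use vN in auto)
  moreover have "mop (kcM g) v - upc s (\<lambda>g. V1.lc g * V2.lc g) g *s v = 0" if "g \<in> CC" for g
  proof (rule grid_zeroI)
    fix i j assume ij: "i < l" "j < l'"
    show "(mop (kcM g) v - upc s (\<lambda>g. V1.lc g * V2.lc g) g *s v) (i * l' + j) = 0"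
    proof (cases "i + j = s")
      case True
      then show ?thesis using c[OF that ij] by (auto simp: ptw upc_def power_add)
    next
      case False
      then show ?thesis using c[OF that ij] dgrD(2)[OF v ij] by (simp add: ptw)
    qed
  qed (use vN in auto)
  ultimately show ?thesis using vN by (simp add: M.wt_def)
qed

lemma al1_nz: "0 < i \<Longrightarrow> i < l \<Longrightarrow> al1 i \<noteq> 0" and al2_nz: "0 < i \<Longrightarrow> i < l' \<Longrightarrow> al2 i \<noteq> 0"
  using alq_nz[OF V1.\<mu>L, of i] alq_nz[OF V2.\<mu>L, of i] charwD(2)[OF V1.cw closed(2)] charwD(2)[OF V2.cw closed(2)]
    V1.L V2.L by auto

lemma lc1: "V1.lc X \<noteq> 0"
  using charwD(2)[OF V1.cw closed(2)] .

text \<open>Since s < l \<le> l', the whole antidiagonal i + j = s lies in the grid. Each coordinate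
  of degree s - 1 relates two neighbouring coefficients, and as the constants \<open>al1\<close> are
  nonzero, these equations are solved upwards from the free coefficient c at i = 0, whose position
  in the vector is s.\<close>

lemma xi_solve:
  assumes s: "s < l" and z: "s = 0 \<Longrightarrow> z = 0" "0 < s \<Longrightarrow> dgr (s - 1) z"
  shows "\<exists>w. dgr s w \<and> mop xiM w = z \<and> w s = c"
proof -
  define r where "r = rec_nat c (\<lambda>i b. (z (i * l' + (s - 1 - i)) - V1.lc X * q ^ i * al2 (s - i) * b) / al1 (Suc i))"
  have r: "r 0 = c" "r (Suc i) = (z (i * l' + (s - 1 - i)) - V1.lc X * q ^ i * al2 (s - i) * r i) / al1 (Suc i)" for i
    by (simp_all add: r_def)
  define w where "w = (\<lambda>k. if k < N \<and> dg k = s then r (k div l') else 0)"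
  have w: "w (i * l' + j) = (if i + j = s then r i else 0)" if "i < l" "j < l'" for i j
    using that grid_less[OF that] by (simp add: w_def dg_def)
  have wd: "dgr s w" using w by (auto simp: dgr_def w_def fsp_def)
  have "mop xiM w - z = 0"
  proof (rule grid_zeroI)
    have "z \<in> fsp N" using z dgrD(1)[of "s - 1" z] by (cases "s = 0") auto
    then show "mop xiM w - z \<in> fsp N" by simp
    fix i j assume ij: "i < l" "j < l'"
    show "(mop xiM w - z) (i * l' + j) = 0"
    proof (cases "Suc (i + j) = s")
      case True
      then have a: "Suc i < l" "Suc j < l'" "s - i = Suc j" "s - 1 - i = j" using s ll by auto
      have "mop xiM w (i * l' + j) = al1 (Suc i) * r (Suc i) + V1.lc X * q ^ i * al2 (Suc j) * r i"
        using xi_at[OF dgrD(1)[OF wd] ij] a True w[of "Suc i" j] w[of i "Suc j"] ij by simp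
      moreover have "r (Suc i) = (z (i * l' + j) - V1.lc X * q ^ i * al2 (Suc j) * r i) / al1 (Suc i)"
        using r(2)[of i] unfolding a(3,4) .
      ultimately show ?thesis using al1_nz[of "Suc i"] a(1) by (simp add: ptw)
    next
      case False
      have "z (i * l' + j) = 0"
        using z dgrD(2)[of "s - 1" z i j] ij False by (cases "s = 0") (auto simp: ptw)
      moreover have "mop xiM w (i * l' + j) = 0"
        using xi_at[OF dgrD(1)[OF wd] ij] False w[of "Suc i" j] w[of i "Suc j"] ij by (simp del: mult_Suc add_Suc_right)
      ultimately show ?thesis by (simp add: ptw)
    qed
  qed
  moreover have "w s = c" using w[of 0 s] s ll r(1) V1.L by simp
  ultimately show ?thesis using wd by auto
qed

text \<open>From degree l on, j > 0 throughout the antidiagonal. At i = l - 1 the equation of the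
  coordinate (i, j - 1) has one term only; the smaller i follow by descent.\<close>

lemma xi_inj:
  assumes v: "dgr s v" and s: "l \<le> s" and z: "mop xiM v = 0"
  shows "v = 0"
proof (rule grid_zeroI[OF dgrD(1)[OF v]])
  have step: "v (i * l' + j) = 0" if ij: "i < l" "j < l'" "i + j = s"
      and IH: "Suc i < l \<Longrightarrow> v (Suc i * l' + (j - 1)) = 0" for i j
  proof -
    have j: "0 < j" "j - 1 < l'" "Suc (j - 1) = j" using ij s by auto
    have "mop xiM v (i * l' + (j - 1)) = V1.lc X * q ^ i * al2 j * v (i * l' + j)"
      using xi_at[OF dgrD(1)[OF v] ij(1) j(2)] IH ij(2) unfolding j(3) by (simp del: mult_Suc)
    then show ?thesis using z al2_nz[OF j(1) ij(2)] lc1 by (simp add: ptw)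
  qed
  have main: "v (i * l' + j) = 0" if "l - 1 - i = k" "i < l" "j < l'" "i + j = s" for i j k
    using that
  proof (induction k arbitrary: i j)
    case 0
    show ?case by (rule step) (use 0 in auto)
  next
    case (Suc k)
    show ?case
    proof (rule step)
      assume "Suc i < l"
      then show "v (Suc i * l' + (j - 1)) = 0" using Suc.prems s by (intro Suc.IH) auto
    qed (use Suc.prems in auto)
  qed
  fix i j assume "i < l" "j < l'"
  then show "v (i * l' + j) = 0" using main[of i "l - 1 - i" j] dgrD(2)[OF v] by (cases "i + j = s") auto
qed

text \<open>For s + 1 < l' every coordinate (i, j + 1) with i + j = s and i < l exists; these
  equations kill the coefficients upwards from i = 0.\<close>

lemma x_inj:
  assumes v: "dgr s v" and s: "Suc s < l'" and z: "mop xM v = 0"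
  shows "v = 0"
proof (rule grid_zeroI[OF dgrD(1)[OF v]])
  have main: "v (i * l' + j) = 0" if "i < l" "i + j = s" for i j
    using that
  proof (induction i arbitrary: j)
    case 0
    then show ?case
      using x_at[OF dgrD(1)[OF v], of 0 "Suc j"] s z V1.L by (simp add: ptw)
  next
    case (Suc i)
    then have "v (i * l' + Suc j) = 0" by (intro Suc.IH) auto
    then show ?case
      using x_at[OF dgrD(1)[OF v], of "Suc i" "Suc j"] Suc.prems s z by (simp add: ptw)
  qed
  fix i j assume "i < l" "j < l'"
  then show "v (i * l' + j) = 0" using main[of i j] dgrD(2)[OF v] by (cases "i + j = s") auto
qed

lemma x_pow_inj: "dgr s v \<Longrightarrow> v \<noteq> 0 \<Longrightarrow> s + k < l' \<Longrightarrow> (mop xM ^^ k) v \<noteq> 0"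
proof (induction k)
  case (Suc k)
  then show ?case using x_inj[OF dgr_x_pow[OF Suc.prems(1), of k]] by auto
qed simp

end

section \<open>The decomposition\<close>

lemma (in vmod) V_ker_xi:
  assumes v: "v \<in> fsp L" and z: "app V xi_el v = 0"
  shows "v = v 0 *s bas 0"
proof -
  let ?al = "alq (lg a) (lc X)"
  have e: "app V xi_el v = (\<lambda>k. if Suc k < L then ?al (Suc k) * v (Suc k) else 0)"
  proof (rule lin_ext[where T = "app V xi_el" and S = "\<lambda>v k. if Suc k < L then ?al (Suc k) * v (Suc k) else 0", OF _ _ _ v])
    show "lin (\<lambda>v k. if Suc k < L then ?al (Suc k) * v (Suc k) else 0)"
      by (auto simp: lin_def fun_eq_iff ptw algebra_simps)
    fix j assume "j < L"
    then show "app V xi_el (bas j) = (\<lambda>k. if Suc k < L then ?al (Suc k) * bas j (Suc k) else 0)"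
      unfolding V_bas(4)[OF \<open>j < L\<close>] by (cases j) (auto simp: bas_def fun_eq_iff ptw)
  qed auto
  have "v k = 0" if k: "0 < k" for k
  proof (cases "k < L")
    case True
    have "?al (Suc (k - 1)) * v (Suc (k - 1)) = 0"
      using fun_cong[OF z, of "k - 1"] k True by (simp add: e ptw)
    moreover have "?al k \<noteq> 0"
      using alq_nz[OF \<mu>L charwD(2)[OF cw closed(2)] L k] True L by simp
    ultimately show ?thesis using k by simp
  qed (use v in \<open>simp add: fsp_def\<close>)
  then show ?thesis by (auto simp: fun_eq_iff ptw bas_def)
qed

text \<open>\<xi> lowers the index of basis vectors. The relation \<xi>^n = 0 cannot be quoted,
  since at this stage \<open>P\<close> is only a \<open>pre_module\<close>.\<close>

lemma (in pmod) P_xi_nil: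
  assumes "v \<in> fsp (2 * n)"
  shows "(app P xi_el ^^ (2 * n)) v = 0"
proof -
  have low: "app P xi_el v \<in> fsp e" if v: "v \<in> fsp (Suc e)" for v e
  proof -
    have v0: "v i = 0" if "e < i" for i using v that by (simp add: fsp_def)
    have "app P xi_el v k = 0" if k: "e \<le> k" for k
    proof (cases "k < n")
      case True
      then show ?thesis using k m by (simp add: P_xi_at(1) v0)
    next
      case False
      show ?thesis
      proof (cases "k < 2 * n")
        case True
        then show ?thesis using P_xi_at(2)[of "k - n" v] k False v0 by simp
      next
        case False
        have "app P xi_el v \<in> fsp (2 * n)" using app_fsp[OF P_pre, of xi_el v] by simp
        then show ?thesis using False by (simp add: fsp_def)
      qed
    qed
    then show ?thesis by (simp add: fsp_def)
  qed
  have "(app P xi_el ^^ e) v = 0" if "v \<in> fsp e" for v e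
    using that
  proof (induction e arbitrary: v)
    case 0
    then show ?case by (auto simp: fsp_def fun_eq_iff ptw)
  next
    case (Suc e)
    then show ?case using low by (simp add: funpow_swap1)
  qed
  then show ?thesis using assms by blast
qed

lemma sum_list_arith_progression:
  assumes "2 * k \<le> c + 1"
  shows "(\<Sum>s\<leftarrow>[0..<k]. c - 2 * s) = k * (c + 1 - k)"
  using assms
proof (induction k)
  case (Suc k)
  define d where "d = c - (2 * k + 1)"
  have "c = 2 * k + 1 + d" using Suc.prems by (simp add: d_def)
  then show ?case using Suc by (simp add: algebra_simps)
qed simp

text \<open>Each of the t + 1 degrees counts n: a pair t - s, s with t < 2s carries a module of
  dimension 2n, the fixed point 2s = t one of dimension n.\<close>

lemma sum_list_upper_half:
  "(\<Sum>s\<leftarrow>[(t + 1) div 2..<t + 1]. if 2 * s = t then n else 2 * n) = (t + 1) * (n::nat)"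
proof (cases "even t")
  case True
  then obtain c where t: "t = 2 * c" by blast
  have "map (\<lambda>s. if 2 * s = 2 * c then n else 2 * n) [Suc c..<2 * c + 1] = map (\<lambda>_. 2 * n) [Suc c..<2 * c + 1]"
    by (rule map_cong) auto
  then have "(\<Sum>s\<leftarrow>[Suc c..<2 * c + 1]. if 2 * s = 2 * c then n else 2 * n) = (\<Sum>s\<leftarrow>[Suc c..<2 * c + 1]. 2 * n)"
    by (simp only:)
  then have "(\<Sum>s\<leftarrow>[Suc c..<2 * c + 1]. if 2 * s = 2 * c then n else 2 * n) = c * (2 * n)"
    by (simp only: sum_list_triv) simp
  moreover have "[(t + 1) div 2..<t + 1] = c # [Suc c..<2 * c + 1]"
    using t upt_conv_Cons[of c "2 * c + 1"] by simp
  ultimately show ?thesis using t by (simp add: algebra_simps)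
next
  case False
  have "map (\<lambda>s. if 2 * s = t then n else 2 * n) [(t + 1) div 2..<t + 1] = map (\<lambda>_. 2 * n) [(t + 1) div 2..<t + 1]"
    by (rule map_cong) (use False in auto)
  then have "(\<Sum>s\<leftarrow>[(t + 1) div 2..<t + 1]. if 2 * s = t then n else 2 * n) = (\<Sum>s\<leftarrow>[(t + 1) div 2..<t + 1]. 2 * n)"
    by (simp only:)
  then have "(\<Sum>s\<leftarrow>[(t + 1) div 2..<t + 1]. if 2 * s = t then n else 2 * n) = (t + 1 - (t + 1) div 2) * (2 * n)"
    by (simp only: sum_list_triv) simp
  also have "2 * (t + 1 - (t + 1) div 2) = t + 1" using False by presburger
  then have "(t + 1 - (t + 1) div 2) * (2 * n) = (t + 1) * n" by (metis mult.assoc mult.commute)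
  finally show ?thesis .
qed

lemma mdim_dd_sum_map: "mdim (dd_sum (map N xs)) = (\<Sum>s\<leftarrow>xs. mdim (N s))"
  by (simp add: dd_sum_def comp_def)

lemma (in datum) Lam_mult_at:
  "g \<in> GG \<Longrightarrow> at_G D (\<mu> \<otimes>\<^bsub>Lam D\<^esub> \<nu>) g = at_G D \<mu> g * at_G D \<nu> g"
  "\<gamma> \<in> CC \<Longrightarrow> at_Gam D (\<mu> \<otimes>\<^bsub>Lam D\<^esub> \<nu>) \<gamma> = at_Gam D \<mu> \<gamma> * at_Gam D \<nu> \<gamma>"
  by (simp_all add: char_group_simps(1)[where H = "grp D \<times>\<times> Gam D"])

context tens
begin

interpretation M: nilrep D N kgM kcM xiM xM by (rule M_nilrep)

abbreviation "lgT \<equiv> \<lambda>g. V1.lg g * V2.lg g"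
abbreviation "lcT \<equiv> \<lambda>\<gamma>. V1.lc \<gamma> * V2.lc \<gamma>"
abbreviation "nu s \<equiv> phi D [^]\<^bsub>Lam D\<^esub> (s::nat) \<otimes>\<^bsub>Lam D\<^esub> \<mu> \<otimes>\<^bsub>Lam D\<^esub> \<mu>'"
abbreviation "len s \<equiv> l + l' - 1 - 2 * s"

lemma charw_T: "charw lgT lcT"
  using V1.cw V2.cw by (auto simp: charw_def power_mult_distrib)

lemma nu_at: "g \<in> GG \<Longrightarrow> at_G D (nu s) g = upg s lgT g" "\<gamma> \<in> CC \<Longrightarrow> at_Gam D (nu s) \<gamma> = upc s lcT \<gamma>"
  by (simp_all add: Lam_mult_at(1)[of _ _ \<mu>'] Lam_mult_at(2)[of _ _ \<mu>'] phi_at[OF V1.\<mu>])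
    (simp_all add: upg_def upc_def)

text \<open>The exponent may reach n: for t - s in place of s, with m = 2s - t, it is n + m - 1,
  which gives the weight condition of u.\<close>

lemma T_rel:
  assumes "s < l"
  shows "upg s lgT a = upc s lcT X * q ^ (len s - 1)"
proof -
  have "l - 1 + (l' - 1) = s + s + (len s - 1)" using assms ll by linarith
  then have "q ^ (l - 1) * q ^ (l' - 1) = q ^ s * q ^ s * q ^ (len s - 1)" by (metis power_add)
  then have "lgT a = lcT X * (q ^ s * q ^ s * q ^ (len s - 1))" using V1.\<mu>L V2.\<mu>L by (simp add: mult_ac)
  then show ?thesis by (simp add: shift_a field_simps)
qed

lemma nu_vmod:
  assumes s: "s < l" and L: "len s \<le> n"
  shows "vmod D (len s) (nu s)"
proof (intro vmod.intro vmod_axioms.intro datum_axioms)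
  show "nu s \<in> carrier (Lam D)" by (intro Lam_closed V1.\<mu> V2.\<mu>)
  show "1 \<le> len s" using s ll by linarith
  show "at_G D (nu s) a = at_Gam D (nu s) X * q ^ (len s - 1)"
    unfolding nu_at(1)[OF closed(1)] nu_at(2)[OF closed(2)] by (rule T_rel[OF s])
qed (rule L)

lemma dgr_wtm: "dgr s v \<Longrightarrow> wtm M1 (upg s lgT) (upc s lcT) v"
  using dgr_wt by (simp add: M1_act)

lemma M1_y_pow: "v \<in> fsp N \<Longrightarrow> (app M1 y_term ^^ k) v = (mop xM ^^ k) v"
proof -
  assume v: "v \<in> fsp N"
  have "(mop xM ^^ k) v \<in> fsp N \<and> (app M1 y_term ^^ k) v = (mop xM ^^ k) v"
    by (induction k) (use v in \<open>simp_all add: M1_y\<close>)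
  then show ?thesis ..
qed

lemma highest_weight_vector_ex: "s < l \<Longrightarrow> \<exists>h. dgr s h \<and> mop xiM h = 0 \<and> h \<noteq> 0"
proof -
  assume "s < l"
  then obtain h where "dgr s h" "mop xiM h = 0" "h s = 1"
    using xi_solve[of s 0 1] by (auto simp: dgr_def ptw)
  then show ?thesis by (intro exI[of _ h]) (auto simp: ptw)
qed

text \<open>\<xi> kills this vector because the constant of index \<open>len s\<close> is 0, and its
  degree s + \<open>len s\<close> is at least l, where \<xi> is injective.\<close>

lemma highest_weight_vector_top:
  assumes s: "s < l" and h: "dgr s h" "mop xiM h = 0"
  shows "(mop xM ^^ len s) h = 0"
proof (rule xi_inj[OF dgr_x_pow[OF h(1)]])
  show "l \<le> s + len s" using s ll by linarith
  show "mop xiM ((mop xM ^^ len s) h) = 0"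
    using M.xi_y_pow[OF dgr_wt[OF h(1)], of "len s"] alq_z[OF T_rel[OF s]] h(2) by simp
qed

lemma emb_V:
  assumes s: "s < l" and L: "len s \<le> n"
  shows "emb D M1 dg (V_mod D (len s) (nu s)) {s}"
proof -
  interpret Vs: vmod D "len s" "nu s" by (rule nu_vmod[OF s L])
  obtain h where h: "dgr s h" "mop xiM h = 0" "h \<noteq> 0" using highest_weight_vector_ex[OF s] by blast
  note hN = dgrD(1)[OF h(1)]
  let ?c = "\<lambda>j. (app M1 y_term ^^ j) h"
  define F where "F = cols_mat (mdim M1) (len s) ?c"
  have "M.wt (at_G D (nu s)) (at_Gam D (nu s)) h"
    by (rule M.wt_cong[OF dgr_wt[OF h(1)]]) (simp_all add: nu_at)
  then have w: "wtm M1 (at_G D (nu s)) (at_Gam D (nu s)) h" by (simp add: M1_act)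
  have F: "F \<in> dd_hom D Vs.V M1"
    unfolding F_def by (rule Vs.V_hom[OF M1_module w]) (simp_all only: M1_act h(2) M1_y_pow[OF hN] highest_weight_vector_top[OF s h(1,2)])
  have F0: "mop F (bas 0) = h" using Vs.L hN by (simp add: F_def mop_cols_mat)
  have Fv: "mop F v = v 0 *s h" if "v \<in> fsp (mdim Vs.V)" "app Vs.V xi_el v = 0" for v
  proof -
    have "v = v 0 *s bas 0" by (rule Vs.V_ker_xi) (use that in \<open>simp_all only: Vs.V_dim\<close>)
    then have "mop F v = mop F (v 0 *s bas 0)" by simp
    then show ?thesis using F0 by simp
  qed
  show ?thesis
  proof (rule embI[OF M1_module Vs.V_pre F])
    fix v :: "nat \<Rightarrow> 'k" assume v: "v \<in> fsp (mdim Vs.V)"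
    show "\<exists>k. (app Vs.V xi_el ^^ k) v = 0" using module_xi_n[OF Vs.V_module v] by blast
    assume z: "app Vs.V xi_el v = 0"
    show "dg k \<in> {s}" if "mop F v k \<noteq> 0" for k
      using dgr_dg[OF h(1), of k] that by (auto simp: Fv[OF v z] ptw)
    obtain k where "h k \<noteq> 0" using h(3) by (auto simp: fun_eq_iff ptw)
    moreover assume "mop F v = 0"
    then have "v 0 * h k = 0" by (auto simp: Fv[OF v z] fun_eq_iff ptw)
    ultimately have "v 0 = 0" by simp
    then show "v = 0" using Vs.V_ker_xi[OF v[unfolded Vs.V_dim] z] by simp
  qed
qed

lemma emb_P:
  assumes t: "l + l' = n + 1 + t" and s: "s \<le> t" "t < 2 * s"
  shows "emb D M1 dg (P_mod D (len s) (nu s)) {t - s, s} \<and> mdim (P_mod D (len s) (nu s)) = 2 * n"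
proof -
  \<comment> \<open>u will have degree t - s and w degree s; then \<open>len s\<close> = n - m is
    the dimension of the head, and \<open>len (t - s)\<close> = n + m.\<close>
  define m where "m = 2 * s - t"
  let ?lg = "upg (t - s) lgT" and ?lc = "upc (t - s) lcT"
  have sl: "s < l" "t - s < l" "s < l'" using t s ll by linarith+
  have m: "1 \<le> m" "m < n" "t - s + m = s" "t - s + (m - 1) = s - 1" "m + (t - s) = s"
    "len (t - s) - 1 = n + (m - 1)" "len s = n - m"
    using t s ll sl unfolding m_def by linarith+
  have lm: "?lg a = ?lc X * q ^ (m - 1)"
    using T_rel[OF sl(2)] unfolding m(6) by (simp add: power_add)
  interpret Ps: pmod D m ?lg ?lc
    by (intro pmod.intro pmod_axioms.intro datum_axioms charw_up charw_T m(1,2) lm)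
  obtain u where u: "dgr (t - s) u" "mop xiM u = 0" "u \<noteq> 0" using highest_weight_vector_ex[OF sl(2)] by blast
  note uN = dgrD(1)[OF u(1)]
  have "dgr (s - 1) ((mop xM ^^ (m - 1)) u)" using dgr_x_pow[OF u(1), of "m - 1"] m(4) by simp
  then obtain w where w: "dgr s w" "mop xiM w = (mop xM ^^ (m - 1)) u"
    using xi_solve[OF sl(1), of "(mop xM ^^ (m - 1)) u" 0] s by auto
  note wN = dgrD(1)[OF w(1)]
  have "wtm M1 (upg m ?lg) (upc m ?lc) w" using dgr_wtm[OF w(1)] by (simp only: shift_up m(5))
  then obtain F where F: "F \<in> dd_hom D Ps.P M1" "\<And>i. i < n \<Longrightarrow> mop F (bas i) = (app M1 y_term ^^ i) u"
    using Ps.P_hom[OF M1_module dgr_wtm[OF u(1)], of w] u(2) w(2)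
    by (auto simp: M1_act M1_y_pow[OF uN] M1_y_pow[OF wN] xM_n uN wN)
  \<comment> \<open>The second vector in the kernel of \<xi>. It is nonzero because the degrees from
    t - s to s stay below l', where y is injective.\<close>
  define u' where "u' = (mop xM ^^ m) u"
  have u': "dgr s u'" "u' \<noteq> 0"
    using dgr_x_pow[OF u(1), of m] x_pow_inj[OF u(1,3), of m] m(3) sl(3) by (simp_all add: u'_def)
  have Fv: "mop F v = v 0 *s u + v m *s u'" if "v \<in> fsp (mdim Ps.P)" "app Ps.P xi_el v = 0" for v
  proof -
    have "v = v 0 *s bas 0 + v m *s bas m" using Ps.P_ker_xi that by simp
    then have "mop F v = mop F (v 0 *s bas 0 + v m *s bas m)" by simp
    then show ?thesis using F(2)[of 0] F(2)[OF m(2)] m(1,2) by (simp add: M1_y_pow[OF uN] u'_def)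
  qed
  have e: "emb D M1 dg Ps.P {t - s, s}"
  proof (rule embI[OF M1_module Ps.P_pre F(1)])
    fix v :: "nat \<Rightarrow> 'k" assume v: "v \<in> fsp (mdim Ps.P)"
    show "\<exists>k. (app Ps.P xi_el ^^ k) v = 0" using Ps.P_xi_nil v by auto
    assume z: "app Ps.P xi_el v = 0"
    show "dg k \<in> {t - s, s}" if "mop F v k \<noteq> 0" for k
    proof -
      have "u k \<noteq> 0 \<or> u' k \<noteq> 0" using that by (auto simp: Fv[OF v z] ptw)
      then show ?thesis using dgr_dg[OF u(1), of k] dgr_dg[OF u'(1), of k] by auto
    qed
    assume "mop F v = 0"
    then have 0: "v 0 * u k + v m * u' k = 0" for k by (simp add: Fv[OF v z] fun_eq_iff ptw)
    have ne: "t - s \<noteq> s" using s by linarith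
    obtain k where k: "u k \<noteq> 0" using u(3) by (auto simp: fun_eq_iff ptw)
    then have "u' k = 0" using dgr_dg[OF u(1), of k] dgr_dg[OF u'(1), of k] ne by auto
    then have v0: "v 0 = 0" using 0[of k] k by simp
    obtain k' where "u' k' \<noteq> 0" using u'(2) by (auto simp: fun_eq_iff ptw)
    then have vm: "v m = 0" using 0[of k'] v0 by simp
    show "v = 0" using Ps.P_ker_xi[of v] v z by (simp add: v0 vm)
  qed
  \<comment> \<open>The embedding just found shows that \<open>P\<close> is a module, which is the
    standing assumption of \<open>pcov\<close>.\<close>
  have "pcov D m ?lg ?lc (nu s)"
  proof (intro pcov.intro pcov_axioms.intro Ps.pmod_axioms)
    show "vmod D (n - m) (nu s)" using nu_vmod[OF sl(1)] m(7) by simp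
    show "dd_module D Ps.P" using e by (simp add: emb_def)
  qed (simp_all add: nu_at shift_up m(5))
  then have c: "projective_cover D Ps.P (V_mod D (len s) (nu s))"
    unfolding m(7) by (rule pcov.cover)
  have "P_mod D (len s) (nu s) = (SOME P. projective_cover D P (V_mod D (len s) (nu s)))"
    using m(1,2,7) by (simp add: P_mod_def)
  then have "projective_cover D (P_mod D (len s) (nu s)) (V_mod D (len s) (nu s))"
    using someI[of "\<lambda>P. projective_cover D P (V_mod D (len s) (nu s))", OF c] by simp
  then have i: "dd_iso D (P_mod D (len s) (nu s)) Ps.P" by (rule projective_cover_unique[OF _ c])
  show ?thesis using emb_iso[OF M1_module e i] dd_iso_mdim[OF i] by simp
qed

lemma mdim_V_mod: "mdim (V_mod D L \<nu>) = L"
  by (simp add: V_mod_def)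

lemma decomposition_small:
  assumes "l + l' \<le> n"
  shows "dd_iso D T (dd_sum (map (\<lambda>s. V_mod D (len s) (nu s)) [0..<l]))"
proof -
  let ?S = "dd_sum (map (\<lambda>s. V_mod D (len s) (nu s)) [0..<l])"
  have "emb D M1 dg ?S (\<Union>s\<in>set [0..<l]. {s})"
  proof (rule emb_list[OF M1_module])
    show "emb D M1 dg (V_mod D (len s) (nu s)) {s}" if "s \<in> set [0..<l]" for s
      by (rule emb_V) (use that assms in auto)
  qed auto
  moreover have "mdim ?S = mdim M1"
    using sum_list_arith_progression[of l "l + l' - 1"] ll V1.L by (simp add: mdim_dd_sum_map mdim_V_mod)
  ultimately show ?thesis by (rule dd_iso_trans[OF T_iso emb_dd_iso[OF M1_module]])
qed

lemma decomposition_large: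
  assumes t: "l + l' = n + 1 + t"
  shows "dd_iso D T (dd_sum [dd_sum (map (\<lambda>s. P_mod D (len s) (nu s)) [(t + 1) div 2..<t + 1]),
    dd_sum (map (\<lambda>s. V_mod D (len s) (nu s)) [t + 1..<l])])"
proof -
  let ?A = "dd_sum (map (\<lambda>s. P_mod D (len s) (nu s)) [(t + 1) div 2..<t + 1])"
  let ?B = "dd_sum (map (\<lambda>s. V_mod D (len s) (nu s)) [t + 1..<l])"
  have tl: "t + 1 \<le> l" "t + 1 \<le> n" using t ll by linarith+
  have P: "emb D M1 dg (P_mod D (len s) (nu s)) {t - s, s} \<and>
      mdim (P_mod D (len s) (nu s)) = (if 2 * s = t then n else 2 * n)"
    if s: "s \<in> set [(t + 1) div 2..<t + 1]" for s
  proof (cases "2 * s = t")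
    case True
    \<comment> \<open>The two degrees coincide, and \<open>P_mod\<close> of length n is by
      definition the simple module.\<close>
    have L: "len s = n" and e: "{t - s, s} = {s}" and sl: "s < l" using t True tl by auto
    show ?thesis using emb_V[OF sl] True unfolding L e by (simp add: P_mod_def mdim_V_mod)
  next
    case False
    have "s \<le> t" "t < 2 * s" using s False by auto
    then show ?thesis using emb_P[OF t, of s] False by simp
  qed
  have A: "emb D M1 dg ?A (\<Union>s\<in>set [(t + 1) div 2..<t + 1]. {t - s, s})"
  proof (rule emb_list[OF M1_module])
    fix s s' assume "s \<in> set [(t + 1) div 2..<t + 1]" "s' \<in> set [(t + 1) div 2..<t + 1]" "s \<noteq> s'"
    \<comment> \<open>s lies in the upper half of 0, ..., t and t - s in the lower half, so
      different s give disjoint pairs.\<close>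
    then have "t - s \<noteq> t - s'" "t - s \<noteq> s'" "s \<noteq> t - s'" "s \<noteq> s'" by auto
    then show "{t - s, s} \<inter> {t - s', s'} = {}" by simp
  qed (use P in auto)
  have B: "emb D M1 dg ?B (\<Union>s\<in>set [t + 1..<l]. {s})"
  proof (rule emb_list[OF M1_module])
    show "emb D M1 dg (V_mod D (len s) (nu s)) {s}" if "s \<in> set [t + 1..<l]" for s
      by (rule emb_V) (use that t in auto)
  qed auto
  have AB: "emb D M1 dg (dd_sum [?A, ?B]) ((\<Union>s\<in>set [(t + 1) div 2..<t + 1]. {t - s, s}) \<union> (\<Union>s\<in>set [t + 1..<l]. {s}))"
    by (rule emb_pair[OF M1_module A B]) auto
  have "mdim ?A = (\<Sum>s\<leftarrow>[(t + 1) div 2..<t + 1]. if 2 * s = t then n else 2 * n)"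
    unfolding mdim_dd_sum_map using P by (intro arg_cong[where f = sum_list] map_cong HOL.refl) blast
  then have dA: "mdim ?A = (t + 1) * n" by (simp only: sum_list_upper_half)
  have c: "l + l' - 1 + 1 - l = l'" "l + l' - 1 + 1 - (t + 1) = n" using t V1.L by linarith+
  \<comment> \<open>The numbers \<open>len s\<close> over all s < l add up to the product of l and
    l', and those with s \<le> t to (t + 1) n, which is also the dimension of the projective part;
    the rest is the dimension of \<open>?B\<close>.\<close>
  have "[0..<l] = [0..<t + 1] @ [t + 1..<l]" using upt_add_eq_append[of 0 "t + 1" "l - (t + 1)"] tl by simp
  then have "(\<Sum>s\<leftarrow>[0..<l]. len s) = (\<Sum>s\<leftarrow>[0..<t + 1]. len s) + (\<Sum>s\<leftarrow>[t + 1..<l]. len s)"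
    by (metis map_append sum_list_append)
  moreover have "(\<Sum>s\<leftarrow>[0..<l]. len s) = l * l'"
    using sum_list_arith_progression[of l "l + l' - 1"] c(1) ll by simp
  moreover have "(\<Sum>s\<leftarrow>[0..<t + 1]. len s) = (t + 1) * n"
    using sum_list_arith_progression[of "t + 1" "l + l' - 1"] t tl unfolding c(2) by simp
  moreover have "mdim ?B = (\<Sum>s\<leftarrow>[t + 1..<l]. len s)" by (simp add: mdim_dd_sum_map mdim_V_mod)
  ultimately have "mdim (dd_sum [?A, ?B]) = mdim M1" using dA by simp
  then show ?thesis by (rule dd_iso_trans[OF T_iso emb_dd_iso[OF M1_module AB]])
qed

end

theorem theorem5p2:
  fixes D :: "('g, 'k::{alg_closed_field, field_char_0}) group_datum"
    and l l' :: nat and t :: int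
    and \<mu> \<mu>' :: "'g \<times> ('g \<Rightarrow> 'k) \<Rightarrow> 'k"
  assumes "is_group_datum D"
    and "1 \<le> l" and "l \<le> l'" and "l' < nn D"
    and "\<mu> \<in> I_set D l" and "\<mu>' \<in> I_set D l'"
    and "t = int l + int l' - int (nn D) - 1"
  shows "(t < 0 \<longrightarrow>
      dd_iso D (dd_tensor D (V_mod D l \<mu>) (V_mod D l' \<mu>'))
        (dd_sum (map (\<lambda>s. V_mod D (l + l' - 1 - 2 * s)
            (phi D [^]\<^bsub>Lam D\<^esub> s \<otimes>\<^bsub>Lam D\<^esub> \<mu> \<otimes>\<^bsub>Lam D\<^esub> \<mu>')) [0..<l]))) \<and>
    (t \<ge> 0 \<longrightarrow>
      dd_iso D (dd_tensor D (V_mod D l \<mu>) (V_mod D l' \<mu>'))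
        (dd_sum
          [dd_sum (map (\<lambda>s. P_mod D (l + l' - 1 - 2 * s)
             (phi D [^]\<^bsub>Lam D\<^esub> s \<otimes>\<^bsub>Lam D\<^esub> \<mu> \<otimes>\<^bsub>Lam D\<^esub> \<mu>')) [nat (cc t)..<nat t + 1]),
           dd_sum (map (\<lambda>s. V_mod D (l + l' - 1 - 2 * s)
             (phi D [^]\<^bsub>Lam D\<^esub> s \<otimes>\<^bsub>Lam D\<^esub> \<mu> \<otimes>\<^bsub>Lam D\<^esub> \<mu>')) [nat t + 1..<l])]))"
proof -
  interpret datum D by (rule datum.intro[OF assms(1)])
  interpret tens D l \<mu> l' \<mu>'
    using assms(2-4) I_setD[OF assms(5)] I_setD[OF assms(6)] by unfold_locales auto
  show ?thesis
  proof (intro conjI impI)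
    assume "t < 0"
    then show "dd_iso D T (dd_sum (map (\<lambda>s. V_mod D (len s) (nu s)) [0..<l]))"
      using assms(7) by (intro decomposition_small) linarith
  next
    assume t: "0 \<le> t"
    have "nat (cc t) = (nat t + 1) div 2" using t by (simp add: cc_def nat_div_distrib nat_add_distrib)
    moreover have "l + l' = n + 1 + nat t" using t assms(7) by linarith
    ultimately show "dd_iso D T (dd_sum [dd_sum (map (\<lambda>s. P_mod D (len s) (nu s)) [nat (cc t)..<nat t + 1]),
        dd_sum (map (\<lambda>s. V_mod D (len s) (nu s)) [nat t + 1..<l])])"
      using decomposition_large by simp
  qed
qed

end
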